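(* For every real number $\beta<1$, $$\lim_{n\to\infty}\ \frac{\exp\big((\log n)^{\beta}\big)}{n}\sum_{1\le k<N_n-1}L(n,k)=0\qquad\mathbb P\text{-almost surely}.$$ In particular, $$\liminf_{n\to\infty}\ \frac1n\,\sup_{k\ge1}L(n,k)\ \ge\ \frac12\qquad\mathbb P\text{-almost surely}.$$
   Context: $\mathbb Z_+=\{0,1,2,\dots\}$. Let $\omega=(\omega_x)_{x\in\mathbb Z_+}$ be i.i.d. random variables with values in $(0,1)$; the law of $\omega$ is $P$ (expectation $E$). For $i\ge1$ put $\rho_i=(1-\omega_i)/\omega_i$. Standing assumptions: $E(\log\rho_1)=0$; $\mathrm{Var}(\log\rho_1)>0$; there is $\delta\in(0,1)$ with $P(\delta\le\omega_1\le1-\delta)=1$. Potential: $V(0)=0$, $V(x)=\sum_{i=1}^x\log\rho_i$ for $x\ge1$. Valleys: fix a constant $K_0>0$. Let $\eta_0=\inf\{i>0: V(i)-\min_{0\le j\le i}V(j)\ge K_0\}$ and $b_0=\sup\{i<\eta_0: V(i)=\min_{0\le j\le\eta_0}V(j)\}$. Inductively for $k\ge1$: $\theta_k=\inf\{i>\eta_{k-1}: V(i)\le V(b_{k-1})\}$; $H_{k-1}^+=\max_{\eta_{k-1}\le j\le\theta_k}V(j)-V(b_{k-1})$; $\eta_k=\inf\{i>\theta_k: V(i)-\min_{0\le j\le i}V(j)\ge H_{k-1}^+\}$; $b_k=\sup\{i<\eta_k: V(i)=\min_{\theta_k\le j\le\eta_k}V(j)\}$. The beginning of the $k$-th valley ($k\ge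 1$) is $m_k=\inf\{i\ge\eta_{k-1}: V(i)=\max_{\eta_{k-1}\le j\le\theta_k}V(j)\}$. (All these quantities are $P$-a.s. finite.) Walk: given $\omega$, $(X_n)_{n\ge0}$ is the Markov chain on $\mathbb Z_+$ with $X_0=0$, $P_\omega(X_{n+1}=1\mid X_n=0)=1$ and, for $x>0$, $P_\omega(X_{n+1}=x+1\mid X_n=x)=\omega_x=1-P_\omega(X_{n+1}=x-1\mid X_n=x)$; $\mathbb P$ is the joint law of $(\omega,(X_n))$. Local time: $\xi(n,x)=|\{0\le j\le n:X_j=x\}|$. Occupation time of the $k$-th valley: $L(n,k)=\sum_{x\in[m_k,m_{k+1})}\xi(n,x)$, $k\ge1$. Number of valleys seen by time $n$: $N_n=\sup\{k\ge 1:\max_{0\le i\le n}X_i\ge m_k\}$ (with $\sup\emptyset=0$). *)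

theory Defs
  imports "HOL-Probability.Probability"
begin

section \<open>Environment and potential\<close>

text \<open>An environment is a sequence \<open>w :: nat \<Rightarrow> real\<close>. The environment is i.i.d. with
  one-site law \<open>mu\<close>, so its law is the product measure \<open>env_law mu\<close>.\<close>

definition env_law :: "real measure \<Rightarrow> (nat \<Rightarrow> real) measure" where
  "env_law mu = (\<Pi>\<^sub>M i\<in>UNIV. mu)"

definition rho :: "(nat \<Rightarrow> real) \<Rightarrow> nat \<Rightarrow> real" where
  "rho w i = (1 - w i) / w i"

definition potential :: "(nat \<Rightarrow> real) \<Rightarrow> nat \<Rightarrow> real" where
  "potential w x = (\<Sum>i = 1..x. ln (rho w i))"


section \<open>Valleys of a function \<open>V\<close>\<close>

text \<open>Infima and suprema are those of \<open>nat\<close>. They carry their intended meaning only where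
  the corresponding set is nonempty (for \<open>Inf\<close>) or finite (for \<open>Sup\<close>), which holds almost
  surely for the potential under the standing assumptions; \<open>Sup {} = 0\<close>.
  \<open>Hplus V K0 k\<close> is the height \<open>H\<^sub>k\<^sup>+\<close>. The value \<open>theta V K0 0\<close> has no mathematical
  meaning and is not used below.\<close>

function eta :: "(nat \<Rightarrow> real) \<Rightarrow> real \<Rightarrow> nat \<Rightarrow> nat"
  and bottom :: "(nat \<Rightarrow> real) \<Rightarrow> real \<Rightarrow> nat \<Rightarrow> nat"
  and theta :: "(nat \<Rightarrow> real) \<Rightarrow> real \<Rightarrow> nat \<Rightarrow> nat"
  and Hplus :: "(nat \<Rightarrow> real) \<Rightarrow> real \<Rightarrow> nat \<Rightarrow> real"
where
  "eta V K0 0 = Inf {i. 0 < i \<and> V i - Min (V ` {0..i}) \<ge> K0}"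
| "eta V K0 (Suc k) = Inf {i. theta V K0 (Suc k) < i \<and> V i - Min (V ` {0..i}) \<ge> Hplus V K0 k}"
| "bottom V K0 0 = Sup {i. i < eta V K0 0 \<and> V i = Min (V ` {0..eta V K0 0})}"
| "bottom V K0 (Suc k) = Sup {i. i < eta V K0 (Suc k) \<and>
     V i = Min (V ` {theta V K0 (Suc k)..eta V K0 (Suc k)})}"
| "theta V K0 0 = 0"
| "theta V K0 (Suc k) = Inf {i. eta V K0 k < i \<and> V i \<le> V (bottom V K0 k)}"
| "Hplus V K0 k = Max (V ` {eta V K0 k..theta V K0 (Suc k)}) - V (bottom V K0 k)"
  by pat_completeness auto
termination
  by (relation "Wellfounded.measure (case_sum (case_sum (\<lambda>(V, K0, k). 4 * k) (\<lambda>(V, K0, k). 4 * k + 1))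
        (case_sum (\<lambda>(V, K0, k). 4 * k - 2) (\<lambda>(V, K0, k). 4 * k + 3)))") auto

text \<open>The beginning \<open>m\<^sub>k\<close> of the \<open>k\<close>-th valley, meaningful for \<open>k \<ge> 1\<close> only.\<close>

definition valley_start :: "(nat \<Rightarrow> real) \<Rightarrow> real \<Rightarrow> nat \<Rightarrow> nat" where
  "valley_start V K0 k = Inf {i. eta V K0 (k - 1) \<le> i \<and>
     V i = Max (V ` {eta V K0 (k - 1)..theta V K0 k})}"


section \<open>The walk\<close>

definition path_space :: "(nat \<Rightarrow> nat) measure" where
  "path_space = (\<Pi>\<^sub>M n\<in>UNIV. count_space UNIV)"

definition step_prob :: "(nat \<Rightarrow> real) \<Rightarrow> nat \<Rightarrow> nat \<Rightarrow> real" where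
  "step_prob w x y =
     (if x = 0 then (if y = 1 then 1 else 0)
      else if y = x + 1 then w x
      else if y + 1 = x then 1 - w x
      else 0)"

text \<open>\<open>Q\<close> is the law on path space of the Markov chain started at \<open>0\<close> with transition
  probabilities \<open>step_prob w\<close>.\<close>

definition quenched_chain :: "(nat \<Rightarrow> real) \<Rightarrow> (nat \<Rightarrow> nat) measure \<Rightarrow> bool" where
  "quenched_chain w Q \<longleftrightarrow>
     prob_space Q \<and> sets Q = sets path_space \<and>
     \<P>(X in Q. X 0 = 0) = 1 \<and>
     (\<forall>n h y. \<P>(X in Q. \<forall>i\<le>n. X i = h i) \<noteq> 0 \<longrightarrow>
        \<P>(X in Q. X (Suc n) = y \<bar> \<forall>i\<le>n. X i = h i) = step_prob w (h n) y)"

text \<open>A measurable version \<open>w \<mapsto> Q w\<close> of the quenched law. As for any conditional law, it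
  is only prescribed up to null sets of environments.\<close>

definition quenched_kernel ::
  "real measure \<Rightarrow> ((nat \<Rightarrow> real) \<Rightarrow> (nat \<Rightarrow> nat) measure) \<Rightarrow> bool" where
  "quenched_kernel mu Q \<longleftrightarrow>
     Q \<in> env_law mu \<rightarrow>\<^sub>M prob_algebra path_space \<and>
     (AE w in env_law mu. quenched_chain w (Q w))"

text \<open>The joint law of the environment and the walk.\<close>

definition joint_law ::
  "real measure \<Rightarrow> ((nat \<Rightarrow> real) \<Rightarrow> (nat \<Rightarrow> nat) measure) \<Rightarrow>
     ((nat \<Rightarrow> real) \<times> (nat \<Rightarrow> nat)) measure" where
  "joint_law mu Q =
     env_law mu \<bind> (\<lambda>w. distr (Q w) (env_law mu \<Otimes>\<^sub>M path_space) (\<lambda>X. (w, X)))"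


section \<open>Occupation of valleys by the walk\<close>

definition local_time :: "(nat \<Rightarrow> nat) \<Rightarrow> nat \<Rightarrow> nat \<Rightarrow> nat" where
  "local_time X n x = card {j. j \<le> n \<and> X j = x}"

definition valley_time ::
  "real \<Rightarrow> (nat \<Rightarrow> real) \<Rightarrow> (nat \<Rightarrow> nat) \<Rightarrow> nat \<Rightarrow> nat \<Rightarrow> nat" where
  "valley_time K0 w X n k =
     (\<Sum>x\<in>{valley_start (potential w) K0 k..<valley_start (potential w) K0 (k + 1)}.
        local_time X n x)"

definition valleys_seen ::
  "real \<Rightarrow> (nat \<Rightarrow> real) \<Rightarrow> (nat \<Rightarrow> nat) \<Rightarrow> nat \<Rightarrow> nat" where
  "valleys_seen K0 w X n =
     Sup {k. 1 \<le> k \<and> valley_start (potential w) K0 k \<le> Max (X ` {0..n})}"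

end

theory Submission
  imports Defs "HOL-Real_Asymp.Real_Asymp"
begin

text \<open>The heights \<open>H\<^sub>k\<close> of the valleys are the successive record drawups of the potential. By
  gambler's ruin after the stopping times \<open>\<theta>\<close> and \<open>\<eta>\<close>, each of the events
  ``the new bottom lies less than \<open>H\<^sub>k\<^bsup>1-\<alpha>\<^esup>\<close> below the old one'',
  ``\<open>H\<^sub>k\<^sub>+\<^sub>1 < H\<^sub>k + H\<^sub>k\<^bsup>1-\<alpha>\<^esup>\<close>'' and ``\<open>H\<^sub>k\<^sub>+\<^sub>1 > H\<^sub>k\<^bsup>1+\<alpha>\<^esup>\<close>''
  has conditional probability at most \<open>c H\<^sub>k\<^bsup>-\<alpha>\<^esup>\<close>. Since \<open>H\<^sub>k\<close> doubles with a probability bounded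
  from below, the expectation of \<open>H\<^sub>k\<^bsup>-\<alpha>\<^esup>\<close> decays geometrically, so almost surely these events
  occur only finitely often.

  At times \<open>n\<close> of order \<open>exp j\<close>, let \<open>y\<close> be the first site with a drawup of size slightly above \<open>j\<close>,
  and let \<open>K\<close> be the valley whose height first exceeds it. The walk is unlikely to have reached \<open>y\<close>,
  while by the Green function of the walk killed at \<open>y\<close> it spends at most
  \<open>exp (j - H\<^bsub>K-2\<^esub>\<^bsup>1-\<alpha>\<^esup>)\<close> time, up to polynomial factors, left of the valley \<open>K - 1\<close>. As
  \<open>y\<close> lies before the end of valley \<open>K\<close>, all remaining time is spent in the valleys \<open>K - 1\<close> and \<open>K\<close>.\<close>

section \<open>Valleys of a fixed potential\<close>

text \<open>The gap of the bottoms and the gap of the heights work together in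
  \<open>climb_from_left\<close>: each handles one range of sites, and both yield climbs of at most
  \<open>a - s\<close> from the left of valley \<open>K - 1\<close>, where
  \<open>s = H (K - 2) powr (1 - \<alpha>)\<close>. The upper bound on the growth only turns
  \<open>s\<close> into a power of the level \<open>a\<close>: as \<open>a\<close> is at most
  \<open>H (K - 2)\<close> to the power \<open>(1 + \<alpha>)^2\<close>, every exponent
  \<open>\<gamma> < 1\<close> satisfies \<open>s >= a powr \<gamma>\<close> once
  \<open>\<alpha>\<close> is small.

  The level is \<open>a = j + 3 ln (j + 1)\<close>. Its logarithmic excess makes the escape bound,
  of order \<open>exp (j - a)\<close>, summable in \<open>j\<close>. It costs the occupation bound
  only the factor \<open>(j + 1)^3\<close>, which disappears because only half of the gain
  \<open>a powr \<gamma>\<close> is claimed. Borel-Cantelli is applied along \<open>j\<close>, and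
  monotonicity in time covers all \<open>n\<close> between \<open>exp j\<close> and
  \<open>exp (j + 1)\<close>.

  The walk is studied in a fixed environment, so the choice of \<open>K\<close>, \<open>b\<close>
  and \<open>y\<close> raises no question of measurability. Two valleys share nearly all the time,
  which gives the constant 1/2.\<close>

lemma nat_Inf_props:
  fixes P :: "nat \<Rightarrow> bool"
  assumes "P j"
  shows "P (Inf {i. P i})" "i < Inf {i. P i} \<Longrightarrow> \<not> P i"
proof -
  have "{i. P i} \<noteq> {}" using assms by auto
  from Inf_nat_def1[OF this] show "P (Inf {i. P i})" by simp
  show "\<not> P i" if "i < Inf {i. P i}"
    using that cInf_lower[of i "{i. P i}"] by fastforce
qed

lemma nat_Sup_props:
  fixes P :: "nat \<Rightarrow> bool"
  assumes "P j" "\<And>i. P i \<Longrightarrow> i < n"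
  shows "P (Sup {i. P i})" "P i \<Longrightarrow> i \<le> Sup {i. P i}"
proof -
  have fin: "finite {i. P i}"
    by (rule finite_subset[of _ "{..<n}"]) (use assms in auto)
  have ne: "{i. P i} \<noteq> {}" using assms by auto
  have eq: "Sup {i. P i} = Max {i. P i}" using fin ne by (simp add: cSup_eq_Max)
  show "P (Sup {i. P i})" using Max_in[OF fin ne] eq by simp
  show "i \<le> Sup {i. P i}" if "P i" using Max_ge[OF fin] that eq by simp
qed

text \<open>Every threshold condition in the definition of \<open>eta\<close> is a condition on this
  quantity. For a random walk it is the walk reflected at 0, see \<open>drawup_walk\<close>.\<close>

definition drawup :: "(nat \<Rightarrow> real) \<Rightarrow> nat \<Rightarrow> real" where
  "drawup V i = V i - Min (V ` {0..i})"

lemma drawup_le_iff: "drawup V i \<le> c \<longleftrightarrow> (\<forall>j\<le>i. V i - V j \<le> c)"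
proof -
  have "drawup V i \<le> c \<longleftrightarrow> V i - c \<le> Min (V ` {0..i})" unfolding drawup_def by linarith
  also have "\<dots> \<longleftrightarrow> (\<forall>j\<le>i. V i - c \<le> V j)" by (subst Min_ge_iff) auto
  finally show ?thesis by (auto simp: algebra_simps)
qed

lemma drawup_ge_iff: "c \<le> drawup V i \<longleftrightarrow> (\<exists>j\<le>i. c \<le> V i - V j)"
proof -
  have "c \<le> drawup V i \<longleftrightarrow> Min (V ` {0..i}) \<le> V i - c" unfolding drawup_def by linarith
  also have "\<dots> \<longleftrightarrow> (\<exists>j\<le>i. V j \<le> V i - c)" by (subst Min_le_iff) auto
  finally show ?thesis by (auto simp: algebra_simps)
qed

lemma drawup_less_iff: "drawup V i < c \<longleftrightarrow> (\<forall>j\<le>i. V i - V j < c)"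
  using drawup_ge_iff[of c V i] by (auto simp: not_le)

text \<open>Exactly what the infima of the construction need to range over nonempty sets: low values
  for \<open>theta\<close>, large drawups for \<open>eta\<close>. Asking for drawups instead of
  large values of \<open>V\<close> fits the exit estimate for the reflected walk.\<close>

definition oscillating :: "(nat \<Rightarrow> real) \<Rightarrow> bool" where
  "oscillating V \<longleftrightarrow> (\<forall>c. \<exists>i. V i \<le> c) \<and> (\<forall>c. \<exists>i. c \<le> drawup V i)"

lemma oscillating_low:
  assumes "oscillating V" shows "\<exists>i>n. V i \<le> c"
proof -
  obtain i where "V i \<le> min c (Min (V ` {0..n}) - 1)"
    using assms unfolding oscillating_def by blast
  moreover have "n < i"
  proof (rule ccontr)
    assume "\<not> n < i"
    then have "Min (V ` {0..n}) \<le> V i" by (intro Min_le) auto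
    with calculation show False by simp
  qed
  ultimately show ?thesis by auto
qed

lemma oscillating_high:
  assumes "oscillating V" shows "\<exists>i>n. c \<le> drawup V i"
proof -
  obtain i where "max c (Max (drawup V ` {0..n}) + 1) \<le> drawup V i"
    using assms unfolding oscillating_def by blast
  moreover have "n < i"
  proof (rule ccontr)
    assume "\<not> n < i"
    then have "drawup V i \<le> Max (drawup V ` {0..n})" by (intro Max_ge) auto
    with calculation show False by simp
  qed
  ultimately show ?thesis by auto
qed

lemma Min_image_interval:
  fixes V :: "nat \<Rightarrow> real"
  shows "m \<le> n \<Longrightarrow> \<exists>j\<in>{m..n}. V j = Min (V ` {m..n}) \<and> (\<forall>i\<in>{m..n}. V j \<le> V i)"
  using Min_in[of "V ` {m..n}"] Min_le[of "V ` {m..n}"] by fastforce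

lemma Max_image_interval:
  fixes V :: "nat \<Rightarrow> real"
  shows "m \<le> n \<Longrightarrow> \<exists>j\<in>{m..n}. V j = Max (V ` {m..n}) \<and> (\<forall>i\<in>{m..n}. V i \<le> V j)"
  using Max_in[of "V ` {m..n}"] Max_ge[of "V ` {m..n}"] by fastforce

declare eta.simps [simp del] bottom.simps [simp del] theta.simps [simp del] Hplus.simps [simp del]

locale valleys =
  fixes V :: "nat \<Rightarrow> real" and K0 :: real
  assumes osc: "oscillating V" and K0: "K0 > 0"
begin

abbreviation "e k \<equiv> eta V K0 k"
abbreviation "b k \<equiv> bottom V K0 k"
abbreviation "t k \<equiv> theta V K0 k"
abbreviation "h k \<equiv> Hplus V K0 k"
abbreviation "m k \<equiv> valley_start V K0 k"

lemma eta_0: "0 < e 0" "K0 \<le> drawup V (e 0)" "i < e 0 \<Longrightarrow> drawup V i < K0"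
proof -
  obtain i0 where i0: "0 < i0 \<and> K0 \<le> drawup V i0" using oscillating_high[OF osc] by blast
  have eq: "e 0 = Inf {i. 0 < i \<and> K0 \<le> drawup V i}" by (simp add: eta.simps drawup_def)
  note * = nat_Inf_props[of "\<lambda>i. 0 < i \<and> K0 \<le> drawup V i", OF i0, folded eq]
  show "0 < e 0" "K0 \<le> drawup V (e 0)" using *(1) by auto
  show "drawup V i < K0" if "i < e 0"
  proof (cases "i = 0")
    case True then show ?thesis using K0 by (simp add: drawup_def)
  next
    case False then show ?thesis using *(2)[OF that] by auto
  qed
qed

lemma eta_Suc: "t (Suc k) < e (Suc k)" "h k \<le> drawup V (e (Suc k))"
  "t (Suc k) < i \<Longrightarrow> i < e (Suc k) \<Longrightarrow> drawup V i < h k"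
proof -
  obtain i0 where i0: "t (Suc k) < i0 \<and> h k \<le> drawup V i0" using oscillating_high[OF osc] by blast
  have eq: "e (Suc k) = Inf {i. t (Suc k) < i \<and> h k \<le> drawup V i}"
    by (subst eta.simps) (simp add: drawup_def)
  note * = nat_Inf_props[of "\<lambda>i. t (Suc k) < i \<and> h k \<le> drawup V i", OF i0, folded eq]
  show "t (Suc k) < e (Suc k)" "h k \<le> drawup V (e (Suc k))" using *(1) by auto
  show "drawup V i < h k" if "t (Suc k) < i" "i < e (Suc k)" using *(2)[OF that(2)] that by auto
qed

lemma theta_Suc: "e k < t (Suc k)" "V (t (Suc k)) \<le> V (b k)"
  "e k < i \<Longrightarrow> i < t (Suc k) \<Longrightarrow> V (b k) < V i"
proof -
  obtain i0 where i0: "e k < i0 \<and> V i0 \<le> V (b k)" using oscillating_low[OF osc] by blast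
  have eq: "t (Suc k) = Inf {i. e k < i \<and> V i \<le> V (b k)}"
    by (subst theta.simps) simp
  note * = nat_Inf_props[of "\<lambda>i. e k < i \<and> V i \<le> V (b k)", OF i0, folded eq]
  show "e k < t (Suc k)" "V (t (Suc k)) \<le> V (b k)" using *(1) by auto
  show "V (b k) < V i" if "e k < i" "i < t (Suc k)" using *(2)[OF that(2)] that by auto
qed

lemma Max_eq: "\<exists>j\<in>{e k..t (Suc k)}. V j = V (b k) + h k \<and> (\<forall>i\<in>{e k..t (Suc k)}. V i \<le> V j)"
  using Max_image_interval[of "e k" "t (Suc k)" V] theta_Suc(1)[of k]
  by (auto simp: Hplus.simps)

lemma V_le_Hplus: "e k \<le> i \<Longrightarrow> i \<le> t (Suc k) \<Longrightarrow> V i \<le> V (b k) + h k"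
  using Max_eq[of k] by fastforce

lemma bottom_0: "b 0 < e 0" "i \<le> e 0 \<Longrightarrow> V (b 0) \<le> V i"
proof -
  obtain j where j: "j \<in> {0..e 0}" "V j = Min (V ` {0..e 0})" "\<forall>i\<in>{0..e 0}. V j \<le> V i"
    using Min_image_interval[of 0 "e 0" V] by auto
  have "j \<noteq> e 0" using eta_0(2) K0 j(2) by (auto simp: drawup_def)
  then have j': "j < e 0 \<and> V j = Min (V ` {0..e 0})" using j by auto
  have eq: "b 0 = Sup {i. i < e 0 \<and> V i = Min (V ` {0..e 0})}" by (simp add: bottom.simps)
  note * = nat_Sup_props[of "\<lambda>i. i < e 0 \<and> V i = Min (V ` {0..e 0})", OF j', of "e 0", folded eq]
  show "b 0 < e 0" "i \<le> e 0 \<Longrightarrow> V (b 0) \<le> V i" using *(1) by auto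
qed

text \<open>At \<open>t (Suc k)\<close> the potential is at its running minimum, so a minimum over
  \<open>[t, e]\<close> is one over \<open>[0, e]\<close>. The drawup at \<open>e\<close> is at
  least \<open>h k > 0\<close>, so the minimum is not attained at \<open>e\<close> and the supremum
  defining the bottom is taken over a nonempty set.\<close>

lemma bottom_Suc_aux:
  assumes "\<And>i. i \<le> e k \<Longrightarrow> V (b k) \<le> V i" and "0 < h k"
  shows "t (Suc k) \<le> b (Suc k) \<and> b (Suc k) < e (Suc k) \<and> (\<forall>i\<le>e (Suc k). V (b (Suc k)) \<le> V i)"
proof -
  let ?t = "t (Suc k)" and ?e = "e (Suc k)"
  obtain j where j: "j \<in> {?t..?e}" "V j = Min (V ` {?t..?e})" "\<forall>i\<in>{?t..?e}. V j \<le> V i"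
    using Min_image_interval[of ?t ?e V] eta_Suc(1)[of k] by auto
  have low: "V ?t \<le> V i" if "i \<le> ?t" for i
    using assms(1)[of i] theta_Suc(2)[of k] theta_Suc(3)[of k i] that
    by (cases "i \<le> e k"; cases "i = ?t") auto
  have all: "V j \<le> V i" if "i \<le> ?e" for i
  proof (cases "i \<le> ?t")
    case True
    have "V j \<le> V ?t" using j(3) eta_Suc(1)[of k] by auto
    then show ?thesis using low[of i] True by simp
  qed (use j that in auto)
  obtain l where "l \<le> ?e" "h k \<le> V ?e - V l" using eta_Suc(2)[of k] by (auto simp: drawup_ge_iff)
  then have "V j < V ?e" using all[of l] assms(2) by linarith
  then have j': "j < ?e \<and> V j = Min (V ` {?t..?e})" using j by (cases "j = ?e") auto
  have eq: "b (Suc k) = Sup {i. i < ?e \<and> V i = Min (V ` {?t..?e})}"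
    by (subst bottom.simps) simp
  note * = nat_Sup_props[of "\<lambda>i. i < ?e \<and> V i = Min (V ` {?t..?e})", OF j', of ?e, folded eq]
  have "j \<le> b (Suc k)" using *(2)[of j] j' by auto
  then show ?thesis using *(1) j all by auto
qed

text \<open>The three facts support each other in one induction: positivity of \<open>h k\<close>
  puts the next bottom strictly before \<open>e (Suc k)\<close>, and that bottom, being minimal up
  to there, forces \<open>h (Suc k)\<close> to be at least \<open>h k\<close>.\<close>

lemma bottom_min: "i \<le> e k \<Longrightarrow> V (b k) \<le> V i"
  and bottom_less_eta: "b k < e k"
  and Hplus_ge: "K0 \<le> h k"
proof -
  have "(\<forall>i\<le>e k. V (b k) \<le> V i) \<and> b k < e k \<and> K0 \<le> h k"
  proof (induction k)
    case 0
    obtain l where "l \<le> e 0" "K0 \<le> V (e 0) - V l" using eta_0(2) by (auto simp: drawup_ge_iff)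
    then have "V (b 0) + K0 \<le> V (e 0)" using bottom_0(2)[of l] by linarith
    also have "V (e 0) \<le> V (b 0) + h 0" using V_le_Hplus[of 0 "e 0"] theta_Suc(1)[of 0] by auto
    finally show ?case using bottom_0 by auto
  next
    case (Suc k)
    then have *: "b (Suc k) < e (Suc k)" "\<forall>i\<le>e (Suc k). V (b (Suc k)) \<le> V i"
      using bottom_Suc_aux[of k] K0 by auto
    obtain l where "l \<le> e (Suc k)" "h k \<le> V (e (Suc k)) - V l"
      using eta_Suc(2)[of k] by (auto simp: drawup_ge_iff)
    then have "V (b (Suc k)) + h k \<le> V (e (Suc k))" using *(2) by force
    also have "V (e (Suc k)) \<le> V (b (Suc k)) + h (Suc k)"
      using V_le_Hplus[of "Suc k" "e (Suc k)"] theta_Suc(1)[of "Suc k"] by auto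
    finally show ?case using * Suc by auto
  qed
  then show "i \<le> e k \<Longrightarrow> V (b k) \<le> V i" "b k < e k" "K0 \<le> h k" by auto
qed

lemma Hplus_pos: "0 < h k" using Hplus_ge[of k] K0 by simp

lemma V_eta_Suc: "V (b (Suc k)) + h k \<le> V (e (Suc k))"
proof -
  obtain l where "l \<le> e (Suc k)" "h k \<le> V (e (Suc k)) - V l"
    using eta_Suc(2)[of k] by (auto simp: drawup_ge_iff)
  then show ?thesis using bottom_min[of l "Suc k"] by linarith
qed

lemma V_eta: "V (b k) < V (e k)"
proof (cases k)
  case 0
  obtain l where "l \<le> e 0" "K0 \<le> V (e 0) - V l" using eta_0(2) by (auto simp: drawup_ge_iff)
  then show ?thesis using bottom_0(2)[of l] K0 0 by simp
next
  case (Suc l)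
  then show ?thesis using V_eta_Suc[of l] Hplus_pos[of l] by simp
qed

lemma V_above_bottom: "e k \<le> i \<Longrightarrow> i < t (Suc k) \<Longrightarrow> V (b k) < V i"
  using theta_Suc(3)[of k i] V_eta[of k] by (cases "i = e k") auto

lemma bottom_min': "i < t (Suc k) \<Longrightarrow> V (b k) \<le> V i"
  using bottom_min[of i k] V_above_bottom[of k i] by (cases "i \<le> e k") auto

lemma theta_min: "i \<le> t (Suc k) \<Longrightarrow> V (t (Suc k)) \<le> V i"
  using bottom_min'[of i k] theta_Suc(2)[of k] by (cases "i = t (Suc k)") auto

lemma Hplus_mono_Suc: "h k \<le> h (Suc k)"
  using V_eta_Suc[of k] V_le_Hplus[of "Suc k" "e (Suc k)"] theta_Suc(1)[of "Suc k"] by auto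

lemma Hplus_mono: "k \<le> l \<Longrightarrow> h k \<le> h l"
  by (rule lift_Suc_mono_le[of h]) (use Hplus_mono_Suc in auto)

lemma drawup_theta: "drawup V (t (Suc k)) \<le> 0"
  using theta_min[of _ k] by (auto simp: drawup_le_iff)

lemma drawup_le_Hplus_step:
  assumes "\<And>i. i < e k \<Longrightarrow> drawup V i \<le> h k" "i < e (Suc k)"
  shows "drawup V i \<le> h k"
proof -
  consider "i < e k" | "e k \<le> i" "i < t (Suc k)" | "i = t (Suc k)" | "t (Suc k) < i" by linarith
  then show ?thesis
  proof cases
    case 1 then show ?thesis by (rule assms)
  next
    case 2
    show ?thesis unfolding drawup_le_iff
    proof (intro allI impI)
      fix j assume "j \<le> i"
      then show "V i - V j \<le> h k" using bottom_min'[of j k] V_le_Hplus[of k i] 2 by auto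
    qed
  next
    case 3
    then show ?thesis using drawup_theta[of k] Hplus_pos[of k] by simp
  next
    case 4
    then show ?thesis using eta_Suc(3)[of k i] assms(2) by simp
  qed
qed

text \<open>On \<open>[e k, t (Suc k))\<close> the path stays between \<open>V (b k)\<close> and
  \<open>V (b k) + h k\<close>, and after \<open>t (Suc k)\<close> the time \<open>e (Suc k)\<close>
  is the first with a drawup of at least \<open>h k\<close>. With
  \<open>drawup_valley_start\<close>, this makes the heights record drawups.\<close>

lemma drawup_le_Hplus: "i < e (Suc k) \<Longrightarrow> drawup V i \<le> h k"
proof (induction k arbitrary: i)
  case 0
  show ?case
    by (rule drawup_le_Hplus_step[OF _ 0]) (use eta_0(3) Hplus_ge[of 0] in force)
next
  case (Suc k)
  show ?case
    by (rule drawup_le_Hplus_step[OF _ Suc.prems]) (use Suc.IH Hplus_mono_Suc[of k] in force)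
qed

lemma valley_start_Suc: "e k \<le> m (Suc k)" "m (Suc k) < t (Suc k)" "V (m (Suc k)) = V (b k) + h k"
proof -
  have eq: "m (Suc k) = Inf {i. e k \<le> i \<and> V i = V (b k) + h k}"
    by (simp add: valley_start_def Hplus.simps)
  obtain j where j: "j\<in>{e k..t (Suc k)}" "V j = V (b k) + h k" using Max_eq[of k] by auto
  then have j': "e k \<le> j \<and> V j = V (b k) + h k" by auto
  note * = nat_Inf_props[of "\<lambda>i. e k \<le> i \<and> V i = V (b k) + h k", OF j', folded eq]
  show "e k \<le> m (Suc k)" "V (m (Suc k)) = V (b k) + h k" using *(1) by auto
  have "m (Suc k) \<le> j" using *(2)[of j] j' by (meson not_le)
  moreover have "j \<noteq> t (Suc k)" using theta_Suc(2)[of k] Hplus_pos[of k] j(2) by auto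
  ultimately show "m (Suc k) < t (Suc k)" using j by auto
qed

lemma valley_start_mono_Suc: "m (Suc k) < m (Suc (Suc k))"
  using valley_start_Suc(1)[of "Suc k"] valley_start_Suc(2)[of k] eta_Suc(1)[of k] by linarith

lemma valley_start_mono: "1 \<le> k \<Longrightarrow> k \<le> l \<Longrightarrow> m k \<le> m l"
proof -
  assume *: "1 \<le> k" "k \<le> l"
  have "m (Suc (k - 1)) \<le> m (Suc (l - 1))"
    by (rule lift_Suc_mono_le[of "\<lambda>i. m (Suc i)"]) (use valley_start_mono_Suc less_imp_le * in auto)
  then show ?thesis using * by simp
qed

lemma drawup_valley_start: "h k \<le> drawup V (m (Suc k))"
  unfolding drawup_ge_iff using valley_start_Suc[of k] bottom_less_eta[of k]
  by (intro exI[of _ "b k"]) auto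

text \<open>If \<open>z\<close> lies before \<open>e (Suc k)\<close>, the climb is bounded by
  \<open>h k\<close>, which is at least \<open>s\<close> below \<open>h (Suc k) < a\<close>. If not,
  \<open>V z\<close> is less than \<open>a\<close> above the bottom \<open>b (Suc k)\<close>, while
  \<open>V x\<close> is at least \<open>V (b k)\<close>, hence already \<open>s\<close> above that
  bottom.\<close>

lemma climb_from_left:
  assumes gapV: "V (b k) - V (b (Suc k)) \<ge> s" and gapH: "h (Suc k) \<ge> h k + s"
    and a: "h (Suc k) < a" and y: "\<And>z. z < y \<Longrightarrow> drawup V z < a"
    and x: "x < m (Suc k)" "x \<le> z" "z < y"
  shows "V z - V x \<le> a - s"
proof (cases "z < e (Suc k)")
  case True
  then have "drawup V z \<le> h k" by (rule drawup_le_Hplus)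
  then have "V z - V x \<le> h k" using x by (auto simp: drawup_le_iff)
  then show ?thesis using gapH a by linarith
next
  case False
  then have "V z - V (b (Suc k)) < a" using y[OF x(3)] bottom_less_eta[of "Suc k"]
    by (auto simp: drawup_less_iff)
  moreover have "V (b k) \<le> V x" using bottom_min'[of x k] x valley_start_Suc(2)[of k] by auto
  ultimately show ?thesis using gapV by linarith
qed

end

section \<open>Gambler's ruin and drawups of centered walks\<close>

definition walk :: "('a \<Rightarrow> real) \<Rightarrow> (nat \<Rightarrow> 'a) \<Rightarrow> nat \<Rightarrow> real" where
  "walk xi w n = (\<Sum>i<n. xi (w i))"

lemma walk_0 [simp]: "walk xi w 0 = 0" by (simp add: walk_def)

lemma walk_Suc: "walk xi w (Suc n) = xi (w 0) + walk xi (\<lambda>i. w (Suc i)) n"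
  unfolding walk_def by (subst sum.lessThan_Suc_shift) simp

lemma walk_uminus: "walk (\<lambda>s. - xi s) w n = - walk xi w n"
  by (simp add: walk_def sum_negf)

context sequence_space
begin

lemma nn_integral_case_nat:
  assumes [measurable]: "f \<in> borel_measurable S"
  shows "(\<integral>\<^sup>+w. f w \<partial>S) = (\<integral>\<^sup>+s. \<integral>\<^sup>+w. f (case_nat s w) \<partial>S \<partial>M)"
proof -
  have "(\<integral>\<^sup>+w. f w \<partial>S) = (\<integral>\<^sup>+w. f w \<partial>distr (M \<Otimes>\<^sub>M S) S (\<lambda>(s, \<omega>). case_nat s \<omega>))"
    by (simp add: PiM_iter)
  also have "\<dots> = (\<integral>\<^sup>+p. f (case_nat (fst p) (snd p)) \<partial>(M \<Otimes>\<^sub>M S))"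
    by (subst nn_integral_distr) (auto simp: split_beta')
  also have "\<dots> = (\<integral>\<^sup>+s. \<integral>\<^sup>+w. f (case_nat s w) \<partial>S \<partial>M)"
    by (subst P.nn_integral_fst[symmetric]) auto
  finally show ?thesis .
qed

lemma nn_integral_comb_seq:
  assumes [measurable]: "f \<in> borel_measurable S"
  shows "(\<integral>\<^sup>+w. f w \<partial>S) = (\<integral>\<^sup>+w. \<integral>\<^sup>+w'. f (comb_seq n w w') \<partial>S \<partial>S)"
proof -
  have "(\<integral>\<^sup>+w. f w \<partial>S) = (\<integral>\<^sup>+w. f w \<partial>distr (S \<Otimes>\<^sub>M S) S (\<lambda>(\<omega>, \<omega>'). comb_seq n \<omega> \<omega>'))"
    by (simp add: PiM_comb_seq)
  also have "\<dots> = (\<integral>\<^sup>+p. f (comb_seq n (fst p) (snd p)) \<partial>(S \<Otimes>\<^sub>M S))"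
    by (subst nn_integral_distr) (auto simp: split_beta' intro!: measurable_comb_seq)
  also have "\<dots> = (\<integral>\<^sup>+w. \<integral>\<^sup>+w'. f (comb_seq n w w') \<partial>S \<partial>S)"
    by (subst P.nn_integral_fst[symmetric]) (auto simp: split_beta')
  finally show ?thesis .
qed

text \<open>The potential is driven by the coordinates from 1 on, whereas \<open>walk\<close> starts
  with the coordinate 0.\<close>

lemma AE_shift:
  assumes "AE w in S. P w"
  shows "AE w in S. P (\<lambda>i. w (Suc i))"
proof -
  have "distr S S (\<lambda>w i. w (Suc i)) = S"
  proof -
    have "distr S S (\<lambda>w i. w (Suc i)) =
        distr (distr (M \<Otimes>\<^sub>M S) S (\<lambda>(s, \<omega>). case_nat s \<omega>)) S (\<lambda>w i. w (Suc i))"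
      by (simp add: PiM_iter)
    also have "\<dots> = distr (M \<Otimes>\<^sub>M S) S snd"
      by (subst distr_distr) (auto simp: comp_def split_beta' space_PiM PiE_iff intro!: distr_cong measurable_PiM_single')
    also have "\<dots> = S"
    proof (rule measure_eqI)
      fix A assume A: "A \<in> sets (distr (M \<Otimes>\<^sub>M S) S snd)"
      then have "snd -` A \<inter> space (M \<Otimes>\<^sub>M S) = space M \<times> A"
        using sets.sets_into_space[of A S] by (auto simp: space_pair_measure)
      then show "emeasure (distr (M \<Otimes>\<^sub>M S) S snd) A = emeasure S A"
        using A by (simp add: emeasure_distr P.emeasure_pair_measure_Times M.emeasure_space_1)
    qed simp
    finally show ?thesis .
  qed
  with assms have "AE w in distr S S (\<lambda>w i. w (Suc i)). P w" by (simp only:)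
  then show ?thesis
    by (rule AE_distrD[rotated]) (auto simp: space_PiM PiE_iff intro!: measurable_PiM_single')
qed

lemma AE_comb_seq:
  assumes "AE w in S. P w"
  shows "AE w in S. AE w' in S. P (comb_seq n w w')"
proof -
  interpret SS: pair_sigma_finite S S ..
  have "AE p in S \<Otimes>\<^sub>M S. P (case p of (\<omega>, \<omega>') \<Rightarrow> comb_seq n \<omega> \<omega>')"
    using AE_distrD[of "\<lambda>(\<omega>, \<omega>'). comb_seq n \<omega> \<omega>'" "S \<Otimes>\<^sub>M S" S P, OF measurable_comb_seq] assms
    by (simp only: PiM_comb_seq)
  then show ?thesis by (auto dest: SS.AE_pair)
qed

end

locale centered_steps = sequence_space M for M :: "'a measure" +
  fixes xi :: "'a \<Rightarrow> real" and C :: real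
  assumes xi_measurable [measurable]: "xi \<in> borel_measurable M"
    and xi_bounded: "AE s in M. \<bar>xi s\<bar> \<le> C"
    and xi_centered: "(\<integral>s. xi s \<partial>M) = 0"
    and C_pos: "0 < C"
begin

lemma xi_integrable [simp]: "integrable M xi"
  by (rule M.integrable_const_bound[where B = C]) (use xi_bounded in auto)

lemma centered_steps_uminus: "centered_steps M (\<lambda>s. - xi s) C"
  by unfold_locales (use xi_bounded xi_centered C_pos in auto)

text \<open>\<open>reach a c n x w\<close>: the walk started at \<open>x\<close> enters \<open>[a, \<infinity>)\<close> within \<open>n\<close> steps and before
  entering \<open>(-\<infinity>, c]\<close>. Recursion on the first step makes the affine bound below an induction that
  needs no stopping times.\<close>

primrec reach :: "real \<Rightarrow> real \<Rightarrow> nat \<Rightarrow> real \<Rightarrow> (nat \<Rightarrow> 'a) \<Rightarrow> bool" where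
  "reach a c 0 x w \<longleftrightarrow> a \<le> x"
| "reach a c (Suc n) x w \<longleftrightarrow> a \<le> x \<or> c < x \<and> reach a c n (x + xi (w 0)) (\<lambda>i. w (Suc i))"

lemma reach_measurable [measurable]: "(\<lambda>p. reach a c n (fst p) (snd p)) \<in> measurable (borel \<Otimes>\<^sub>M S) (count_space UNIV)"
proof (induction n)
  case (Suc n)
  have [measurable]: "(\<lambda>p. (fst p + xi (snd p 0), \<lambda>i. snd p (Suc i))) \<in> borel \<Otimes>\<^sub>M S \<rightarrow>\<^sub>M borel \<Otimes>\<^sub>M S"
    by (intro measurable_Pair measurable_PiM_single') (auto simp: space_pair_measure space_PiM PiE_iff)
  have [measurable]: "(\<lambda>p. reach a c n (fst p + xi (snd p 0)) (\<lambda>i. snd p (Suc i))) \<in> measurable (borel \<Otimes>\<^sub>M S) (count_space UNIV)"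
    using measurable_compose[OF _ Suc, of "\<lambda>p. (fst p + xi (snd p 0), \<lambda>i. snd p (Suc i))"] by simp
  show ?case by simp
qed simp

lemma reach_measurable' [measurable]: "reach a c n x \<in> measurable S (count_space UNIV)"
  using measurable_compose[OF _ reach_measurable, of "\<lambda>w. (x, w)" S] by simp

declare reach.simps(2) [simp del]

lemma reach_sets [measurable]: "{w \<in> space S. reach a c n x w} \<in> sets S"
  by measurable

text \<open>The bound is the affine function of \<open>x\<close> that vanishes at
  \<open>c - C\<close> and equals 1 at \<open>a\<close>. Centering makes it invariant under
  averaging over one step; since a step from above \<open>c\<close> cannot fall below
  \<open>c - C\<close>, it stays nonnegative where it is used.\<close>

lemma emeasure_reach:
  assumes "c < a + C" "c - C \<le> x"
  shows "emeasure S {w \<in> space S. reach a c n x w} \<le> ennreal ((x - c + C) / (a - c + C))"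
  using assms(2)
proof (induction n arbitrary: x)
  case 0
  show ?case
  proof (cases "a \<le> x")
    case True
    then have "1 \<le> (x - c + C) / (a - c + C)" using assms(1) by simp
    then have "ennreal 1 \<le> ennreal ((x - c + C) / (a - c + C))" by (rule ennreal_leI)
    then show ?thesis
      using P.emeasure_le_1[of "{w \<in> space S. reach a c 0 x w}"] unfolding ennreal_1 by (rule order_trans[rotated])
  qed simp
next
  case (Suc n)
  consider "a \<le> x" | "x < a" "x \<le> c" | "x < a" "c < x" by linarith
  then show ?case
  proof cases
    case 1
    then have "1 \<le> (x - c + C) / (a - c + C)" using assms(1) by simp
    then have "ennreal 1 \<le> ennreal ((x - c + C) / (a - c + C))" by (rule ennreal_leI)
    then show ?thesis
      using P.emeasure_le_1[of "{w \<in> space S. reach a c (Suc n) x w}"] unfolding ennreal_1 by (rule order_trans[rotated])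
  next
    case 2
    then have "{w \<in> space S. reach a c (Suc n) x w} = {}" by (auto simp: reach.simps)
    then show ?thesis by (simp only: emeasure_empty zero_le)
  next
    case 3
    have "emeasure S {w \<in> space S. reach a c (Suc n) x w} =
        (\<integral>\<^sup>+w. indicator {w \<in> space S. reach a c (Suc n) x w} w \<partial>S)"
      by (rule nn_integral_indicator[symmetric]) (rule reach_sets)
    also have "\<dots> = (\<integral>\<^sup>+s. \<integral>\<^sup>+w. indicator {w \<in> space S. reach a c (Suc n) x w} (case_nat s w) \<partial>S \<partial>M)"
      by (rule nn_integral_case_nat) (rule borel_measurable_indicator[OF reach_sets])
    also have "\<dots> = (\<integral>\<^sup>+s. emeasure S {w \<in> space S. reach a c n (x + xi s) w} \<partial>M)"
    proof (rule nn_integral_cong)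
      fix s assume s: "s \<in> space M"
      have "(\<integral>\<^sup>+w. indicator {w \<in> space S. reach a c (Suc n) x w} (case_nat s w) \<partial>S) =
        (\<integral>\<^sup>+w. indicator {w \<in> space S. reach a c n (x + xi s) w} w \<partial>S)"
        using 3 s by (intro nn_integral_cong) (auto simp: indicator_def space_PiM PiE_iff reach.simps(2) split: nat.split)
      then show "(\<integral>\<^sup>+w. indicator {w \<in> space S. reach a c (Suc n) x w} (case_nat s w) \<partial>S) =
        emeasure S {w \<in> space S. reach a c n (x + xi s) w}"
        by (simp only: nn_integral_indicator[OF reach_sets])
    qed
    also have "\<dots> \<le> (\<integral>\<^sup>+s. ennreal ((x + xi s - c + C) / (a - c + C)) \<partial>M)"
      by (rule nn_integral_mono_AE) (use xi_bounded 3 Suc.IH in \<open>auto elim!: eventually_mono\<close>)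
    also have "\<dots> = ennreal (\<integral>s. (x + xi s - c + C) / (a - c + C) \<partial>M)"
    proof (rule nn_integral_eq_integral)
      show "AE s in M. 0 \<le> (x + xi s - c + C) / (a - c + C)"
        using xi_bounded 3 assms(1) by (auto elim!: eventually_mono)
    qed simp
    also have "(\<integral>s. (x + xi s - c + C) / (a - c + C) \<partial>M) = (x - c + C) / (a - c + C)"
    proof -
      have "(\<integral>s. (x + xi s - c + C) / (a - c + C) \<partial>M) = (\<integral>s. (x - c + C + xi s) \<partial>M) / (a - c + C)"
        by (subst integral_divide_zero[symmetric]) (simp add: algebra_simps)
      also have "(\<integral>s. (x - c + C + xi s) \<partial>M) = x - c + C"
        by (subst Bochner_Integration.integral_add) (auto simp: xi_centered M.prob_space)
      finally show ?thesis .
    qed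
    finally show ?thesis .
  qed
qed

lemma reach_Suc: "reach a c n x w \<Longrightarrow> reach a c (Suc n) x w"
proof (induction n arbitrary: x w)
  case (Suc n)
  from Suc.prems have "a \<le> x \<or> c < x \<and> reach a c n (x + xi (w 0)) (\<lambda>i. w (Suc i))"
    by (simp only: reach.simps)
  then show ?case using Suc.IH unfolding reach.simps(2)[of a c "Suc n"] by blast
qed (simp add: reach.simps)

lemma reach_walk:
  "a \<le> x + walk xi w n \<Longrightarrow> (\<And>i. i < n \<Longrightarrow> c < x + walk xi w i) \<Longrightarrow> reach a c n x w"
proof (induction n arbitrary: x w)
  case (Suc n)
  have "reach a c n (x + xi (w 0)) (\<lambda>i. w (Suc i))"
  proof (rule Suc.IH)
    show "c < x + xi (w 0) + walk xi (\<lambda>i. w (Suc i)) i" if "i < n" for i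
      using Suc.prems(2)[of "Suc i"] that by (simp add: walk_Suc algebra_simps)
  qed (use Suc.prems(1) in \<open>simp add: walk_Suc algebra_simps\<close>)
  then show ?case using Suc.prems(2)[of 0] by (simp add: reach.simps)
qed simp

lemma walk_measurable [measurable]: "(\<lambda>w. walk xi w n) \<in> borel_measurable S"
  unfolding walk_def by measurable

text \<open>Negative \<open>a\<close> is allowed: the bound is then at least 1. This spares the
  later applications a case distinction, where \<open>a\<close> is a difference such as
  \<open>h - s h\<close>.\<close>

lemma gambler_ruin:
  assumes "0 < a + b + C" "0 \<le> b"
  shows "emeasure S {w \<in> space S. \<exists>n. a \<le> walk xi w n \<and> (\<forall>i<n. - b < walk xi w i)}
    \<le> ennreal ((b + C) / (a + b + C))"
proof -
  let ?A = "\<lambda>n. {w \<in> space S. reach a (- b) n 0 w}"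
  have "emeasure S {w \<in> space S. \<exists>n. a \<le> walk xi w n \<and> (\<forall>i<n. - b < walk xi w i)} \<le> emeasure S (\<Union>n. ?A n)"
  proof (rule emeasure_mono)
    show "{w \<in> space S. \<exists>n. a \<le> walk xi w n \<and> (\<forall>i<n. - b < walk xi w i)} \<subseteq> (\<Union>n. ?A n)"
      using reach_walk[of a 0 _ _ "- b"] by fastforce
  qed measurable
  also have "\<dots> = (SUP n. emeasure S (?A n))"
    by (rule SUP_emeasure_incseq[symmetric]) (auto intro!: incseq_SucI reach_Suc)
  also have "\<dots> \<le> ennreal ((0 - (- b) + C) / (a - (- b) + C))"
    by (rule SUP_least, rule emeasure_reach) (use assms C_pos in auto)
  finally show ?thesis by simp
qed

section \<open>The reflected walk and its exit time\<close>

primrec refl :: "real \<Rightarrow> (nat \<Rightarrow> 'a) \<Rightarrow> nat \<Rightarrow> real" where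
  "refl x w 0 = x"
| "refl x w (Suc n) = max (refl x w n + xi (w n)) 0"

lemma refl_shift: "refl (max (x + xi (w 0)) 0) (\<lambda>i. w (Suc i)) n = refl x w (Suc n)"
  by (induction n) auto

text \<open>A new step either raises the height above the running minimum or sets a new minimum,
  which resets that height to 0: this is Lindley's recursion. \<open>refl\<close> runs forward in
  time while \<open>stay\<close> unrolls the first step; \<open>refl_shift\<close> connects the
  two.\<close>

lemma drawup_walk: "drawup (walk xi w) n = refl 0 w n"
proof (induction n)
  case (Suc n)
  let ?V = "walk xi w"
  have "Min (?V ` {0..Suc n}) = min (?V (Suc n)) (Min (?V ` {0..n}))"
    by (simp add: atLeast0_atMost_Suc)
  then have "drawup ?V (Suc n) = max (drawup ?V n + (?V (Suc n) - ?V n)) 0"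
    unfolding drawup_def by linarith
  also have "?V (Suc n) - ?V n = xi (w n)" by (simp add: walk_def)
  finally show ?case by (simp add: Suc)
qed (simp add: drawup_def)

text \<open>The exit time from \<open>[0, h)\<close> of the walk \<open>D\<close> reflected at \<open>0\<close>, truncated at \<open>n\<close>. Its expectation
  is bounded because \<open>D\<^sup>2\<close> increases by at least \<open>v\<close> per step on average.\<close>

primrec stay :: "real \<Rightarrow> nat \<Rightarrow> real \<Rightarrow> (nat \<Rightarrow> 'a) \<Rightarrow> ennreal" where
  "stay h 0 x w = 0"
| "stay h (Suc n) x w = (if x < h then 1 + stay h n (max (x + xi (w 0)) 0) (\<lambda>i. w (Suc i)) else 0)"

lemma stay_measurable [measurable]: "(\<lambda>p. stay h n (fst p) (snd p)) \<in> borel_measurable (borel \<Otimes>\<^sub>M S)"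
proof (induction n)
  case (Suc n)
  have *: "(\<lambda>p. (max (fst p + xi (snd p 0)) 0, \<lambda>i. snd p (Suc i))) \<in> borel \<Otimes>\<^sub>M S \<rightarrow>\<^sub>M borel \<Otimes>\<^sub>M S"
    by (intro measurable_Pair measurable_PiM_single') (auto simp: space_pair_measure space_PiM PiE_iff)
  have [measurable]: "(\<lambda>p. stay h n (max (fst p + xi (snd p 0)) 0) (\<lambda>i. snd p (Suc i))) \<in> borel_measurable (borel \<Otimes>\<^sub>M S)"
    using measurable_compose[OF * Suc] by simp
  show ?case by simp
qed simp

lemma stay_measurable' [measurable]: "stay h n x \<in> borel_measurable S"
  using measurable_compose[OF _ stay_measurable, of "\<lambda>w. (x, w)" S] by simp

lemma stay_ge: "(\<And>i. i < n \<Longrightarrow> refl x w i < h) \<Longrightarrow> of_nat n \<le> stay h n x w"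
proof (induction n arbitrary: x w)
  case (Suc n)
  have "of_nat n \<le> stay h n (max (x + xi (w 0)) 0) (\<lambda>i. w (Suc i))"
    by (rule Suc.IH) (use Suc.prems in \<open>auto simp only: refl_shift\<close>)
  then show ?case using Suc.prems[of 0] by (simp add: add_mono)
qed simp

text \<open>The positive part appears because at 0 the reflected walk keeps only upward steps;
  \<open>v\<close> is the mean gain of its square there.\<close>

definition v where "v = (\<integral>s. (max (xi s) 0)\<^sup>2 \<partial>M)"

lemma bounded_integrable:
  fixes f :: "real \<Rightarrow> real"
  assumes [measurable]: "f \<in> borel_measurable borel" and "\<And>y. \<bar>y\<bar> \<le> C \<Longrightarrow> \<bar>f y\<bar> \<le> B"
  shows "integrable M (\<lambda>s. f (xi s))"
  by (rule M.integrable_const_bound[where B = B]) (use xi_bounded assms(2) in \<open>auto elim!: eventually_mono\<close>)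

lemma square_pos_part_le: "0 \<le> x \<Longrightarrow> \<bar>y\<bar> \<le> C \<Longrightarrow> (max (x + y) 0)\<^sup>2 \<le> (x + C)\<^sup>2"
  by (rule power_mono) auto

lemma square_pos_part_integrable: "0 \<le> x \<Longrightarrow> integrable M (\<lambda>s. (max (x + xi s) 0)\<^sup>2)"
  by (rule bounded_integrable[where B = "(x + C)\<^sup>2"]) (simp_all add: square_pos_part_le)

text \<open>Holds already pointwise once the centered term \<open>2 * x * xi s\<close> is added. If
  \<open>x + xi s\<close> is negative, then \<open>xi s < - x\<close>, so the positive part of
  \<open>xi s\<close> vanishes and \<open>x * (x + 2 * xi s)\<close> is at most 0.\<close>

lemma v_le: "0 \<le> x \<Longrightarrow> x\<^sup>2 + v \<le> (\<integral>s. (max (x + xi s) 0)\<^sup>2 \<partial>M)"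
proof -
  assume x: "0 \<le> x"
  have i1: "integrable M (\<lambda>s. (max (xi s) 0)\<^sup>2)"
    using square_pos_part_integrable[of 0] by simp
  have i2: "integrable M (\<lambda>s. (max (x + xi s) 0)\<^sup>2)"
    using square_pos_part_integrable[OF x] .
  have "x\<^sup>2 + v = (\<integral>s. x\<^sup>2 + 2 * x * xi s + (max (xi s) 0)\<^sup>2 \<partial>M)"
    using i1 by (subst Bochner_Integration.integral_add; simp add: xi_centered M.prob_space v_def)
  also have "\<dots> \<le> (\<integral>s. (max (x + xi s) 0)\<^sup>2 \<partial>M)"
  proof (rule integral_mono)
    fix s
    show "x\<^sup>2 + 2 * x * xi s + (max (xi s) 0)\<^sup>2 \<le> (max (x + xi s) 0)\<^sup>2"
    proof (cases "0 \<le> x + xi s")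
      case True
      then show ?thesis by (simp add: power2_sum max_def)
    next
      case False
      then have "x * (x + 2 * xi s) \<le> 0" using x by (intro mult_nonneg_nonpos) auto
      then show ?thesis using False x by (auto simp: max_def power2_eq_square algebra_simps)
    qed
  qed (use i1 i2 in auto)
  finally show ?thesis .
qed

text \<open>A step from below \<open>h\<close> ends at most at \<open>h + C\<close>, so the square
  can gain no more than \<open>(h + C)^2 - x^2\<close> in total, and each step spent inside
  contributes at least \<open>v\<close> on average.\<close>

lemma nn_integral_stay:
  assumes v: "0 < v" and h: "0 < h" and x: "0 \<le> x" "x \<le> h + C"
  shows "(\<integral>\<^sup>+w. stay h n x w \<partial>S) \<le> ennreal (((h + C)\<^sup>2 - x\<^sup>2) / v)"
  using x
proof (induction n arbitrary: x)
  case 0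
  have "stay h 0 x = (\<lambda>_. 0)" by auto
  then show ?case by simp
next
  case (Suc n)
  show ?case
  proof (cases "x < h")
    case True
    have "(\<integral>\<^sup>+w. stay h (Suc n) x w \<partial>S) = (\<integral>\<^sup>+s. \<integral>\<^sup>+w. stay h (Suc n) x (case_nat s w) \<partial>S \<partial>M)"
      by (rule nn_integral_case_nat) measurable
    also have "\<dots> = (\<integral>\<^sup>+s. 1 + (\<integral>\<^sup>+w. stay h n (max (x + xi s) 0) w \<partial>S) \<partial>M)"
      using True by (intro nn_integral_cong) (simp add: nn_integral_add P.emeasure_space_1)
    also have "\<dots> \<le> (\<integral>\<^sup>+s. 1 + ennreal (((h + C)\<^sup>2 - (max (x + xi s) 0)\<^sup>2) / v) \<partial>M)"
      by (rule nn_integral_mono_AE)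
        (use xi_bounded True Suc C_pos in \<open>auto elim!: eventually_mono intro!: add_left_mono Suc.IH\<close>)
    also have "\<dots> = (\<integral>\<^sup>+s. ennreal (1 + ((h + C)\<^sup>2 - (max (x + xi s) 0)\<^sup>2) / v) \<partial>M)"
    proof (rule nn_integral_cong_AE)
      show "AE s in M. 1 + ennreal (((h + C)\<^sup>2 - (max (x + xi s) 0)\<^sup>2) / v) =
        ennreal (1 + ((h + C)\<^sup>2 - (max (x + xi s) 0)\<^sup>2) / v)"
        using xi_bounded
      proof eventually_elim
        case (elim s)
        have "(max (x + xi s) 0)\<^sup>2 \<le> (h + C)\<^sup>2"
          by (rule power_mono) (use elim True C_pos h in auto)
        then show ?case using v by (subst ennreal_plus) auto
      qed
    qed
    also have "\<dots> = ennreal (\<integral>s. 1 + ((h + C)\<^sup>2 - (max (x + xi s) 0)\<^sup>2) / v \<partial>M)"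
    proof (rule nn_integral_eq_integral)
      show "integrable M (\<lambda>s. 1 + ((h + C)\<^sup>2 - (max (x + xi s) 0)\<^sup>2) / v)"
      proof -
        have "integrable M (\<lambda>s. (max (x + xi s) 0)\<^sup>2)"
        using square_pos_part_integrable[OF Suc.prems(1)] .
        then show ?thesis by simp
      qed
      show "AE s in M. 0 \<le> 1 + ((h + C)\<^sup>2 - (max (x + xi s) 0)\<^sup>2) / v"
        using xi_bounded
      proof eventually_elim
        case (elim s)
        have "(max (x + xi s) 0)\<^sup>2 \<le> (h + C)\<^sup>2"
          by (rule power_mono) (use elim True C_pos h in auto)
        then show ?case using v by auto
      qed
    qed
    also have "\<dots> \<le> ennreal (((h + C)\<^sup>2 - x\<^sup>2) / v)"
    proof (rule ennreal_leI)
      have i: "integrable M (\<lambda>s. (max (x + xi s) 0)\<^sup>2)"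
        using square_pos_part_integrable[OF Suc.prems(1)] .
      have "(\<integral>s. 1 + ((h + C)\<^sup>2 - (max (x + xi s) 0)\<^sup>2) / v \<partial>M) =
          1 + ((h + C)\<^sup>2 - (\<integral>s. (max (x + xi s) 0)\<^sup>2 \<partial>M)) / v"
        using i by (simp add: M.prob_space)
      also have "\<dots> \<le> 1 + ((h + C)\<^sup>2 - (x\<^sup>2 + v)) / v"
        using v_le[OF Suc.prems(1)] v by (intro add_left_mono divide_right_mono) auto
      also have "\<dots> = ((h + C)\<^sup>2 - x\<^sup>2) / v" using v by (simp add: field_simps)
      finally show "(\<integral>s. 1 + ((h + C)\<^sup>2 - (max (x + xi s) 0)\<^sup>2) / v \<partial>M) \<le> ((h + C)\<^sup>2 - x\<^sup>2) / v" .
    qed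
    finally show ?thesis .
  qed simp
qed

lemma drawup_walk_measurable [measurable]: "(\<lambda>w. drawup (walk xi w) i) \<in> borel_measurable S"
  unfolding drawup_walk by (induction i) auto

text \<open>Markov's inequality for \<open>stay\<close>, which is at least \<open>n\<close> on this
  event.\<close>

lemma emeasure_small_drawup:
  assumes v: "0 < v" and h: "0 < h" and n: "0 < n"
  shows "emeasure S {w \<in> space S. \<forall>i<n. drawup (walk xi w) i < h} \<le> ennreal ((h + C)\<^sup>2 / v / n)"
proof -
  let ?A = "{w \<in> space S. \<forall>i<n. drawup (walk xi w) i < h}"
  have "of_nat n * emeasure S ?A = (\<integral>\<^sup>+w. of_nat n * indicator ?A w \<partial>S)"
    by (simp add: nn_integral_cmult)
  also have "\<dots> \<le> (\<integral>\<^sup>+w. stay h n 0 w \<partial>S)"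
    by (rule nn_integral_mono) (auto simp: indicator_def drawup_walk intro!: stay_ge)
  also have "\<dots> \<le> ennreal (((h + C)\<^sup>2 - 0\<^sup>2) / v)"
    by (rule nn_integral_stay) (use assms C_pos in auto)
  finally have "of_nat n * emeasure S ?A \<le> ennreal ((h + C)\<^sup>2 / v)" by simp
  then have "ennreal (real n * measure S ?A) \<le> ennreal ((h + C)\<^sup>2 / v)"
    by (simp add: P.emeasure_eq_measure ennreal_of_nat_eq_real_of_nat ennreal_mult)
  then have "real n * measure S ?A \<le> (h + C)\<^sup>2 / v"
    using v by (subst (asm) ennreal_le_iff) auto
  then have "measure S ?A \<le> (h + C)\<^sup>2 / v / n"
    using n by (subst pos_le_divide_eq) (auto simp: mult.commute)
  then show ?thesis by (simp add: P.emeasure_eq_measure ennreal_leI)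
qed

end

section \<open>The landmarks of the valleys depend only on the past\<close>

lemma nat_Inf_agree:
  fixes P P' :: "nat \<Rightarrow> bool"
  assumes "P j" "\<And>i. i \<le> Inf {i. P i} \<Longrightarrow> P' i \<longleftrightarrow> P i"
  shows "Inf {i. P' i} = Inf {i. P i}"
proof -
  note * = nat_Inf_props[of P, OF assms(1)]
  have "P' (Inf {i. P i})" using *(1) assms(2) by blast
  note ** = nat_Inf_props[of P', OF this]
  show ?thesis
    using *(2)[of "Inf {i. P' i}"] **(1) **(2)[of "Inf {i. P i}"] *(1) assms(2)
    by (meson linorder_neq_iff order_less_imp_le order_refl)
qed

lemma drawup_agree: "(\<And>j. j \<le> i \<Longrightarrow> V' j = V j) \<Longrightarrow> drawup V' i = drawup V i"
proof -
  assume *: "\<And>j. j \<le> i \<Longrightarrow> V' j = V j"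
  then have "V' ` {0..i} = V ` {0..i}" by (intro image_cong) auto
  then show ?thesis using * by (simp add: drawup_def)
qed

context valleys
begin

lemma eta_bottom_agree_0:
  assumes "\<And>i. i \<le> e 0 \<Longrightarrow> V' i = V i"
  shows "eta V' K0 0 = e 0" "bottom V' K0 0 = b 0"
proof -
  have e: "eta V K0 0 = Inf {i. 0 < i \<and> K0 \<le> drawup V i}" for V
    by (simp add: eta.simps drawup_def)
  show *: "eta V' K0 0 = e 0"
    unfolding e
  proof (rule nat_Inf_agree)
    show "0 < e 0 \<and> K0 \<le> drawup V (e 0)" using eta_0 by simp
    show "(0 < i \<and> K0 \<le> drawup V' i) = (0 < i \<and> K0 \<le> drawup V i)"
      if "i \<le> Inf {i. 0 < i \<and> K0 \<le> drawup V i}" for i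
      using drawup_agree[of i V' V] assms that unfolding e by auto
  qed
  have "V' ` {0..e 0} = V ` {0..e 0}" using assms by (intro image_cong) auto
  then show "bottom V' K0 0 = b 0"
    using assms by (auto simp: bottom.simps * intro!: arg_cong[where f = Sup])
qed

lemma theta_Hplus_agree:
  assumes "\<And>i. i \<le> t (Suc k) \<Longrightarrow> V' i = V i"
    and eb: "eta V' K0 k = e k" "bottom V' K0 k = b k"
  shows "theta V' K0 (Suc k) = t (Suc k)" "Hplus V' K0 k = h k"
proof -
  have e: "theta V K0 (Suc k) = Inf {i. eta V K0 k < i \<and> V i \<le> V (bottom V K0 k)}" for V
    by (subst theta.simps) simp
  have b: "V' (b k) = V (b k)"
    using assms(1) bottom_less_eta[of k] theta_Suc(1)[of k] by auto
  show *: "theta V' K0 (Suc k) = t (Suc k)"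
    unfolding e eb
  proof (rule nat_Inf_agree)
    show "e k < t (Suc k) \<and> V (t (Suc k)) \<le> V (b k)" using theta_Suc[of k] by simp
    show "(e k < i \<and> V' i \<le> V' (b k)) = (e k < i \<and> V i \<le> V (b k))"
      if "i \<le> Inf {i. e k < i \<and> V i \<le> V (b k)}" for i
      using assms(1)[of i] that b unfolding e by auto
  qed
  have "V' ` {e k..t (Suc k)} = V ` {e k..t (Suc k)}" using assms by (intro image_cong) auto
  then show "Hplus V' K0 k = h k" by (simp add: Hplus.simps * eb b)
qed

lemma eta_bottom_agree_Suc:
  assumes "\<And>i. i \<le> e (Suc k) \<Longrightarrow> V' i = V i"
    and th: "theta V' K0 (Suc k) = t (Suc k)" "Hplus V' K0 k = h k"
  shows "eta V' K0 (Suc k) = e (Suc k)" "bottom V' K0 (Suc k) = b (Suc k)"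
proof -
  have e: "eta V K0 (Suc k) = Inf {i. theta V K0 (Suc k) < i \<and> Hplus V K0 k \<le> drawup V i}" for V
    by (subst eta.simps) (simp add: drawup_def)
  show *: "eta V' K0 (Suc k) = e (Suc k)"
    unfolding e th
  proof (rule nat_Inf_agree)
    show "t (Suc k) < e (Suc k) \<and> h k \<le> drawup V (e (Suc k))" using eta_Suc[of k] by simp
    show "(t (Suc k) < i \<and> h k \<le> drawup V' i) = (t (Suc k) < i \<and> h k \<le> drawup V i)"
      if "i \<le> Inf {i. t (Suc k) < i \<and> h k \<le> drawup V i}" for i
      using drawup_agree[of i V' V] assms that unfolding e by auto
  qed
  have "V' ` {t (Suc k)..e (Suc k)} = V ` {t (Suc k)..e (Suc k)}" using assms by (intro image_cong) auto
  moreover have "bottom V K0 (Suc k) = Sup {i. i < eta V K0 (Suc k) \<and>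
     V i = Min (V ` {theta V K0 (Suc k)..eta V K0 (Suc k)})}" for V
    by (subst bottom.simps) simp
  ultimately show "bottom V' K0 (Suc k) = b (Suc k)"
    using assms by (auto simp: * th intro!: arg_cong[where f = Sup])
qed

lemma eta_bottom_agree:
  "(\<And>i. i \<le> e k \<Longrightarrow> V' i = V i) \<Longrightarrow> eta V' K0 k = e k \<and> bottom V' K0 k = b k"
proof (induction k)
  case 0
  then show ?case using eta_bottom_agree_0[of V'] by auto
next
  case (Suc k)
  have 1: "V' i = V i" if "i \<le> t (Suc k)" for i using Suc.prems[of i] eta_Suc(1)[of k] that by auto
  have 2: "V' i = V i" if "i \<le> e k" for i using 1[of i] theta_Suc(1)[of k] that by auto
  show ?case
    using eta_bottom_agree_Suc[of k V'] theta_Hplus_agree[of k V'] Suc.IH[OF 2] 1 Suc.prems by auto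
qed

text \<open>The height \<open>h k\<close> is known at \<open>t (Suc k)\<close>, and so also at
  \<open>e (Suc k)\<close>. It can therefore serve as a fixed scale in ruin estimates started at
  either time.\<close>

lemma theta_Hplus_agree':
  assumes "\<And>i. i \<le> t (Suc k) \<Longrightarrow> V' i = V i"
  shows "theta V' K0 (Suc k) = t (Suc k)" "Hplus V' K0 k = h k"
proof -
  have 2: "V' i = V i" if "i \<le> e k" for i using assms[of i] theta_Suc(1)[of k] that by auto
  show "theta V' K0 (Suc k) = t (Suc k)" "Hplus V' K0 k = h k"
    using theta_Hplus_agree[of k V'] assms eta_bottom_agree[OF 2] by auto
qed

lemma eta_Hplus_agree':
  assumes "\<And>i. i \<le> e (Suc k) \<Longrightarrow> V' i = V i"
  shows "eta V' K0 (Suc k) = e (Suc k)" "Hplus V' K0 k = h k"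
  using theta_Hplus_agree'[of k V'] eta_bottom_agree[of "Suc k" V'] assms eta_Suc(1)[of k] by auto

end

section \<open>Measurability of the landmarks\<close>

context
  fixes N :: "'x measure" and F :: "'x \<Rightarrow> nat \<Rightarrow> real" and K0 :: real
  assumes F [measurable]: "\<And>i. (\<lambda>x. F x i) \<in> borel_measurable N"
begin

lemma measurable_at_index:
  assumes "g \<in> N \<rightarrow>\<^sub>M count_space UNIV"
  shows "(\<lambda>x. F x (g x)) \<in> borel_measurable N"
  by (rule measurable_compose_countable[OF F assms])

lemma measurable_Min_interval:
  assumes l: "l \<in> N \<rightarrow>\<^sub>M count_space UNIV" and r: "r \<in> N \<rightarrow>\<^sub>M count_space UNIV"
  shows "(\<lambda>x. Min (F x ` {l x..r x})) \<in> borel_measurable N"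
proof (rule measurable_compose_countable[OF _ l], rule measurable_compose_countable[OF _ r])
  show "(\<lambda>x. Min (F x ` {i..j})) \<in> borel_measurable N" for i j :: nat by measurable
qed

lemma measurable_Max_interval:
  assumes l: "l \<in> N \<rightarrow>\<^sub>M count_space UNIV" and r: "r \<in> N \<rightarrow>\<^sub>M count_space UNIV"
  shows "(\<lambda>x. Max (F x ` {l x..r x})) \<in> borel_measurable N"
proof (rule measurable_compose_countable[OF _ l], rule measurable_compose_countable[OF _ r])
  show "(\<lambda>x. Max (F x ` {i..j})) \<in> borel_measurable N" for i j :: nat by measurable
qed

lemma measurable_valleys_step:
  assumes [measurable]: "(\<lambda>x. eta (F x) K0 k) \<in> N \<rightarrow>\<^sub>M count_space UNIV"
    "(\<lambda>x. bottom (F x) K0 k) \<in> N \<rightarrow>\<^sub>M count_space UNIV"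
  shows "(\<lambda>x. theta (F x) K0 (Suc k)) \<in> N \<rightarrow>\<^sub>M count_space UNIV"
    "(\<lambda>x. Hplus (F x) K0 k) \<in> borel_measurable N"
proof -
  have [measurable]: "(\<lambda>x. F x (bottom (F x) K0 k)) \<in> borel_measurable N"
    by (rule measurable_at_index) measurable
  show t: "(\<lambda>x. theta (F x) K0 (Suc k)) \<in> N \<rightarrow>\<^sub>M count_space UNIV"
    unfolding theta.simps Inf_nat_def mem_Collect_eq by measurable
  show "(\<lambda>x. Hplus (F x) K0 k) \<in> borel_measurable N"
    unfolding Hplus.simps by (intro borel_measurable_diff measurable_Max_interval t) measurable
qed

lemma measurable_eta_bottom:
  "(\<lambda>x. eta (F x) K0 k) \<in> N \<rightarrow>\<^sub>M count_space UNIV \<and> (\<lambda>x. bottom (F x) K0 k) \<in> N \<rightarrow>\<^sub>M count_space UNIV"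
proof (induction k)
  case 0
  have [measurable]: "(\<lambda>x. Min (F x ` {0..i})) \<in> borel_measurable N" for i
    by (rule measurable_Min_interval) auto
  have e [measurable]: "(\<lambda>x. eta (F x) K0 0) \<in> N \<rightarrow>\<^sub>M count_space UNIV"
    unfolding eta.simps Inf_nat_def mem_Collect_eq by measurable
  have [measurable]: "(\<lambda>x. Min (F x ` {0..eta (F x) K0 0})) \<in> borel_measurable N"
    by (rule measurable_Min_interval) auto
  have "(\<lambda>x. bottom (F x) K0 0) \<in> N \<rightarrow>\<^sub>M count_space UNIV"
    unfolding bottom.simps by measurable
  with e show ?case by simp
next
  case (Suc k)
  have [measurable]: "(\<lambda>x. Min (F x ` {0..i})) \<in> borel_measurable N" for i
    by (rule measurable_Min_interval) auto
  have [measurable]: "(\<lambda>x. theta (F x) K0 (Suc k)) \<in> N \<rightarrow>\<^sub>M count_space UNIV"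
    "(\<lambda>x. Hplus (F x) K0 k) \<in> borel_measurable N"
    using measurable_valleys_step[of k] Suc.IH by auto
  have e [measurable]: "(\<lambda>x. eta (F x) K0 (Suc k)) \<in> N \<rightarrow>\<^sub>M count_space UNIV"
    unfolding eta.simps Inf_nat_def mem_Collect_eq by measurable
  have [measurable]: "(\<lambda>x. Min (F x ` {theta (F x) K0 (Suc k)..eta (F x) K0 (Suc k)})) \<in> borel_measurable N"
    by (rule measurable_Min_interval) measurable
  have "(\<lambda>x. bottom (F x) K0 (Suc k)) \<in> N \<rightarrow>\<^sub>M count_space UNIV"
    unfolding bottom.simps by measurable
  with e show ?case by simp
qed

lemma measurable_eta: "(\<lambda>x. eta (F x) K0 k) \<in> N \<rightarrow>\<^sub>M count_space UNIV"
  and measurable_bottom: "(\<lambda>x. bottom (F x) K0 k) \<in> N \<rightarrow>\<^sub>M count_space UNIV"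
  and measurable_theta: "(\<lambda>x. theta (F x) K0 k) \<in> N \<rightarrow>\<^sub>M count_space UNIV"
  and measurable_Hplus: "(\<lambda>x. Hplus (F x) K0 k) \<in> borel_measurable N"
  using measurable_eta_bottom measurable_valleys_step by (auto, cases k) (auto simp: theta.simps(1))

lemma measurable_valley_start: "(\<lambda>x. valley_start (F x) K0 k) \<in> N \<rightarrow>\<^sub>M count_space UNIV"
proof -
  note [measurable] = measurable_eta measurable_theta
  have [measurable]: "(\<lambda>x. Max (F x ` {eta (F x) K0 (k - 1)..theta (F x) K0 k})) \<in> borel_measurable N"
    by (rule measurable_Max_interval) measurable
  show ?thesis unfolding valley_start_def Inf_nat_def mem_Collect_eq by measurable
qed

end

section \<open>Borel-Cantelli and restarting at a stopping time\<close>

lemma (in prob_space) AE_eventually_not: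
  assumes [measurable]: "\<And>n. A n \<in> sets M" and le: "\<And>n. emeasure M (A n) \<le> ennreal (c n)"
    and c: "summable c" "\<And>n. 0 \<le> c n"
  shows "AE x in M. \<forall>\<^sub>F n in sequentially. x \<notin> A n"
proof -
  have "summable (\<lambda>n. measure M (A n))"
    using le c by (intro summable_comparison_test'[OF c(1)]) (auto simp: emeasure_eq_measure)
  then have "AE x in M. \<forall>\<^sub>F n in sequentially. x \<in> space M - A n"
    by (intro borel_cantelli_AE1) (auto simp: less_top[symmetric])
  then show ?thesis by (auto elim!: eventually_mono)
qed

text \<open>A strong Markov inequality. \<open>G\<close> need not be measurable; it restricts attention to the
  environments on which \<open>\<tau>\<close> is an honest stopping time.\<close>

lemma (in sequence_space) nn_integral_stopping_le:
  fixes \<tau> :: "(nat \<Rightarrow> 'a) \<Rightarrow> nat"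
  assumes [measurable]: "\<tau> \<in> S \<rightarrow>\<^sub>M count_space UNIV" "f \<in> borel_measurable S" "W \<in> borel_measurable S"
    and G: "AE w in S. G w"
    and determined: "\<And>w w'. G w \<Longrightarrow> (\<And>i. i \<le> \<tau> w \<Longrightarrow> w' i = w i) \<Longrightarrow> \<tau> w' = \<tau> w \<and> W w' = W w"
    and step: "\<And>w. G w \<Longrightarrow> \<exists>g\<in>borel_measurable S. (\<integral>\<^sup>+w'. g w' \<partial>S) \<le> W w \<and>
      (\<forall>w'. G (comb_seq (Suc (\<tau> w)) w w') \<longrightarrow> f (comb_seq (Suc (\<tau> w)) w w') \<le> g w')"
  shows "(\<integral>\<^sup>+w. f w \<partial>S) \<le> (\<integral>\<^sup>+w. W w \<partial>S)"
proof -
  have [measurable]: "(\<lambda>w. indicator {t} (\<tau> w) :: ennreal) \<in> borel_measurable S" for t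
    by (rule measurable_compose[OF assms(1)]) simp
  have split: "(\<integral>\<^sup>+w. F w \<partial>S) = (\<Sum>t. \<integral>\<^sup>+w. F w * indicator {t} (\<tau> w) \<partial>S)"
    if [measurable]: "F \<in> borel_measurable S" for F :: "_ \<Rightarrow> ennreal"
  proof -
    have "F w = (\<Sum>t. F w * indicator {t} (\<tau> w))" for w
      using suminf_cmult_indicator[of "\<lambda>t. {t}" "\<tau> w" "\<tau> w" "\<lambda>_. F w"]
      by (auto simp: disjoint_family_on_def)
    then have "(\<integral>\<^sup>+w. F w \<partial>S) = (\<integral>\<^sup>+w. (\<Sum>t. F w * indicator {t} (\<tau> w)) \<partial>S)" by simp
    also have "\<dots> = (\<Sum>t. \<integral>\<^sup>+w. F w * indicator {t} (\<tau> w) \<partial>S)"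
      by (rule nn_integral_suminf) measurable
    finally show ?thesis .
  qed
  have "(\<integral>\<^sup>+w. f w * indicator {t} (\<tau> w) \<partial>S) \<le> (\<integral>\<^sup>+w. W w * indicator {t} (\<tau> w) \<partial>S)" for t
  proof -
    \<comment> \<open>The coordinates 0 to \<open>t\<close> are kept and all later ones are
      resampled independently.\<close>
    let ?c = "\<lambda>w w'. comb_seq (Suc t) w w'"
    have "(\<integral>\<^sup>+w. f w * indicator {t} (\<tau> w) \<partial>S) =
        (\<integral>\<^sup>+w. \<integral>\<^sup>+w'. f (?c w w') * indicator {t} (\<tau> (?c w w')) \<partial>S \<partial>S)"
      by (rule nn_integral_comb_seq) measurable
    also have "\<dots> \<le> (\<integral>\<^sup>+w. \<integral>\<^sup>+w'. W (?c w w') * indicator {t} (\<tau> (?c w w')) \<partial>S \<partial>S)"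
    proof (rule nn_integral_mono_AE)
      show "AE w in S. (\<integral>\<^sup>+w'. f (?c w w') * indicator {t} (\<tau> (?c w w')) \<partial>S) \<le>
          (\<integral>\<^sup>+w'. W (?c w w') * indicator {t} (\<tau> (?c w w')) \<partial>S)"
        using AE_comb_seq[OF G, of "Suc t"]
      proof eventually_elim
        case (elim w)
        show ?case
        proof (cases "\<exists>w'. G (?c w w') \<and> \<tau> (?c w w') = t")
          \<comment> \<open>Almost every continuation of \<open>w\<close> is good, and no good one
            stops at \<open>t\<close>, so the left integrand vanishes almost everywhere.\<close>
          case False
          have "(\<integral>\<^sup>+w'. f (?c w w') * indicator {t} (\<tau> (?c w w')) \<partial>S) \<le> (\<integral>\<^sup>+w'. 0 \<partial>S)"
            by (rule nn_integral_mono_AE) (use elim False in \<open>auto elim!: eventually_mono simp: indicator_def\<close>)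
          then show ?thesis by simp
        next
          \<comment> \<open>A single good continuation stopping at \<open>t\<close> decides for all:
            \<open>\<tau>\<close> and \<open>W\<close> are determined by the kept coordinates, so
            both are constant over the continuations.\<close>
          case True
          then obtain w0 where w0: "G (?c w w0)" "\<tau> (?c w w0) = t" by auto
          let ?u = "?c w w0"
          have same: "?c ?u w' = ?c w w'" for w' by (auto simp: comb_seq_def)
          have det: "\<tau> (?c w w') = t" "W (?c w w') = W ?u" for w'
            using determined[OF w0(1), of "?c w w'"] w0(2) by (auto simp: comb_seq_def)
          obtain g where g: "g \<in> borel_measurable S" "(\<integral>\<^sup>+w'. g w' \<partial>S) \<le> W ?u"
            "\<And>w'. G (?c w w') \<Longrightarrow> f (?c w w') \<le> g w'"
            using step[OF w0(1)] unfolding w0(2) same by blast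
          have "(\<integral>\<^sup>+w'. f (?c w w') * indicator {t} (\<tau> (?c w w')) \<partial>S) \<le> (\<integral>\<^sup>+w'. g w' \<partial>S)"
            by (rule nn_integral_mono_AE) (use elim g in \<open>auto elim!: eventually_mono simp: indicator_def\<close>)
          also have "\<dots> \<le> W ?u" by (rule g(2))
          also have "\<dots> = (\<integral>\<^sup>+w'. W (?c w w') * indicator {t} (\<tau> (?c w w')) \<partial>S)"
          proof -
            have "W (?c w w') * indicator {t} (\<tau> (?c w w')) = W ?u" for w'
              using det(1)[of w'] by (simp only: det(2)[of w']) simp
            then show ?thesis by (simp only: nn_integral_const P.emeasure_space_1 mult_1_right)
          qed
          finally show ?thesis .
        qed
      qed
    qed
    also have "\<dots> = (\<integral>\<^sup>+w. W w * indicator {t} (\<tau> w) \<partial>S)"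
      by (rule nn_integral_comb_seq[symmetric]) measurable
    finally show ?thesis .
  qed
  then show ?thesis by (subst (1 2) split) (auto intro!: suminf_le)
qed

section \<open>Oscillation of centered walks\<close>

context centered_steps
begin

text \<open>Leaving \<open>[0, l)\<close> takes the reflected walk a time of order
  \<open>l^2\<close>, so the fourth power makes the failure probability of order
  \<open>1 / l^2\<close>, which is summable.\<close>

lemma AE_drawup_reached:
  assumes v: "0 < v"
  shows "AE w in S. \<forall>\<^sub>F l in sequentially. \<exists>i\<le>l ^ 4. real l \<le> drawup (walk xi w) i"
proof -
  let ?A = "\<lambda>l. {w \<in> space S. \<forall>i<Suc (l ^ 4). drawup (walk xi w) i < real l}"
  let ?c = "\<lambda>l. (1 + C)\<^sup>2 / v * (1 / real l ^ 2)"
  have "AE w in S. \<forall>\<^sub>F l in sequentially. w \<notin> ?A l"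
  proof (rule P.AE_eventually_not)
    show "emeasure S (?A l) \<le> ennreal (?c l)" for l
    proof (cases "l = 0")
      case True
      have "drawup (walk xi w) 0 = 0" for w by (simp add: drawup_def)
      then have "?A l = {}" using True by auto
      then show ?thesis by (simp only: emeasure_empty zero_le)
    next
      case False
      have "emeasure S (?A l) \<le> ennreal ((real l + C)\<^sup>2 / v / real (Suc (l ^ 4)))"
        by (rule emeasure_small_drawup) (use v False in auto)
      also have "\<dots> \<le> ennreal (?c l)"
      proof (rule ennreal_leI)
        have l: "1 \<le> real l" using False by simp
        have "real l + C \<le> (1 + C) * real l"
          using mult_left_mono[OF l, of C] C_pos by (simp add: algebra_simps)
        then have "(real l + C)\<^sup>2 \<le> ((1 + C) * real l)\<^sup>2"
          using C_pos by (intro power_mono) auto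
        then have "(real l + C)\<^sup>2 / v / real (Suc (l ^ 4)) \<le> ((1 + C) * real l)\<^sup>2 / v / real (l ^ 4)"
          using v l by (intro frac_le divide_right_mono) auto
        also have "real (l ^ 4) = (real l)\<^sup>2 * (real l)\<^sup>2" by (simp flip: power_add)
        also have "((1 + C) * real l)\<^sup>2 / v / ((real l)\<^sup>2 * (real l)\<^sup>2) = ?c l"
        proof -
          have "K * q / v / (q * q) = K / v * (1 / q)" if "q \<noteq> 0" for K q :: real
            using v that by (simp add: field_simps)
          from this[of "(real l)\<^sup>2" "(1 + C)\<^sup>2"] show ?thesis using l by (simp add: power_mult_distrib)
        qed
        finally show "(real l + C)\<^sup>2 / v / real (Suc (l ^ 4)) \<le> ?c l" .
      qed
      finally show ?thesis .
    qed
    show "summable ?c" 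
      using inverse_power_summable[of 2, where 'a = real]
      by (simp only: inverse_eq_divide summable_mult)
    show "?A l \<in> sets S" for l by measurable
    show "0 \<le> ?c l" for l using v by simp
  qed
  then show ?thesis
  proof (rule AE_mp, intro AE_I2 impI)
    fix w assume "w \<in> space S" "\<forall>\<^sub>F l in sequentially. w \<notin> ?A l"
    then show "\<forall>\<^sub>F l in sequentially. \<exists>i\<le>l ^ 4. real l \<le> drawup (walk xi w) i"
      by (elim eventually_mono) (auto simp: not_less less_Suc_eq_le)
  qed
qed

lemma AE_oscillating_walk:
  assumes v: "0 < v"
  shows "AE w in S. oscillating (walk xi w)"
proof -
  have drawup: "AE w in S. \<forall>c. \<exists>i. c \<le> drawup (walk xi w) i"
    using AE_drawup_reached[OF v]
  proof eventually_elim
    case (elim w)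
    then obtain L where L: "\<And>l. L \<le> l \<Longrightarrow> \<exists>i\<le>l ^ 4. real l \<le> drawup (walk xi w) i"
      by (auto simp: eventually_sequentially)
    show ?case
    proof
      fix c
      show "\<exists>i. c \<le> drawup (walk xi w) i"
        using L[of "max L (nat \<lceil>c\<rceil>)"] by (meson max.cobounded1 max.cobounded2 of_nat_ceiling of_nat_le_iff order_trans)
    qed
  qed
  \<comment> \<open>A path staying above \<open>- B\<close> still has a drawup of
    \<open>a + B\<close>, hence reaches \<open>a\<close> without having dropped to
    \<open>- B\<close>. By gambler's ruin the probability of this tends to 0 as \<open>a\<close>
    grows.\<close>
  have "AE w in S. \<exists>i. walk xi w i \<le> - real B" for B
  proof -
    let ?N = "{w \<in> space S. \<not> (\<exists>i. walk xi w i \<le> - real B)}"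
    have "emeasure S ?N \<le> ennreal ((real B + C) / (real a + real B + C))" for a :: nat
    proof -
      let ?R = "{w \<in> space S. \<exists>n. real a \<le> walk xi w n \<and> (\<forall>i<n. - real B < walk xi w i)}"
      have "emeasure S ?N \<le> emeasure S ?R"
      proof (rule emeasure_mono_AE)
        show "AE w in S. w \<in> ?N \<longrightarrow> w \<in> ?R"
          using drawup
        proof eventually_elim
          case (elim w)
          then obtain i where "real a + real B \<le> drawup (walk xi w) i" by blast
          then obtain j where j: "real a + real B \<le> walk xi w i - walk xi w j" by (auto simp: drawup_ge_iff)
          show ?case
          proof
            assume N: "w \<in> ?N"
            then have B: "- real B < walk xi w l" for l by (auto simp: not_le)
            have "real a \<le> walk xi w i" using B[of j] j by linarith
            then show "w \<in> ?R" using N B by blast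
          qed
        qed
      qed measurable
      also have "\<dots> \<le> ennreal ((real B + C) / (real a + real B + C))"
        by (rule gambler_ruin) (use C_pos in auto)
      finally show ?thesis .
    qed
    moreover have "(\<lambda>a. ennreal ((real B + C) / (real a + real B + C))) \<longlonglongrightarrow> ennreal 0"
      by (rule tendsto_ennrealI) real_asymp
    ultimately have "emeasure S ?N \<le> 0"
      by (intro LIMSEQ_le_const[where X = "\<lambda>a. ennreal ((real B + C) / (real a + real B + C))"]) auto
    then show ?thesis by (intro AE_I'[of ?N]) (auto simp: null_sets_def)
  qed
  then have "AE w in S. \<forall>B. \<exists>i. walk xi w i \<le> - real B" by (subst AE_all_countable) auto
  then show ?thesis
    using drawup
  proof eventually_elim
    case (elim w)
    show ?case unfolding oscillating_def
    proof (intro conjI allI)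
      fix c :: real
      obtain i where "walk xi w i \<le> - real (nat \<lceil>- c\<rceil>)" using elim(1) by blast
      then show "\<exists>i. walk xi w i \<le> c" by (intro exI[of _ i]) linarith
    qed (use elim(2) in auto)
  qed
qed

end

section \<open>Growth of the valleys\<close>

context valleys
begin

text \<open>The path goes from \<open>t (Suc k)\<close>, at height at most \<open>V (b k)\<close>,
  to \<open>e (Suc k)\<close>, at least \<open>h k\<close> above the new bottom. If that bottom is
  less than \<open>s\<close> deeper than the old one, this is a climb of \<open>h k - s\<close> with
  no previous fall by \<open>s\<close>.\<close>

lemma climb_of_small_descent:
  assumes "V (b k) - V (b (Suc k)) < s"
  shows "\<exists>n. h k - s \<le> V (t (Suc k) + n) - V (t (Suc k)) \<and>
    (\<forall>i<n. - s < V (t (Suc k) + i) - V (t (Suc k)))"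
proof (intro exI conjI allI impI)
  let ?n = "e (Suc k) - t (Suc k)"
  have n: "t (Suc k) + ?n = e (Suc k)" using eta_Suc(1)[of k] by simp
  show "h k - s \<le> V (t (Suc k) + ?n) - V (t (Suc k))"
    unfolding n using V_eta_Suc[of k] theta_Suc(2)[of k] assms by linarith
  show "- s < V (t (Suc k) + i) - V (t (Suc k))" if "i < ?n" for i
    using bottom_min[of "t (Suc k) + i" "Suc k"] theta_Suc(2)[of k] assms that n by linarith
qed

text \<open>At \<open>e (Suc k)\<close> the path is already \<open>h k\<close> above its bottom. A
  new height below \<open>h k + s\<close> leaves less than \<open>s\<close> of further rise before
  the path falls back to the bottom at \<open>t (Suc (Suc k))\<close>.\<close>

lemma fall_of_small_rise:
  assumes "h (Suc k) < h k + s"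
  shows "\<exists>n. h k \<le> V (e (Suc k)) - V (e (Suc k) + n) \<and>
    (\<forall>i<n. V (e (Suc k) + i) - V (e (Suc k)) < s)"
proof (intro exI conjI allI impI)
  let ?n = "t (Suc (Suc k)) - e (Suc k)"
  have n: "e (Suc k) + ?n = t (Suc (Suc k))" using theta_Suc(1)[of "Suc k"] by simp
  show "h k \<le> V (e (Suc k)) - V (e (Suc k) + ?n)"
    unfolding n using V_eta_Suc[of k] theta_Suc(2)[of "Suc k"] by linarith
  show "V (e (Suc k) + i) - V (e (Suc k)) < s" if "i < ?n" for i
    using V_le_Hplus[of "Suc k" "e (Suc k) + i"] V_eta_Suc[of k] assms that n by linarith
qed

lemma V_eta_Suc_le:
  assumes "\<And>i. \<bar>V (Suc i) - V i\<bar> \<le> C"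
  shows "V (e (Suc k)) \<le> V (b (Suc k)) + h k + C"
proof -
  obtain j where j: "e (Suc k) = Suc j" using eta_Suc(1)[of k] by (cases "e (Suc k)") auto
  have "V j - V (b (Suc k)) \<le> h k"
    using drawup_le_Hplus[of j k] bottom_less_eta[of "Suc k"] j by (auto simp: drawup_le_iff)
  then show ?thesis using assms[of j] unfolding j by linarith
qed

text \<open>The summand \<open>C\<close> is the overshoot at \<open>e (Suc k)\<close>: there the
  path is at most \<open>h k + C\<close> above the bottom. From there it climbs to the top at
  \<open>m (Suc (Suc k))\<close> without returning to the bottom.\<close>

lemma climb_of_large_rise:
  assumes "\<And>i. \<bar>V (Suc i) - V i\<bar> \<le> C" and "c < h (Suc k)"
  shows "\<exists>n. c - h k - C \<le> V (e (Suc k) + n) - V (e (Suc k)) \<and>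
    (\<forall>i<n. - (h k + C) < V (e (Suc k) + i) - V (e (Suc k)))"
proof (intro exI conjI allI impI)
  let ?m = "m (Suc (Suc k))"
  let ?n = "?m - e (Suc k)"
  have n: "e (Suc k) + ?n = ?m" using valley_start_Suc(1)[of "Suc k"] by simp
  show "c - h k - C \<le> V (e (Suc k) + ?n) - V (e (Suc k))"
    unfolding n using V_eta_Suc_le[OF assms(1), of k] assms(2) valley_start_Suc(3)[of "Suc k"] by linarith
  show "- (h k + C) < V (e (Suc k) + i) - V (e (Suc k))" if "i < ?n" for i
    using V_above_bottom[of "Suc k" "e (Suc k) + i"] V_eta_Suc_le[OF assms(1), of k]
      valley_start_Suc(2)[of "Suc k"] that n by linarith
qed

end

locale valley_environment = centered_steps M xi C for M :: "'a measure" and xi C +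
  fixes K0 :: real
  assumes v_pos: "0 < v" and K0_pos: "0 < K0"
begin

text \<open>By the shift, \<open>V w t\<close> reads the coordinates 1 to \<open>t\<close>. After
  replacing everything beyond the first \<open>Suc t\<close> coordinates, the increments from
  \<open>t\<close> on form a walk of the fresh sequence, see \<open>V_comb_seq\<close>.\<close>

definition V :: "(nat \<Rightarrow> 'a) \<Rightarrow> nat \<Rightarrow> real" where
  "V w = walk xi (\<lambda>i. w (Suc i))"

abbreviation "H k w \<equiv> Hplus (V w) K0 k"

text \<open>Plays the part of \<open>G\<close> in \<open>nn_integral_stopping_le\<close>. Bounding
  all steps at once makes the overshoot bounds deterministic on good environments.\<close>

definition good :: "(nat \<Rightarrow> 'a) \<Rightarrow> bool" where
  "good w \<longleftrightarrow> oscillating (V w) \<and> (\<forall>i. \<bar>xi (w i)\<bar> \<le> C)"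

lemma V_diff: "V w (Suc i) - V w i = xi (w (Suc i))"
  by (simp add: V_def walk_def)

lemma V_agree: "(\<And>j. j \<le> i \<Longrightarrow> w' j = w j) \<Longrightarrow> V w' i = V w i"
  by (auto simp: V_def walk_def intro!: sum.cong)

lemma V_comb_seq: "V (comb_seq (Suc t) w w') (t + i) - V (comb_seq (Suc t) w w') t = walk xi w' i"
proof (induction i)
  case (Suc i)
  have "V (comb_seq (Suc t) w w') (Suc (t + i)) - V (comb_seq (Suc t) w w') (t + i) = xi (w' i)"
    unfolding V_diff by (simp add: comb_seq_def)
  then show ?case using Suc by (simp add: walk_def)
qed simp

lemma V_measurable [measurable]: "(\<lambda>w. V w i) \<in> borel_measurable S"
  unfolding V_def walk_def by measurable

lemma good_valleys: "good w \<Longrightarrow> valleys (V w) K0"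
  using K0_pos by (auto simp: good_def valleys_def)

lemma good_step: "good w \<Longrightarrow> \<bar>V w (Suc i) - V w i\<bar> \<le> C"
  by (auto simp: good_def V_diff)

lemma AE_good: "AE w in S. good w"
proof -
  have "AE w in S. \<bar>xi (w i)\<bar> \<le> C" for i
    by (rule AE_PiM_component) (use xi_bounded M.prob_space_axioms in auto)
  then have "AE w in S. \<forall>i. \<bar>xi (w i)\<bar> \<le> C" by (simp add: AE_all_countable)
  then show ?thesis
    using AE_shift[OF AE_oscillating_walk[OF v_pos]] by eventually_elim (simp add: good_def V_def)
qed

lemma H_measurable [measurable]: "(\<lambda>w. H k w) \<in> borel_measurable S"
  and eta_measurable [measurable]: "(\<lambda>w. eta (V w) K0 k) \<in> S \<rightarrow>\<^sub>M count_space UNIV"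
  and theta_measurable [measurable]: "(\<lambda>w. theta (V w) K0 k) \<in> S \<rightarrow>\<^sub>M count_space UNIV"
  and bottom_measurable [measurable]: "(\<lambda>w. bottom (V w) K0 k) \<in> S \<rightarrow>\<^sub>M count_space UNIV"
  by (rule measurable_Hplus measurable_eta measurable_theta measurable_bottom, rule V_measurable)+

lemma V_bottom_measurable [measurable]: "(\<lambda>w. V w (bottom (V w) K0 k)) \<in> borel_measurable S"
  by (rule measurable_at_index[OF V_measurable bottom_measurable])

lemma signed_gambler_ruin:
  assumes "0 < a + b + C" "0 \<le> b" "\<sigma> = 1 \<or> \<sigma> = - 1"
  shows "emeasure S {w \<in> space S. \<exists>n. a \<le> \<sigma> * walk xi w n \<and> (\<forall>i<n. - b < \<sigma> * walk xi w i)}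
    \<le> ennreal ((b + C) / (a + b + C))"
  using assms(3)
proof
  assume "\<sigma> = 1"
  then show ?thesis using gambler_ruin[OF assms(1,2)] by simp
next
  assume "\<sigma> = - 1"
  then show ?thesis
    using centered_steps.gambler_ruin[OF centered_steps_uminus assms(1,2)] by (simp add: walk_uminus)
qed

text \<open>One form for all ruin events: \<open>\<sigma>\<close> selects climbs or falls, and the
  scales \<open>a\<close> and \<open>b\<close> may depend on \<open>H k\<close> because it is known
  at \<open>\<tau>\<close>. For the same reason the weight \<open>g\<close> passes through the
  conditional estimate; \<open>H_decay\<close> uses it to obtain a recursion.\<close>

lemma weighted_ruin_after_stopping:
  assumes [measurable]: "\<tau> \<in> S \<rightarrow>\<^sub>M count_space UNIV" "A \<in> sets S" "g \<in> borel_measurable borel" "p \<in> borel_measurable borel"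
    and determined: "\<And>w w'. good w \<Longrightarrow> (\<And>i. i \<le> \<tau> w \<Longrightarrow> V w' i = V w i) \<Longrightarrow> \<tau> w' = \<tau> w \<and> H k w' = H k w"
    and A: "\<And>w. good w \<Longrightarrow> w \<in> A \<Longrightarrow> \<exists>n. a (H k w) \<le> \<sigma> * (V w (\<tau> w + n) - V w (\<tau> w)) \<and>
      (\<forall>i<n. - b (H k w) < \<sigma> * (V w (\<tau> w + i) - V w (\<tau> w)))"
    and \<sigma>: "\<sigma> = 1 \<or> \<sigma> = - 1"
    and ab: "\<And>h. K0 \<le> h \<Longrightarrow> 0 < a h + b h + C \<and> 0 \<le> b h \<and> (b h + C) / (a h + b h + C) \<le> p h"
  shows "(\<integral>\<^sup>+w. ennreal (g (H k w)) * indicator A w \<partial>S) \<le> (\<integral>\<^sup>+w. ennreal (g (H k w)) * ennreal (p (H k w)) \<partial>S)"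
proof (rule nn_integral_stopping_le[where G = good and \<tau> = \<tau>])
  show "\<tau> w' = \<tau> w \<and> ennreal (g (H k w')) * ennreal (p (H k w')) = ennreal (g (H k w)) * ennreal (p (H k w))"
    if "good w" "\<And>i. i \<le> \<tau> w \<Longrightarrow> w' i = w i" for w w'
    using determined[OF that(1), of w'] V_agree[of _ w' w] that(2) by auto
next
  fix w assume w: "good w"
  let ?h = "H k w"
  let ?R = "{w \<in> space S. \<exists>n. a ?h \<le> \<sigma> * walk xi w n \<and> (\<forall>i<n. - b ?h < \<sigma> * walk xi w i)}"
  let ?c = "\<lambda>w'. comb_seq (Suc (\<tau> w)) w w'"
  have h: "K0 \<le> ?h" using valleys.Hplus_ge[OF good_valleys[OF w]] .
  have "emeasure S ?R \<le> ennreal ((b ?h + C) / (a ?h + b ?h + C))"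
    by (rule signed_gambler_ruin) (use ab[OF h] \<sigma> in auto)
  also have "\<dots> \<le> ennreal (p ?h)" using ab[OF h] by (intro ennreal_leI) auto
  finally have R: "emeasure S ?R \<le> ennreal (p ?h)" .
  show "\<exists>f\<in>borel_measurable S. (\<integral>\<^sup>+w'. f w' \<partial>S) \<le> ennreal (g ?h) * ennreal (p ?h) \<and>
    (\<forall>w'. good (?c w') \<longrightarrow> ennreal (g (H k (?c w'))) * indicator A (?c w') \<le> f w')"
  proof (intro bexI conjI allI impI)
    \<comment> \<open>The dominating function has to work for every \<open>w'\<close>, also outside
      \<open>space S\<close>. The set written with an implication contains those points and agrees
      with \<open>?R\<close> on \<open>space S\<close>.\<close>
    show "(\<integral>\<^sup>+w'. ennreal (g ?h) * indicator {w. w \<in> space S \<longrightarrow> w \<in> ?R} w' \<partial>S) \<le> ennreal (g ?h) * ennreal (p ?h)"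
    proof -
      have "(\<integral>\<^sup>+w'. ennreal (g ?h) * indicator {w. w \<in> space S \<longrightarrow> w \<in> ?R} w' \<partial>S) =
          (\<integral>\<^sup>+w'. ennreal (g ?h) * indicator ?R w' \<partial>S)"
        by (intro nn_integral_cong) (auto simp: indicator_def)
      also have "\<dots> = ennreal (g ?h) * emeasure S ?R" by (rule nn_integral_cmult_indicator) measurable
      finally show ?thesis using R by (simp add: mult_left_mono)
    qed
    show "(\<lambda>w'. ennreal (g ?h) * indicator {w. w \<in> space S \<longrightarrow> w \<in> ?R} w') \<in> borel_measurable S"
      by (subst measurable_cong[where g = "\<lambda>w'. ennreal (g ?h) * indicator ?R w'"])
        (auto simp: indicator_def intro!: borel_measurable_times_ennreal borel_measurable_indicator)
    fix w' assume c: "good (?c w')"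
    have V: "V (?c w') i = V w i" if "i \<le> \<tau> w" for i
      by (rule V_agree) (use that in \<open>auto simp: comb_seq_def\<close>)
    have det: "\<tau> (?c w') = \<tau> w" "H k (?c w') = ?h" using determined[OF w V] by auto
    have "w' \<in> {w. w \<in> space S \<longrightarrow> w \<in> ?R}" if "?c w' \<in> A"
      using A[OF c that] unfolding det V_comb_seq by auto
    then show "ennreal (g (H k (?c w'))) * indicator A (?c w') \<le>
        ennreal (g ?h) * indicator {w. w \<in> space S \<longrightarrow> w \<in> ?R} w'"
      unfolding det by (auto simp: indicator_def)
  qed
qed (use AE_good in measurable)

section \<open>Probabilities of small gaps and of large rises\<close>

lemmas eta_determined = valleys.eta_Hplus_agree'[OF good_valleys]
lemmas theta_determined = valleys.theta_Hplus_agree'[OF good_valleys]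

lemma prob_small_rise:
  assumes [measurable]: "g \<in> borel_measurable borel" "p \<in> borel_measurable borel" "s \<in> borel_measurable borel"
    and p: "\<And>h. K0 \<le> h \<Longrightarrow> 0 \<le> s h \<and> (s h + C) / (h + s h + C) \<le> p h"
  shows "(\<integral>\<^sup>+w. ennreal (g (H k w)) * indicator {w \<in> space S. H (Suc k) w < H k w + s (H k w)} w \<partial>S)
    \<le> (\<integral>\<^sup>+w. ennreal (g (H k w)) * ennreal (p (H k w)) \<partial>S)"
proof (rule weighted_ruin_after_stopping[where \<tau> = "\<lambda>w. eta (V w) K0 (Suc k)" and \<sigma> = "- 1" and a = "\<lambda>h. h" and b = s])
  fix w assume w: "good w" "w \<in> {w \<in> space S. H (Suc k) w < H k w + s (H k w)}"
  interpret valleys "V w" K0 using good_valleys[OF w(1)] .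
  obtain n where "h k \<le> V w (e (Suc k)) - V w (e (Suc k) + n)"
    "\<forall>i<n. V w (e (Suc k) + i) - V w (e (Suc k)) < s (h k)"
    using fall_of_small_rise[of k "s (h k)"] w(2) by auto
  then show "\<exists>n. H k w \<le> - 1 * (V w (e (Suc k) + n) - V w (e (Suc k))) \<and>
      (\<forall>i<n. - s (H k w) < - 1 * (V w (e (Suc k) + i) - V w (e (Suc k))))"
    by (intro exI[of _ n]) auto
next
  fix h assume "K0 \<le> h"
  then show "0 < h + s h + C \<and> 0 \<le> s h \<and> (s h + C) / (h + s h + C) \<le> p h"
    using p[of h] K0_pos C_pos by auto
next
    show "eta (V w') K0 (Suc k) = eta (V w) K0 (Suc k) \<and> H k w' = H k w"
      if "good w" "\<And>i. i \<le> eta (V w) K0 (Suc k) \<Longrightarrow> V w' i = V w i" for w w'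
      using eta_determined[OF that] by simp
    show "{w \<in> space S. H (Suc k) w < H k w + s (H k w)} \<in> sets S" by measurable
  qed (rule eta_measurable theta_measurable assms(1) assms(2) | simp)+

lemma prob_large_rise:
  assumes [measurable]: "p \<in> borel_measurable borel" "c \<in> borel_measurable borel"
    and p: "\<And>h. K0 \<le> h \<Longrightarrow> 0 < c h \<and> (h + C + C) / (c h + C) \<le> p h"
  shows "emeasure S {w \<in> space S. c (H k w) < H (Suc k) w} \<le> (\<integral>\<^sup>+w. ennreal (p (H k w)) \<partial>S)"
proof -
  have "(\<integral>\<^sup>+w. ennreal 1 * indicator {w \<in> space S. c (H k w) < H (Suc k) w} w \<partial>S)
      \<le> (\<integral>\<^sup>+w. ennreal 1 * ennreal (p (H k w)) \<partial>S)"
  proof (rule weighted_ruin_after_stopping[where \<tau> = "\<lambda>w. eta (V w) K0 (Suc k)" and \<sigma> = 1 and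
        a = "\<lambda>h. c h - h - C" and b = "\<lambda>h. h + C" and g = "\<lambda>_. 1"])
    fix w assume w: "good w" "w \<in> {w \<in> space S. c (H k w) < H (Suc k) w}"
    interpret valleys "V w" K0 using good_valleys[OF w(1)] .
    show "\<exists>n. c (H k w) - H k w - C \<le> 1 * (V w (e (Suc k) + n) - V w (e (Suc k))) \<and>
        (\<forall>i<n. - (H k w + C) < 1 * (V w (e (Suc k) + i) - V w (e (Suc k))))"
      using climb_of_large_rise[OF good_step[OF w(1)], of "c (h k)" k] w(2) by auto
  next
    fix h assume "K0 \<le> h"
    then show "0 < c h - h - C + (h + C) + C \<and> 0 \<le> h + C \<and> (h + C + C) / (c h - h - C + (h + C) + C) \<le> p h"
      using p[of h] K0_pos C_pos by auto
  next
    show "eta (V w') K0 (Suc k) = eta (V w) K0 (Suc k) \<and> H k w' = H k w"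
      if "good w" "\<And>i. i \<le> eta (V w) K0 (Suc k) \<Longrightarrow> V w' i = V w i" for w w'
      using eta_determined[OF that] by simp
    show "{w \<in> space S. c (H k w) < H (Suc k) w} \<in> sets S" by measurable
  qed (rule eta_measurable theta_measurable assms(1) assms(2) | simp)+
  then show ?thesis by simp
qed

lemma prob_small_descent:
  assumes [measurable]: "p \<in> borel_measurable borel" "s \<in> borel_measurable borel"
    and p: "\<And>h. K0 \<le> h \<Longrightarrow> 0 \<le> s h \<and> (s h + C) / (h + C) \<le> p h"
  shows "emeasure S {w \<in> space S. V w (bottom (V w) K0 k) - V w (bottom (V w) K0 (Suc k)) < s (H k w)}
    \<le> (\<integral>\<^sup>+w. ennreal (p (H k w)) \<partial>S)"
proof -
  let ?A = "{w \<in> space S. V w (bottom (V w) K0 k) - V w (bottom (V w) K0 (Suc k)) < s (H k w)}"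
  have "(\<integral>\<^sup>+w. ennreal 1 * indicator ?A w \<partial>S) \<le> (\<integral>\<^sup>+w. ennreal 1 * ennreal (p (H k w)) \<partial>S)"
  proof (rule weighted_ruin_after_stopping[where \<tau> = "\<lambda>w. theta (V w) K0 (Suc k)" and \<sigma> = 1 and
        a = "\<lambda>h. h - s h" and b = s and g = "\<lambda>_. 1"])
    fix w assume w: "good w" "w \<in> ?A"
    interpret valleys "V w" K0 using good_valleys[OF w(1)] .
    show "\<exists>n. H k w - s (H k w) \<le> 1 * (V w (t (Suc k) + n) - V w (t (Suc k))) \<and>
        (\<forall>i<n. - s (H k w) < 1 * (V w (t (Suc k) + i) - V w (t (Suc k))))"
      using climb_of_small_descent[of k "s (h k)"] w(2) by auto
  next
    fix h assume "K0 \<le> h"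
    then show "0 < h - s h + s h + C \<and> 0 \<le> s h \<and> (s h + C) / (h - s h + s h + C) \<le> p h"
      using p[of h] K0_pos C_pos by auto
  next
    show "theta (V w') K0 (Suc k) = theta (V w) K0 (Suc k) \<and> H k w' = H k w"
      if "good w" "\<And>i. i \<le> theta (V w) K0 (Suc k) \<Longrightarrow> V w' i = V w i" for w w'
      using theta_determined[OF that] by simp
    show "?A \<in> sets S" by measurable
  qed (rule eta_measurable theta_measurable assms(1) assms(2) | simp)+
  then show ?thesis by simp
qed

text \<open>If the height doubles, its power \<open>- \<alpha>\<close> shrinks by the factor
  \<open>r\<close>; otherwise it does not grow. As failure to double has conditional probability at
  most \<open>q0\<close>, each valley multiplies the expectation by at most
  \<open>r + (1 - r) * q0 < 1\<close>.\<close>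

lemma H_decay:
  assumes \<alpha>: "0 < \<alpha>"
  obtains q where "0 < q" "q < 1"
    "\<And>k. (\<integral>\<^sup>+w. ennreal (H k w powr - \<alpha>) \<partial>S) \<le> ennreal (K0 powr - \<alpha> * q ^ k)"
proof -
  \<comment> \<open>The ruin bound \<open>(h + C) / (2 * h + C)\<close> for failing to double
    decreases in \<open>h\<close>, so its value at the smallest height \<open>K0\<close> is a
    uniform bound.\<close>
  define q0 where "q0 = (K0 + C) / (2 * K0 + C)"
  define r where "r = (2::real) powr - \<alpha>"
  define q where "q = r + (1 - r) * q0"
  have q0: "0 < q0" "q0 < 1" using K0_pos C_pos by (auto simp: q0_def field_simps)
  have r: "0 < r" "r < 1" using \<alpha> by (auto simp: r_def powr_less_one)
  have q: "0 < q" "q < 1"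
  proof -
    show "0 < q" using r q0 by (auto simp: q_def intro!: add_pos_nonneg)
    have "(1 - r) * q0 < (1 - r) * 1" using r q0 by (intro mult_strict_left_mono) auto
    then show "q < 1" by (simp add: q_def)
  qed
  let ?x = "\<lambda>k w. ennreal (H k w powr - \<alpha>)"
  have step: "(\<integral>\<^sup>+w. ?x (Suc k) w \<partial>S) \<le> ennreal q * (\<integral>\<^sup>+w. ?x k w \<partial>S)" for k
  proof -
    let ?A = "{w \<in> space S. H (Suc k) w < H k w + H k w}"
    have "(\<integral>\<^sup>+w. ?x (Suc k) w \<partial>S) \<le> (\<integral>\<^sup>+w. ennreal r * ?x k w + ennreal (1 - r) * (?x k w * indicator ?A w) \<partial>S)"
    proof (rule nn_integral_mono_AE)
      show "AE w in S. ?x (Suc k) w \<le> ennreal r * ?x k w + ennreal (1 - r) * (?x k w * indicator ?A w)"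
        using AE_good AE_space
      proof eventually_elim
        case (elim w)
        interpret valleys "V w" K0 using good_valleys[OF elim(1)] .
        show ?case
        proof (cases "w \<in> ?A")
          case True
          have "h (Suc k) powr - \<alpha> \<le> h k powr - \<alpha>"
            using Hplus_mono_Suc[of k] Hplus_pos[of k] \<alpha> by (intro powr_mono2') auto
          also have "\<dots> = r * h k powr - \<alpha> + (1 - r) * h k powr - \<alpha>" by (simp add: algebra_simps)
          finally have "?x (Suc k) w \<le> ennreal (r * h k powr - \<alpha> + (1 - r) * h k powr - \<alpha>)"
            by (rule ennreal_leI)
          then show ?thesis using True r by (simp add: ennreal_plus ennreal_mult')
        next
          case False
          then have "2 * h k \<le> h (Suc k)" using elim(2) by auto
          then have "h (Suc k) powr - \<alpha> \<le> (2 * h k) powr - \<alpha>"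
            using Hplus_pos[of k] \<alpha> by (intro powr_mono2') auto
          also have "\<dots> = r * h k powr - \<alpha>" using Hplus_pos[of k] by (simp add: powr_mult r_def)
          finally have "?x (Suc k) w \<le> ennreal (r * h k powr - \<alpha>)" by (rule ennreal_leI)
          also have "\<dots> = ennreal r * ?x k w" using r by (simp add: ennreal_mult')
          finally show ?thesis using False by simp
        qed
      qed
    qed
    also have "\<dots> = ennreal r * (\<integral>\<^sup>+w. ?x k w \<partial>S) + ennreal (1 - r) * (\<integral>\<^sup>+w. ?x k w * indicator ?A w \<partial>S)"
      by (subst nn_integral_add) (auto simp: nn_integral_cmult)
    also have "(\<integral>\<^sup>+w. ?x k w * indicator ?A w \<partial>S) \<le> (\<integral>\<^sup>+w. ?x k w * ennreal q0 \<partial>S)"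
    proof (rule prob_small_rise[where g = "\<lambda>h. h powr - \<alpha>" and s = "\<lambda>h. h" and p = "\<lambda>_. q0"])
      fix h assume h: "K0 \<le> h"
      have "(h + C) * (2 * K0 + C) \<le> (K0 + C) * (h + h + C)"
        using mult_left_mono[OF h, of C] C_pos by (simp add: algebra_simps)
      then have "(h + C) / (h + h + C) \<le> q0"
        unfolding q0_def using h K0_pos C_pos by (subst frac_le_eq) (auto simp: divide_le_0_iff algebra_simps)
      then show "0 \<le> h \<and> (h + C) / (h + h + C) \<le> q0" using h K0_pos by simp
    qed auto
    also have "(\<integral>\<^sup>+w. ?x k w * ennreal q0 \<partial>S) = ennreal q0 * (\<integral>\<^sup>+w. ?x k w \<partial>S)"
      by (subst nn_integral_multc) (auto simp: mult.commute)
    also have "ennreal r * (\<integral>\<^sup>+w. ?x k w \<partial>S) + ennreal (1 - r) * (ennreal q0 * (\<integral>\<^sup>+w. ?x k w \<partial>S)) =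
        ennreal q * (\<integral>\<^sup>+w. ?x k w \<partial>S)"
      using r q0 by (simp add: q_def ennreal_plus ennreal_mult' distrib_right mult.assoc)
    finally show ?thesis by (simp add: mult_left_mono add_left_mono)
  qed
  have "(\<integral>\<^sup>+w. ?x k w \<partial>S) \<le> ennreal (K0 powr - \<alpha> * q ^ k)" for k
  proof (induction k)
    case 0
    have "(\<integral>\<^sup>+w. ?x 0 w \<partial>S) \<le> (\<integral>\<^sup>+w. ennreal (K0 powr - \<alpha>) \<partial>S)"
    proof (rule nn_integral_mono_AE)
      show "AE w in S. ?x 0 w \<le> ennreal (K0 powr - \<alpha>)"
        using AE_good
      proof eventually_elim
        case (elim w)
        interpret valleys "V w" K0 using good_valleys[OF elim] .
        show ?case using Hplus_ge[of 0] K0_pos \<alpha> by (intro ennreal_leI powr_mono2') auto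
      qed
    qed
    then show ?case by (simp add: P.emeasure_space_1)
  next
    case (Suc k)
    have "(\<integral>\<^sup>+w. ?x (Suc k) w \<partial>S) \<le> ennreal q * ennreal (K0 powr - \<alpha> * q ^ k)"
      using step[of k] mult_left_mono[OF Suc, of "ennreal q"] by (rule order_trans) simp
    also have "\<dots> = ennreal (K0 powr - \<alpha> * q ^ Suc k)"
      using q by (simp add: ennreal_mult'[symmetric] ac_simps)
    finally show ?case .
  qed
  with q that show thesis by blast
qed

lemma AE_eventually_gaps:
  assumes \<alpha>: "0 < \<alpha>" "\<alpha> < 1"
  shows "AE w in S. \<forall>\<^sub>F k in sequentially.
    H k w powr (1 - \<alpha>) \<le> V w (bottom (V w) K0 k) - V w (bottom (V w) K0 (Suc k)) \<and>
    H k w + H k w powr (1 - \<alpha>) \<le> H (Suc k) w \<and> H (Suc k) w \<le> H k w powr (1 + \<alpha>)"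
proof -
  \<comment> \<open>The constant in front of \<open>h powr - \<alpha>\<close>: 1 comes from
    \<open>s h / h\<close>, the second summand absorbs \<open>C / h\<close> in the two gap events
    (here \<open>\<alpha> < 1\<close> enters), and the third absorbs the overshoot
    \<open>2 * C\<close> in the event of a large rise.\<close>
  define c where "c = 1 + C * K0 powr (\<alpha> - 1) + 2 * C / K0"
  define p where "p h = c * h powr - \<alpha>" for h :: real
  define s where "s h = h powr (1 - \<alpha>)" for h :: real
  have c: "0 \<le> c" using C_pos K0_pos by (simp add: c_def)
  have [measurable]: "p \<in> borel_measurable borel" "s \<in> borel_measurable borel"
    unfolding p_def s_def by measurable
  have s: "(s h + C) / h \<le> p h" if h: "K0 \<le> h" for h
  proof -
    have h0: "0 < h" using h K0_pos by simp
    have "s h / h = h powr - \<alpha>" using h0 by (simp add: s_def powr_diff powr_minus_divide)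
    moreover have "C / h = C * (h powr - \<alpha> * h powr (\<alpha> - 1))"
    proof -
      have "h powr - \<alpha> * h powr (\<alpha> - 1) = h powr (- 1)" by (subst powr_add[symmetric]) simp
      also have "\<dots> = 1 / h" using h0 by (subst powr_minus_divide) simp
      finally show ?thesis by simp
    qed
    moreover have "h powr (\<alpha> - 1) \<le> K0 powr (\<alpha> - 1)"
      by (rule powr_mono2') (use \<alpha> K0_pos h in auto)
    then have "C * (h powr - \<alpha> * h powr (\<alpha> - 1)) \<le> C * (h powr - \<alpha> * K0 powr (\<alpha> - 1))"
      using C_pos by (intro mult_left_mono) auto
    moreover have "0 \<le> 2 * C / K0 * h powr - \<alpha>" using C_pos K0_pos by simp
    ultimately show ?thesis by (simp add: add_divide_distrib p_def c_def algebra_simps)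
  qed
  obtain q where q: "0 < q" "q < 1"
    "\<And>k. (\<integral>\<^sup>+w. ennreal (H k w powr - \<alpha>) \<partial>S) \<le> ennreal (K0 powr - \<alpha> * q ^ k)"
    using H_decay[OF \<alpha>(1)] by blast
  define B where "B k = c * (K0 powr - \<alpha> * q ^ k)" for k :: nat
  have B: "summable B" unfolding B_def using q by (intro summable_mult summable_geometric) auto
  have B0: "0 \<le> B k" for k using c q by (simp add: B_def)
  have pB: "(\<integral>\<^sup>+w. ennreal (p (H k w)) \<partial>S) \<le> ennreal (B k)" for k
  proof -
    have "(\<integral>\<^sup>+w. ennreal (p (H k w)) \<partial>S) = ennreal c * (\<integral>\<^sup>+w. ennreal (H k w powr - \<alpha>) \<partial>S)"
      using c by (subst nn_integral_cmult[symmetric]) (auto simp: p_def ennreal_mult')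
    also have "\<dots> \<le> ennreal c * ennreal (K0 powr - \<alpha> * q ^ k)" by (intro mult_left_mono q) auto
    also have "\<dots> = ennreal (B k)" using c by (simp add: B_def ennreal_mult')
    finally show ?thesis .
  qed
  let ?A1 = "\<lambda>k. {w \<in> space S. V w (bottom (V w) K0 k) - V w (bottom (V w) K0 (Suc k)) < s (H k w)}"
  let ?A2 = "\<lambda>k. {w \<in> space S. H (Suc k) w < H k w + s (H k w)}"
  let ?A3 = "\<lambda>k. {w \<in> space S. H k w powr (1 + \<alpha>) < H (Suc k) w}"
  have "AE w in S. \<forall>\<^sub>F k in sequentially. w \<notin> ?A1 k"
  proof (rule P.AE_eventually_not[OF _ _ B B0])
    show "emeasure S (?A1 k) \<le> ennreal (B k)" for k
    proof (rule order_trans[OF prob_small_descent[where p = p] pB])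
      fix h assume h: "K0 \<le> h"
      have "(s h + C) / (h + C) \<le> (s h + C) / h"
        using h K0_pos C_pos by (intro divide_left_mono) (auto simp: s_def)
      then show "0 \<le> s h \<and> (s h + C) / (h + C) \<le> p h" using s[OF h] by (simp add: s_def)
    qed measurable
  qed measurable
  moreover have "AE w in S. \<forall>\<^sub>F k in sequentially. w \<notin> ?A2 k"
  proof (rule P.AE_eventually_not[OF _ _ B B0])
    show "emeasure S (?A2 k) \<le> ennreal (B k)" for k
    proof -
      have "(\<integral>\<^sup>+w. ennreal 1 * indicator (?A2 k) w \<partial>S) \<le> (\<integral>\<^sup>+w. ennreal 1 * ennreal (p (H k w)) \<partial>S)"
      proof (rule prob_small_rise[where g = "\<lambda>_. 1"])
        fix h assume h: "K0 \<le> h"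
        have "(s h + C) / (h + s h + C) \<le> (s h + C) / h"
          using h K0_pos C_pos by (intro divide_left_mono) (auto simp: s_def add_pos_nonneg)
        then show "0 \<le> s h \<and> (s h + C) / (h + s h + C) \<le> p h" using s[OF h] by (simp add: s_def)
      qed measurable
      then have "emeasure S (?A2 k) \<le> (\<integral>\<^sup>+w. ennreal (p (H k w)) \<partial>S)" by simp
      then show ?thesis using pB[of k] by (rule order_trans)
    qed
  qed measurable
  moreover have "AE w in S. \<forall>\<^sub>F k in sequentially. w \<notin> ?A3 k"
  proof (rule P.AE_eventually_not[OF _ _ B B0])
    show "emeasure S (?A3 k) \<le> ennreal (B k)" for k
    proof (rule order_trans[OF prob_large_rise[where p = p and c = "\<lambda>h. h powr (1 + \<alpha>)"] pB])
      fix h assume h: "K0 \<le> h"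
      then have h0: "0 < h" using K0_pos by simp
      have "(h + C + C) / (h powr (1 + \<alpha>) + C) \<le> (h + C + C) / h powr (1 + \<alpha>)"
        using h0 C_pos by (intro divide_left_mono) (auto intro!: mult_pos_pos add_pos_pos)
      also have "\<dots> = h powr - \<alpha> * (1 + 2 * C / h)"
        using h0 by (simp add: powr_add powr_minus_divide field_simps)
      also have "\<dots> \<le> h powr - \<alpha> * c"
      proof (rule mult_left_mono)
        have "2 * C / h \<le> 2 * C / K0" using h K0_pos C_pos by (intro divide_left_mono) auto
        moreover have "0 \<le> C * K0 powr (\<alpha> - 1)" using C_pos by simp
        ultimately show "1 + 2 * C / h \<le> c" unfolding c_def by linarith
      qed simp
      finally show "0 < h powr (1 + \<alpha>) \<and> (h + C + C) / (h powr (1 + \<alpha>) + C) \<le> p h"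
        using h0 by (simp add: p_def mult.commute)
    qed measurable
  qed measurable
  ultimately show ?thesis
    using AE_space
  proof eventually_elim
    case (elim w)
    from elim(1-3) show ?case
      by eventually_elim (use elim(4) in \<open>auto simp: s_def not_less\<close>)
  qed
qed

lemma AE_drawup_V_reached:
  "AE w in S. \<forall>\<^sub>F l in sequentially. \<exists>i\<le>l ^ 4. real l \<le> drawup (V w) i"
  unfolding V_def by (rule AE_shift[OF AE_drawup_reached[OF v_pos]])

end

section \<open>Hitting times and occupation times of the quenched walk\<close>

lemma potential_0 [simp]: "potential w 0 = 0" by (simp add: potential_def)

lemma potential_Suc: "potential w (Suc x) = potential w x + ln (rho w (Suc x))"
  by (simp add: potential_def)

definition visits :: "nat \<Rightarrow> nat \<Rightarrow> (nat \<Rightarrow> nat) \<Rightarrow> real" where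
  "visits l n X = (\<Sum>i<n. if X i < l then 1 else 0)"

locale quenched_walk = Q: prob_space Q for Q :: "(nat \<Rightarrow> nat) measure" +
  fixes w :: "nat \<Rightarrow> real" and \<delta> :: real
  assumes chain: "quenched_chain w Q" and \<delta>: "0 < \<delta>"
    and elliptic: "\<And>x. \<delta> \<le> w x" "\<And>x. w x \<le> 1 - \<delta>"
begin

lemma sets_Q [measurable_cong]: "sets Q = sets path_space"
  using chain by (simp add: quenched_chain_def)

lemma space_Q [simp]: "space Q = UNIV"
  using sets_eq_imp_space_eq[OF sets_Q] by (simp add: path_space_def space_PiM PiE_UNIV_domain)

lemma component_measurable [measurable]: "(\<lambda>X. X n) \<in> Q \<rightarrow>\<^sub>M count_space UNIV"
  unfolding measurable_cong_sets[OF sets_Q refl] path_space_def by measurable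

text \<open>The past as a list: its values lie in a countable type, so integrals over the past split
  into countably many cylinders.\<close>

definition prefix :: "nat \<Rightarrow> (nat \<Rightarrow> nat) \<Rightarrow> nat list" where
  "prefix n X = map X [0..<Suc n]"

lemma prefix_eq_iff: "prefix n X = prefix n h \<longleftrightarrow> (\<forall>i\<le>n. X i = h i)"
  by (auto simp: prefix_def map_eq_conv)

lemma prefix_eq_sets [measurable]: "{X. prefix n X = l} \<in> sets Q"
proof (cases "\<exists>h. l = prefix n h")
  case True
  then obtain h where l: "l = prefix n h" by auto
  have "{X \<in> space Q. \<forall>i\<le>n. X i = h i} \<in> sets Q" by measurable
  then show ?thesis by (simp add: l prefix_eq_iff)
next
  case False
  then have "{X. prefix n X = l} = {}" by auto
  then show ?thesis by (simp only: sets.empty_sets)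
qed

lemma prefix_measurable [measurable]: "prefix n \<in> Q \<rightarrow>\<^sub>M count_space UNIV"
  by (subst measurable_count_space_eq2_countable) (auto simp: vimage_def)

lemma measure_cylinder_Suc:
  "measure Q {X. prefix n X = prefix n h \<and> X (Suc n) = y} =
    measure Q {X. prefix n X = prefix n h} * step_prob w (h n) y"
proof (cases "measure Q {X. prefix n X = prefix n h} = 0")
  \<comment> \<open>On null cylinders \<open>quenched_chain\<close> prescribes no conditional
    probability, but both sides are 0.\<close>
  case True
  have "measure Q {X. prefix n X = prefix n h \<and> X (Suc n) = y} \<le> measure Q {X. prefix n X = prefix n h}"
    by (rule Q.finite_measure_mono) auto
  then show ?thesis using True by (simp add: measure_le_0_iff)
next
  case False
  then have "\<P>(X in Q. X (Suc n) = y \<bar> \<forall>i\<le>n. X i = h i) = step_prob w (h n) y"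
    using chain unfolding quenched_chain_def by (simp add: prefix_eq_iff)
  then show ?thesis using False by (simp add: cond_prob_def prefix_eq_iff conj_commute field_simps)
qed

definition transition :: "(nat \<Rightarrow> ennreal) \<Rightarrow> nat \<Rightarrow> ennreal" where
  "transition u x = (if x = 0 then u 1 else ennreal (w x) * u (Suc x) + ennreal (1 - w x) * u (x - 1))"

lemma elliptic': "0 < w x" "w x < 1"
  using elliptic[of x] \<delta> by linarith+

lemma nn_integral_cylinder:
  "(\<integral>\<^sup>+X. u (X (Suc n)) * indicator {X. prefix n X = prefix n h} X \<partial>Q) =
    transition u (h n) * emeasure Q {X. prefix n X = prefix n h}"
proof -
  let ?B = "{X. prefix n X = prefix n h}" and ?x = "h n"
  have em: "emeasure Q {X. prefix n X = prefix n h \<and> X (Suc n) = y} = ennreal (step_prob w ?x y) * emeasure Q ?B" for y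
    unfolding Q.emeasure_eq_measure measure_cylinder_Suc
    using elliptic'[of ?x] by (subst mult.commute, subst ennreal_mult') (auto simp: step_prob_def)
  have sets: "{X. prefix n X = prefix n h \<and> X (Suc n) = y} \<in> sets Q" for y
  proof -
    have "{X \<in> space Q. X (Suc n) = y} \<inter> ?B \<in> sets Q" by measurable
    then show ?thesis by (simp add: Int_def conj_commute)
  qed
  \<comment> \<open>Successors of transition probability 0 are almost surely not taken after this
    prefix, so only the neighbours of \<open>h n\<close> contribute to the integral.\<close>
  have "AE X in Q. \<not> (prefix n X = prefix n h \<and> X (Suc n) = y)" if "step_prob w ?x y = 0" for y
    using em[of y] that sets[of y] by (intro AE_I'[of "{X. prefix n X = prefix n h \<and> X (Suc n) = y}"]) (auto simp: null_sets_def)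
  then have "AE X in Q. \<forall>y\<in>{y. step_prob w ?x y = 0}. \<not> (prefix n X = prefix n h \<and> X (Suc n) = y)"
    by (subst AE_ball_countable) auto
  then have step: "AE X in Q. prefix n X = prefix n h \<longrightarrow> step_prob w ?x (X (Suc n)) \<noteq> 0"
    by (rule AE_mp) auto
  show ?thesis
  proof (cases "?x = 0")
    case True
    have "(\<integral>\<^sup>+X. u (X (Suc n)) * indicator ?B X \<partial>Q) = (\<integral>\<^sup>+X. u 1 * indicator ?B X \<partial>Q)"
    proof (rule nn_integral_cong_AE)
      show "AE X in Q. u (X (Suc n)) * indicator ?B X = u 1 * indicator ?B X"
        using step by eventually_elim (auto simp: True step_prob_def indicator_def split: if_splits)
    qed
    also have "\<dots> = u 1 * emeasure Q ?B" by (rule nn_integral_cmult_indicator) measurable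
    finally show ?thesis by (simp add: transition_def True)
  next
    case False
    let ?U = "{X. prefix n X = prefix n h \<and> X (Suc n) = Suc ?x}"
    let ?D = "{X. prefix n X = prefix n h \<and> X (Suc n) = ?x - 1}"
    have "(\<integral>\<^sup>+X. u (X (Suc n)) * indicator ?B X \<partial>Q) =
        (\<integral>\<^sup>+X. u (Suc ?x) * indicator ?U X + u (?x - 1) * indicator ?D X \<partial>Q)"
    proof (rule nn_integral_cong_AE)
      show "AE X in Q. u (X (Suc n)) * indicator ?B X = u (Suc ?x) * indicator ?U X + u (?x - 1) * indicator ?D X"
        using step
      proof eventually_elim
        case (elim X)
        have "X (Suc n) = Suc ?x \<or> X (Suc n) = ?x - 1" if "prefix n X = prefix n h"
          using elim that False by (auto simp: step_prob_def split: if_splits)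
        then show ?case using False by (auto simp: indicator_def)
      qed
    qed
    also have "\<dots> = u (Suc ?x) * emeasure Q ?U + u (?x - 1) * emeasure Q ?D"
      using sets by (simp add: nn_integral_add nn_integral_cmult_indicator)
    also have "\<dots> = transition u ?x * emeasure Q ?B"
    proof -
      have sp: "step_prob w ?x (Suc ?x) = w ?x" "step_prob w ?x (?x - 1) = 1 - w ?x"
        using False by (auto simp: step_prob_def)
      show ?thesis using False unfolding em sp by (simp add: transition_def ring_distribs ac_simps)
    qed
    finally show ?thesis .
  qed
qed

text \<open>The Markov property with an arbitrary weight \<open>F\<close> of the past, obtained by
  summing \<open>nn_integral_cylinder\<close> over the countably many prefixes.\<close>

lemma nn_integral_transition:
  "(\<integral>\<^sup>+X. F (prefix n X) * u (X (Suc n)) \<partial>Q) = (\<integral>\<^sup>+X. F (prefix n X) * transition u (X n) \<partial>Q)"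
proof -
  have split: "(\<integral>\<^sup>+X. G X \<partial>Q) = (\<Sum>i. \<integral>\<^sup>+X. G X * indicator {X. prefix n X = from_nat i \<and> to_nat (prefix n X) = i} X \<partial>Q)"
    if [measurable]: "G \<in> borel_measurable Q" for G :: "_ \<Rightarrow> ennreal"
  proof -
    have ind: "indicator {X. prefix n X = from_nat i \<and> to_nat (prefix n X) = i} X = (indicator {i} (to_nat (prefix n X)) :: ennreal)" for X i
      by (auto simp: indicator_def)
    have meas: "(\<lambda>X. indicator {i} (to_nat (prefix n X)) :: ennreal) \<in> borel_measurable Q" for i :: nat
      by (rule measurable_compose[OF prefix_measurable]) simp
    have "G X = (\<Sum>i. G X * indicator {i} (to_nat (prefix n X)))" for X
      using suminf_cmult_indicator[of "\<lambda>t. {t}" "to_nat (prefix n X)" "to_nat (prefix n X)" "\<lambda>_. G X"]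
      by (auto simp: disjoint_family_on_def)
    then have "(\<integral>\<^sup>+X. G X \<partial>Q) = (\<integral>\<^sup>+X. (\<Sum>i. G X * indicator {i} (to_nat (prefix n X))) \<partial>Q)" by simp
    also have "\<dots> = (\<Sum>i. \<integral>\<^sup>+X. G X * indicator {i} (to_nat (prefix n X)) \<partial>Q)"
      by (rule nn_integral_suminf) (use meas in measurable)
    finally show ?thesis unfolding ind .
  qed
  have meas: "(\<lambda>X. F (prefix n X)) \<in> borel_measurable Q" "(\<lambda>X. v (X m)) \<in> borel_measurable Q"
    for v :: "nat \<Rightarrow> ennreal" and m
    by (rule measurable_compose[OF prefix_measurable], simp, rule measurable_compose[OF component_measurable], simp)
  note [measurable] = meas
  have eq: "(\<integral>\<^sup>+X. F (prefix n X) * u (X (Suc n)) * indicator {X. prefix n X = from_nat i \<and> to_nat (prefix n X) = i} X \<partial>Q) =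
    (\<integral>\<^sup>+X. F (prefix n X) * transition u (X n) * indicator {X. prefix n X = from_nat i \<and> to_nat (prefix n X) = i} X \<partial>Q)" for i
  proof (cases "\<exists>h. prefix n h = from_nat i \<and> to_nat (prefix n h) = i")
    case False
    then have "{X. prefix n X = from_nat i \<and> to_nat (prefix n X) = i} = {}" by auto
    then show ?thesis by (simp only:) simp
  next
    case True
    then obtain h where h: "prefix n h = from_nat i" "to_nat (prefix n h) = i" by auto
    have B: "{X. prefix n X = from_nat i \<and> to_nat (prefix n X) = i} = {X. prefix n X = prefix n h}"
      using h by auto
    let ?B = "{X. prefix n X = prefix n h}"
    have "(\<integral>\<^sup>+X. F (prefix n X) * u (X (Suc n)) * indicator ?B X \<partial>Q) =
        (\<integral>\<^sup>+X. F (prefix n h) * (u (X (Suc n)) * indicator ?B X) \<partial>Q)"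
      by (intro nn_integral_cong) (auto simp: indicator_def)
    also have "\<dots> = F (prefix n h) * (\<integral>\<^sup>+X. u (X (Suc n)) * indicator ?B X \<partial>Q)"
      by (rule nn_integral_cmult) measurable
    also have "\<dots> = (\<integral>\<^sup>+X. F (prefix n h) * transition u (h n) * indicator ?B X \<partial>Q)"
      unfolding nn_integral_cylinder by (subst nn_integral_cmult_indicator) (auto simp: mult.assoc)
    also have "\<dots> = (\<integral>\<^sup>+X. F (prefix n X) * transition u (X n) * indicator ?B X \<partial>Q)"
    proof (intro nn_integral_cong)
      fix X
      show "F (prefix n h) * transition u (h n) * indicator ?B X = F (prefix n X) * transition u (X n) * indicator ?B X"
        using prefix_eq_iff[of n X h] by (cases "X \<in> ?B") auto
    qed
    finally show ?thesis unfolding B .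
  qed
  show ?thesis by (subst (1 2) split) (simp_all add: eq)
qed

section \<open>Exit over a level and occupation before it\<close>

definition below :: "nat \<Rightarrow> nat \<Rightarrow> (nat \<Rightarrow> nat) set" where
  "below y n = {X. \<forall>i\<le>n. X i < y}"

lemma below_sets [measurable]: "below y n \<in> sets Q"
proof -
  have "{X \<in> space Q. \<forall>i\<le>n. X i < y} \<in> sets Q" by measurable
  then show ?thesis by (simp add: below_def)
qed

lemma function_measurable [measurable]: "(\<lambda>X. u (X n)) \<in> borel_measurable Q" for u :: "nat \<Rightarrow> ennreal"
  by (rule measurable_compose[OF component_measurable]) simp

lemma AE_start: "AE X in Q. X 0 = 0"
proof -
  have "{X \<in> space Q. X 0 = 0} \<in> sets Q" by measurable
  then show ?thesis using chain Q.prob_eq_1[of "{X \<in> space Q. X 0 = 0}"] by (auto simp: quenched_chain_def)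
qed

text \<open>\<open>u\<close> is stopped on leaving \<open>[0, y)\<close>, where it is at least
  \<open>\<kappa>\<close>; each earlier step loses \<open>f\<close> on average and gains at most
  \<open>p\<close>. \<open>prob_not_below\<close> takes \<open>\<kappa> = 1\<close> and
  \<open>f = 0\<close> and pays \<open>p\<close> per step, while \<open>expected_visits\<close>
  takes \<open>\<kappa> = 0\<close> and \<open>p = 0\<close> and reads off the sum of
  \<open>f\<close>.\<close>

lemma supermartingale_bound:
  fixes u f :: "nat \<Rightarrow> ennreal" and \<kappa> p :: ennreal
  assumes y: "0 < y" and \<kappa>: "\<And>z. y \<le> z \<Longrightarrow> \<kappa> \<le> u z"
    and super: "\<And>z. z < y \<Longrightarrow> transition u z + f z \<le> u z + p"
  shows "(\<integral>\<^sup>+X. u (X n) * indicator (below y n) X \<partial>Q) + \<kappa> * emeasure Q (- below y n) +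
    (\<Sum>i<n. \<integral>\<^sup>+X. f (X i) * indicator (below y i) X \<partial>Q) \<le> u 0 + of_nat n * p"
proof (induction n)
  case 0
  have AE: "AE X in Q. X \<in> below y 0" using AE_start by eventually_elim (use y in \<open>auto simp: below_def\<close>)
  have "emeasure Q (- below y 0) = 0"
  proof (rule AE_iff_measurable[THEN iffD1])
    show "- below y 0 \<in> sets Q" using sets.compl_sets[OF below_sets] by (simp add: Compl_eq_Diff_UNIV)
    show "AE X in Q. X \<in> below y 0" by (rule AE)
  qed auto
  moreover have "(\<integral>\<^sup>+X. u (X 0) * indicator (below y 0) X \<partial>Q) \<le> (\<integral>\<^sup>+X. u 0 \<partial>Q)"
    by (rule nn_integral_mono_AE) (use AE_start in \<open>auto elim!: eventually_mono simp: indicator_def\<close>)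
  ultimately show ?case by (simp add: Q.emeasure_space_1[simplified])
next
  case (Suc n)
  let ?I = "\<lambda>n X. indicator (below y n) X :: ennreal"
  have compl [measurable]: "- below y i \<in> sets Q" for i
    using sets.compl_sets[OF below_sets] by (simp add: Compl_eq_Diff_UNIV)
  have "(\<integral>\<^sup>+X. u (X (Suc n)) * ?I (Suc n) X \<partial>Q) + \<kappa> * emeasure Q (- below y (Suc n)) =
      (\<integral>\<^sup>+X. u (X (Suc n)) * ?I (Suc n) X + \<kappa> * indicator (- below y (Suc n)) X \<partial>Q)"
    by (subst nn_integral_add) (auto simp: nn_integral_cmult_indicator)
  also have "\<dots> \<le> (\<integral>\<^sup>+X. u (X (Suc n)) * ?I n X + \<kappa> * indicator (- below y n) X \<partial>Q)"
    by (rule nn_integral_mono) (auto simp: indicator_def below_def le_Suc_eq intro!: \<kappa>)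
  also have "\<dots> = (\<integral>\<^sup>+X. u (X (Suc n)) * ?I n X \<partial>Q) + \<kappa> * emeasure Q (- below y n)"
    by (subst nn_integral_add) (auto simp: nn_integral_cmult_indicator)
  also have "(\<integral>\<^sup>+X. u (X (Suc n)) * ?I n X \<partial>Q) = (\<integral>\<^sup>+X. transition u (X n) * ?I n X \<partial>Q)"
  proof -
    have I: "?I n X = (if \<forall>z\<in>set (prefix n X). z < y then 1 else 0)" for X
    proof -
      have "set (prefix n X) = X ` {..n}" by (auto simp: prefix_def simp del: upt_Suc)
      then show ?thesis by (auto simp: below_def indicator_def)
    qed
    show ?thesis
      using nn_integral_transition[of "\<lambda>l. if \<forall>z\<in>set l. z < y then 1 else 0" n u]
      unfolding I[symmetric] by (simp only: mult.commute)
  qed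
  finally have step: "(\<integral>\<^sup>+X. u (X (Suc n)) * ?I (Suc n) X \<partial>Q) + \<kappa> * emeasure Q (- below y (Suc n)) \<le>
    (\<integral>\<^sup>+X. transition u (X n) * ?I n X \<partial>Q) + \<kappa> * emeasure Q (- below y n)" .
  have "(\<integral>\<^sup>+X. transition u (X n) * ?I n X \<partial>Q) + (\<integral>\<^sup>+X. f (X n) * ?I n X \<partial>Q) =
      (\<integral>\<^sup>+X. (transition u (X n) + f (X n)) * ?I n X \<partial>Q)"
    by (subst nn_integral_add[symmetric]) (auto simp: distrib_right)
  also have "\<dots> \<le> (\<integral>\<^sup>+X. u (X n) * ?I n X + p \<partial>Q)"
  proof (rule nn_integral_mono)
    fix X
    show "(transition u (X n) + f (X n)) * ?I n X \<le> u (X n) * ?I n X + p"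
      using super[of "X n"] by (auto simp: indicator_def below_def)
  qed
  also have "\<dots> = (\<integral>\<^sup>+X. u (X n) * ?I n X \<partial>Q) + p"
    using Q.emeasure_space_1 by (subst nn_integral_add) auto
  finally have drift: "(\<integral>\<^sup>+X. transition u (X n) * ?I n X \<partial>Q) + (\<integral>\<^sup>+X. f (X n) * ?I n X \<partial>Q) \<le>
    (\<integral>\<^sup>+X. u (X n) * ?I n X \<partial>Q) + p" .
  have "(\<integral>\<^sup>+X. u (X (Suc n)) * ?I (Suc n) X \<partial>Q) + \<kappa> * emeasure Q (- below y (Suc n)) +
      (\<Sum>i<Suc n. \<integral>\<^sup>+X. f (X i) * ?I i X \<partial>Q) \<le>
      ((\<integral>\<^sup>+X. transition u (X n) * ?I n X \<partial>Q) + (\<integral>\<^sup>+X. f (X n) * ?I n X \<partial>Q)) +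
      (\<kappa> * emeasure Q (- below y n) + (\<Sum>i<n. \<integral>\<^sup>+X. f (X i) * ?I i X \<partial>Q))"
    using add_right_mono[OF step, of "\<Sum>i<Suc n. \<integral>\<^sup>+X. f (X i) * ?I i X \<partial>Q"]
    by (simp only: sum.lessThan_Suc add_ac)
  also have "\<dots> \<le> ((\<integral>\<^sup>+X. u (X n) * ?I n X \<partial>Q) + p) +
      (\<kappa> * emeasure Q (- below y n) + (\<Sum>i<n. \<integral>\<^sup>+X. f (X i) * ?I i X \<partial>Q))"
    by (rule add_right_mono[OF drift])
  also have "\<dots> \<le> (u 0 + of_nat n * p) + p"
    using add_right_mono[OF Suc.IH, of p] by (simp add: add_ac)
  also have "\<dots> = u 0 + of_nat (Suc n) * p" by (simp add: distrib_right add_ac)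
  finally show ?case .
qed

abbreviation "V \<equiv> potential w"

text \<open>Says that a function with increments \<open>exp (V x)\<close> from \<open>x\<close> to
  \<open>x + 1\<close> is harmonic for the chain at \<open>x\<close>.\<close>

lemma exp_potential: "0 < x \<Longrightarrow> w x * exp (V x) = (1 - w x) * exp (V (x - 1))"
proof (cases x)
  case (Suc n)
  then show ?thesis using elliptic'[of x] by (simp add: potential_Suc exp_add rho_def)
qed simp

text \<open>Every step made at \<open>b\<close> starts a new attempt to reach \<open>y\<close>,
  which succeeds with probability at most \<open>exp (V b - V (y - 1))\<close>; at most
  \<open>n\<close> attempts fit into \<open>n\<close> steps. The index \<open>y - 1\<close> is that
  of the last summand of \<open>U y\<close>.\<close>

lemma prob_not_below:
  assumes "b < y"
  shows "emeasure Q (- below y n) \<le> ennreal (real n * exp (V b - V (y - 1)))"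
proof -
  \<comment> \<open>\<open>U / U y\<close> is the probability of reaching \<open>y\<close> before \<open>b\<close>.\<close>
  define U where "U z = (\<Sum>i\<in>{b..<z}. exp (V i))" for z
  have mono: "U i \<le> U j" if "i \<le> j" for i j
    unfolding U_def using that by (intro sum_mono2) auto
  have U0: "0 \<le> U z" for z unfolding U_def by (intro sum_nonneg) auto
  have Z: "exp (V (y - 1)) \<le> U y"
    unfolding U_def using assms by (intro member_le_sum) auto
  then have Z0: "0 < U y" using exp_gt_zero less_le_trans by blast
  \<comment> \<open>\<open>U\<close> vanishes up to \<open>b\<close> and is harmonic above it. Only
    at \<open>b\<close> itself does one step gain something, at most the first summand
    \<open>exp (V b)\<close>.\<close>
  have drift: "(if z = 0 then U 1 else w z * U (Suc z) + (1 - w z) * U (z - 1)) \<le> U z + exp (V b)" for z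
  proof -
    consider "z < b" | "z = b" "z = 0" | "z = b" "0 < z" | "b < z" by linarith
    then show ?thesis
    proof cases
      case 1 then show ?thesis by (auto simp: U_def)
    next
      case 2 then show ?thesis by (simp add: U_def)
    next
      case 3 then show ?thesis using elliptic'[of z] by (simp add: U_def mult_left_le_one_le)
    next
      case 4
      then have 1: "U (Suc z) = U z + exp (V z)" by (simp add: U_def)
      obtain n where n: "z = Suc n" using 4 by (cases z) auto
      then have 2: "U z = U (z - 1) + exp (V (z - 1))" using 4 by (simp add: U_def)
      have "w z * U (Suc z) + (1 - w z) * U (z - 1) = U z + (w z * exp (V z) - (1 - w z) * exp (V (z - 1)))"
        unfolding 1 using 2 by (simp add: algebra_simps)
      also have "\<dots> = U z" using exp_potential[of z] 4 by simp
      finally show ?thesis using 4 by simp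
    qed
  qed
  have "(\<integral>\<^sup>+X. ennreal (U (X n) / U y) * indicator (below y n) X \<partial>Q) + 1 * emeasure Q (- below y n) +
    (\<Sum>i<n. \<integral>\<^sup>+X. 0 * indicator (below y i) X \<partial>Q) \<le> ennreal (U 0 / U y) + of_nat n * ennreal (exp (V b) / U y)"
  proof (rule supermartingale_bound[where u = "\<lambda>z. ennreal (U z / U y)" and f = "\<lambda>_. 0"])
    show "1 \<le> ennreal (U z / U y)" if "y \<le> z" for z
      using mono[OF that] Z0 by simp
    fix z
    have "transition (\<lambda>z. ennreal (U z / U y)) z =
        ennreal ((if z = 0 then U 1 else w z * U (Suc z) + (1 - w z) * U (z - 1)) / U y)"
      using U0 Z0 elliptic'[of z]
      by (simp add: transition_def ennreal_mult'[symmetric] ennreal_plus[symmetric] add_divide_distrib del: ennreal_plus)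
    also have "\<dots> \<le> ennreal ((U z + exp (V b)) / U y)"
      using drift[of z] Z0 by (intro ennreal_leI divide_right_mono) auto
    also have "\<dots> = ennreal (U z / U y) + ennreal (exp (V b) / U y)"
      using U0 Z0 by (simp add: add_divide_distrib ennreal_plus)
    finally show "transition (\<lambda>z. ennreal (U z / U y)) z + 0 \<le> ennreal (U z / U y) + ennreal (exp (V b) / U y)" by simp
  qed (use assms in auto)
  moreover have "U 0 = 0" by (simp add: U_def)
  ultimately have "(\<integral>\<^sup>+X. ennreal (U (X n) / U y) * indicator (below y n) X \<partial>Q) + emeasure Q (- below y n)
    \<le> of_nat n * ennreal (exp (V b) / U y)"
    by simp
  then have "emeasure Q (- below y n) \<le> of_nat n * ennreal (exp (V b) / U y)"
    by (rule order_trans[rotated]) (rule add_increasing, auto)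
  also have "\<dots> = ennreal (real n * (exp (V b) / U y))"
    by (subst ennreal_mult') (auto simp: ennreal_of_nat_eq_real_of_nat)
  also have "\<dots> \<le> ennreal (real n * (exp (V b) / exp (V (y - 1))))"
    using Z Z0 by (intro ennreal_leI mult_left_mono divide_left_mono) auto
  finally show ?thesis by (simp add: exp_diff)
qed

lemma expected_visits:
  assumes "x < y"
  shows "(\<Sum>i<n. \<integral>\<^sup>+X. indicator {x} (X i) * indicator (below y i) X \<partial>Q) \<le>
    ennreal ((\<Sum>i\<in>{x..<y}. exp (V i - V x)) / \<delta>)"
proof -
  \<comment> \<open>The Green function at \<open>x\<close> of the walk killed at \<open>y\<close>, with the factor \<open>1 / w x\<close> replaced by its
    upper bound \<open>1 / \<delta>\<close>.\<close>
  define U where "U z = (\<Sum>i\<in>{max z x..<y}. exp (V i - V x)) / \<delta>" for z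
  have U0: "0 \<le> U z" for z unfolding U_def using \<delta> by (intro divide_nonneg_pos sum_nonneg) auto
  have U_Suc: "U z = exp (V z - V x) / \<delta> + U (Suc z)" if "x \<le> z" "z < y" for z
    using that by (simp add: U_def sum.atLeast_Suc_lessThan add_divide_distrib max_def)
  have U_left: "U z = U x" if "z \<le> x" for z using that by (simp add: U_def max_def)
  \<comment> \<open>\<open>U\<close> is constant to the left of \<open>x\<close> and harmonic to the
    right. At \<open>x\<close> a step to the right drops it by \<open>1 / \<delta>\<close> and has
    probability at least \<open>\<delta>\<close>, so the mean drop of at least 1 pays for the
    visit.\<close>
  have drift: "(if z = 0 then U 1 else w z * U (Suc z) + (1 - w z) * U (z - 1)) + indicator {x} z \<le> U z"
    if z: "z < y" for z
  proof -
    consider "z < x" | "z = x" "z = 0" | "z = x" "0 < z" | "x < z" by linarith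
    then show ?thesis
    proof cases
      case 1
      then have "U z = U x" "U (Suc z) = U x" "U (z - 1) = U x"
        using U_left[of z] U_left[of "Suc z"] U_left[of "z - 1"] by simp_all
      then show ?thesis using 1 U_left[of 1] by (auto simp: algebra_simps)
    next
      case 2
      have "1 \<le> 1 / \<delta>" using elliptic[of 0] \<delta> by simp
      then show ?thesis using U_Suc[of x] 2 z by simp
    next
      case 3
      have "1 \<le> w x / \<delta>" using elliptic[of x] \<delta> by simp
      moreover have Us: "U (Suc x) = U x - 1 / \<delta>" using U_Suc[of x] 3 z by simp
      have Ul: "U (x - 1) = U x" by (rule U_left) simp
      have "w x * U (Suc x) + (1 - w x) * U (x - 1) = U x - w x / \<delta>"
        unfolding Us Ul by (simp add: algebra_simps)
      ultimately show ?thesis using 3 by simp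
    next
      case 4
      have e: "exp (V j - V x) / \<delta> = exp (V j) * (exp (- V x) / \<delta>)" for j
        by (simp add: exp_diff exp_minus field_simps)
      have 1: "U (Suc z) = U z - exp (V z) * (exp (- V x) / \<delta>)"
        using U_Suc[of z] 4 z by (simp add: e)
      have 2: "U (z - 1) = U z + exp (V (z - 1)) * (exp (- V x) / \<delta>)"
        using U_Suc[of "z - 1"] 4 z by (simp add: e)
      have "w z * U (Suc z) + (1 - w z) * U (z - 1) =
          U z - (w z * exp (V z) - (1 - w z) * exp (V (z - 1))) * (exp (- V x) / \<delta>)"
        unfolding 1 2 by (simp only: algebra_simps)
      also have "\<dots> = U z" using exp_potential[of z] 4 by simp
      finally show ?thesis using 4 by simp
    qed
  qed
  have "(\<integral>\<^sup>+X. ennreal (U (X n)) * indicator (below y n) X \<partial>Q) + 0 * emeasure Q (- below y n) +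
    (\<Sum>i<n. \<integral>\<^sup>+X. indicator {x} (X i) * indicator (below y i) X \<partial>Q) \<le> ennreal (U 0) + of_nat n * 0"
  proof (rule supermartingale_bound[where u = "\<lambda>z. ennreal (U z)" and f = "indicator {x}"])
    fix z assume z: "z < y"
    have "transition (\<lambda>z. ennreal (U z)) z + indicator {x} z =
        ennreal ((if z = 0 then U 1 else w z * U (Suc z) + (1 - w z) * U (z - 1)) + indicator {x} z)"
      using U0 elliptic'[of z]
      by (auto simp: transition_def ennreal_mult'[symmetric] ennreal_plus[symmetric] indicator_def
        ennreal_1[symmetric] simp del: ennreal_plus ennreal_1)
    also have "\<dots> \<le> ennreal (U z)" by (rule ennreal_leI[OF drift[OF z]])
    finally show "transition (\<lambda>z. ennreal (U z)) z + indicator {x} z \<le> ennreal (U z) + 0" by simp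
  qed (use assms in auto)
  then have "(\<Sum>i<n. \<integral>\<^sup>+X. indicator {x} (X i) * indicator (below y i) X \<partial>Q) \<le> ennreal (U 0)"
    by (simp only: mult_zero_left mult_zero_right add_0_right) (erule order_trans[rotated], rule add_increasing, auto)
  then show ?thesis by (simp add: U_def)
qed

lemma visits_measurable [measurable]: "visits l n \<in> borel_measurable Q"
proof -
  have "(\<lambda>X. if X i < l then 1 else 0 :: real) \<in> borel_measurable Q" for i
    by (rule measurable_compose[OF component_measurable]) simp
  then show ?thesis unfolding visits_def by measurable
qed

text \<open>Markov's inequality for the expected number of visits. One factor \<open>y\<close>
  counts the sites \<open>x\<close>, the other the summands of each Green function, all at most
  \<open>exp G\<close>.\<close>

lemma prob_many_visits:
  assumes L: "0 < L" and climb: "\<And>x i. x < l \<Longrightarrow> x \<le> i \<Longrightarrow> i < y \<Longrightarrow> V i - V x \<le> G"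
  shows "emeasure Q (below y n \<inter> {X. L \<le> visits l n X}) \<le> ennreal ((real y)\<^sup>2 * exp G / \<delta> / L)"
proof -
  define A where "A = {..<min l y}"
  have [simp]: "finite A" by (simp add: A_def)
  let ?B = "below y n \<inter> {X. L \<le> visits l n X}"
  let ?g = "\<lambda>x i X. indicator {x} (X i) * indicator (below y i) X :: ennreal"
  have [measurable]: "{X. L \<le> visits l n X} \<in> sets Q"
  proof -
    have "{X \<in> space Q. L \<le> visits l n X} \<in> sets Q" by measurable
    then show ?thesis by simp
  qed
  have count: "ennreal (visits l n X) = (\<Sum>x\<in>A. \<Sum>i<n. ?g x i X)" if X: "X \<in> below y n" for X
  proof -
    have "(\<Sum>x\<in>A. \<Sum>i<n. ?g x i X) = (\<Sum>i<n. \<Sum>x\<in>A. ?g x i X)" by (rule sum.swap)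
    also have "\<dots> = (\<Sum>i<n. ennreal (if X i < l then 1 else 0))"
    proof (rule sum.cong)
      fix i assume "i \<in> {..<n}"
      then have i: "X i < y" "X \<in> below y i" using X by (auto simp: below_def)
      have "(\<Sum>x\<in>A. ?g x i X) = (\<Sum>x\<in>A. if x = X i then 1 else 0)"
        using i(2) by (intro sum.cong) (auto simp: indicator_def)
      also have "\<dots> = ennreal (if X i < l then 1 else 0)"
        using i(1) by (simp add: A_def)
      finally show "(\<Sum>x\<in>A. ?g x i X) = ennreal (if X i < l then 1 else 0)" .
    qed simp
    also have "\<dots> = ennreal (visits l n X)" unfolding visits_def by (rule sum_ennreal) auto
    finally show ?thesis by simp
  qed
  have "ennreal L * emeasure Q ?B = (\<integral>\<^sup>+X. ennreal L * indicator ?B X \<partial>Q)"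
    by (rule nn_integral_cmult_indicator[symmetric]) measurable
  also have "\<dots> \<le> (\<integral>\<^sup>+X. (\<Sum>x\<in>A. \<Sum>i<n. ?g x i X) \<partial>Q)"
  proof (rule nn_integral_mono)
    fix X
    show "ennreal L * indicator ?B X \<le> (\<Sum>x\<in>A. \<Sum>i<n. ?g x i X)"
    proof (cases "X \<in> ?B")
      case True
      then have "ennreal L \<le> ennreal (visits l n X)" by (intro ennreal_leI) auto
      moreover have "ennreal L * indicator ?B X = ennreal L" using True by simp
      moreover have "X \<in> below y n" using True by simp
      ultimately show ?thesis using count[of X] by (simp only:)
    qed simp
  qed
  also have "\<dots> = (\<Sum>x\<in>A. \<Sum>i<n. \<integral>\<^sup>+X. ?g x i X \<partial>Q)"
  proof -
    have g: "?g x i \<in> borel_measurable Q" for x i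
      by (intro borel_measurable_times_ennreal borel_measurable_indicator below_sets function_measurable)
    then have "(\<lambda>X. \<Sum>i<n. ?g x i X) \<in> borel_measurable Q" for x by (intro borel_measurable_sum)
    with g show ?thesis by (simp only: nn_integral_sum)
  qed
  also have "\<dots> \<le> (\<Sum>x\<in>A. ennreal (real y * exp G / \<delta>))"
  proof (rule sum_mono)
    fix x assume x: "x \<in> A"
    have "(\<Sum>i\<in>{x..<y}. exp (V i - V x)) \<le> (\<Sum>i\<in>{x..<y}. exp G)"
      using climb x by (intro sum_mono) (auto simp: A_def)
    also have "\<dots> \<le> real y * exp G" by simp
    finally have "(\<Sum>i\<in>{x..<y}. exp (V i - V x)) / \<delta> \<le> real y * exp G / \<delta>"
      using \<delta> by (intro divide_right_mono) auto
    then show "(\<Sum>i<n. \<integral>\<^sup>+X. ?g x i X \<partial>Q) \<le> ennreal (real y * exp G / \<delta>)"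
      using expected_visits[of x y n] x by (auto simp: A_def intro: order_trans ennreal_leI)
  qed
  also have "\<dots> = ennreal (real (card A) * (real y * exp G / \<delta>))"
    by (subst ennreal_mult') (auto simp: ennreal_of_nat_eq_real_of_nat)
  also have "\<dots> \<le> ennreal (real y * (real y * exp G / \<delta>))"
    using \<delta> by (intro ennreal_leI mult_right_mono) (auto simp: A_def)
  finally have "ennreal (L * measure Q ?B) \<le> ennreal ((real y)\<^sup>2 * exp G / \<delta>)"
    using L by (simp add: Q.emeasure_eq_measure ennreal_mult' power2_eq_square mult.assoc)
  then have "L * measure Q ?B \<le> (real y)\<^sup>2 * exp G / \<delta>"
    using \<delta> by (subst (asm) ennreal_le_iff) auto
  then have "measure Q ?B \<le> (real y)\<^sup>2 * exp G / \<delta> / L"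
    using L by (subst pos_le_divide_eq) (auto simp: mult.commute)
  then show ?thesis by (simp add: Q.emeasure_eq_measure ennreal_leI)
qed

end

section \<open>Trapping of the walk\<close>

lemma sum_local_time:
  assumes "finite A"
  shows "(\<Sum>x\<in>A. local_time X n x) = card {j. j \<le> n \<and> X j \<in> A}"
proof -
  have "{j. j \<le> n \<and> X j \<in> A} = (\<Union>x\<in>A. {j. j \<le> n \<and> X j = x})" by auto
  also have "card \<dots> = (\<Sum>x\<in>A. card {j. j \<le> n \<and> X j = x})"
    by (rule card_UN_disjoint) (use assms in auto)
  finally show ?thesis by (simp add: local_time_def)
qed

lemma valley_time_eq_card:
  "valley_time K0 w X n k = card {j. j \<le> n \<and> X j \<in>
    {valley_start (potential w) K0 k..<valley_start (potential w) K0 (k + 1)}}"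
  unfolding valley_time_def by (rule sum_local_time) simp

lemma valley_time_le: "valley_time K0 w X n k \<le> n + 1"
proof -
  have "card {j. j \<le> n \<and> P j} \<le> card {..n}" for P by (rule card_mono) auto
  then show ?thesis unfolding valley_time_eq_card by (auto intro: order_trans)
qed

lemma visits_eq_card: "visits l (Suc n) X = real (card {j. j \<le> n \<and> X j < l})"
proof -
  have "visits l (Suc n) X = (\<Sum>j\<in>{j\<in>{..<Suc n}. X j < l}. 1)"
    unfolding visits_def by (rule sum.inter_filter[symmetric]) simp
  also have "{j\<in>{..<Suc n}. X j < l} = {j. j \<le> n \<and> X j < l}" by auto
  finally show ?thesis by simp
qed

lemma visits_mono: "n \<le> n' \<Longrightarrow> visits l n X \<le> visits l n' X"
  unfolding visits_def by (intro sum_mono2) auto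

context valleys
begin

lemma Hplus_unbounded:
  assumes "\<forall>\<^sub>F k in sequentially. h k + h k powr (1 - \<alpha>) \<le> h (Suc k)" and "\<alpha> < 1"
  shows "\<exists>k. c \<le> h k"
proof -
  obtain k0 where k0: "\<And>k. k0 \<le> k \<Longrightarrow> h k + h k powr (1 - \<alpha>) \<le> h (Suc k)"
    using assms(1) by (auto simp: eventually_sequentially)
  define d where "d = K0 powr (1 - \<alpha>)"
  have d: "0 < d" using K0 by (simp add: d_def)
  have "real n * d \<le> h (k0 + n)" for n
  proof (induction n)
    case (Suc n)
    have "d \<le> h (k0 + n) powr (1 - \<alpha>)"
      unfolding d_def using Hplus_ge[of "k0 + n"] K0 assms(2) by (intro powr_mono2) auto
    then show ?case using Suc k0[of "k0 + n"] by (simp add: algebra_simps)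
  qed (use Hplus_pos[of k0] in simp)
  moreover obtain n where "c / d \<le> real n" using real_arch_simple by blast
  then have "c \<le> real n * d" using d by (simp add: field_simps)
  ultimately show ?thesis using order_trans by blast
qed

text \<open>The loss \<open>a powr \<gamma>\<close> must be expressed by \<open>a\<close> alone
  although the gaps are measured in \<open>h (K - 2)\<close>, two valleys earlier. Two growth steps
  separate that height from \<open>h K\<close>, whence the square in the condition on
  \<open>\<gamma>\<close>.\<close>

lemma eventually_trap:
  assumes gaps: "\<forall>\<^sub>F k in sequentially. h k powr (1 - \<alpha>) \<le> V (b k) - V (b (Suc k)) \<and>
      h k + h k powr (1 - \<alpha>) \<le> h (Suc k) \<and> h (Suc k) \<le> h k powr (1 + \<alpha>)"
    and reached: "\<forall>\<^sub>F l in sequentially. \<exists>i\<le>l ^ 4. real l \<le> drawup V i"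
    and \<alpha>: "0 < \<alpha>" "\<alpha> < 1" and \<gamma>: "0 \<le> \<gamma>" "\<gamma> * (1 + \<alpha>)\<^sup>2 \<le> 1 - \<alpha>"
  shows "\<forall>\<^sub>F a in at_top. \<exists>K\<ge>2. \<exists>b y. b < y \<and> y \<le> m (K + 1) \<and> a \<le> V y - V b \<and> real y \<le> (a + 1) ^ 4 \<and>
    (\<forall>x i. x < m (K - 1) \<longrightarrow> x \<le> i \<longrightarrow> i < y \<longrightarrow> V i - V x \<le> a - a powr \<gamma>)"
proof -
  obtain k0 where k0: "\<And>k. k0 \<le> k \<Longrightarrow> h k powr (1 - \<alpha>) \<le> V (b k) - V (b (Suc k)) \<and>
      h k + h k powr (1 - \<alpha>) \<le> h (Suc k) \<and> h (Suc k) \<le> h k powr (1 + \<alpha>)"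
    using gaps by (auto simp: eventually_sequentially)
  have unb: "\<exists>k. c \<le> h k" for c
    by (rule Hplus_unbounded[OF _ \<alpha>(2)]) (use gaps in \<open>auto elim: eventually_mono\<close>)
  obtain k1 where k1: "1 \<le> h k1" using unb by blast
  define k2 where "k2 = max k0 k1"
  have k2: "1 \<le> h k" if "k2 \<le> k" for k using Hplus_mono[of k1 k] k1 that by (auto simp: k2_def)
  obtain l0 where l0: "\<And>l. l0 \<le> l \<Longrightarrow> \<exists>i\<le>l ^ 4. real l \<le> drawup V i"
    using reached by (auto simp: eventually_sequentially)
  show ?thesis
    unfolding eventually_at_top_linorder
  proof (rule exI[of _ "max (real l0) (h (k2 + 2) + 1)"], intro allI impI)
    fix a assume "max (real l0) (h (k2 + 2) + 1) \<le> a"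
    then have a: "real l0 \<le> a" "h (k2 + 2) < a" "0 < a" using Hplus_pos[of "k2 + 2"] by auto
    \<comment> \<open>Valley \<open>K\<close> is the first whose height reaches \<open>a\<close>.
      With \<open>k = K - 2\<close>, the sites left of valley \<open>K - 1\<close> are those before
      \<open>m (Suc k)\<close>, the situation of \<open>climb_from_left\<close>.\<close>
    define K where "K = (LEAST k. a \<le> h k)"
    have K: "a \<le> h K" unfolding K_def by (rule LeastI_ex[OF unb])
    have K_less: "h k < a" if "k < K" for k
      using not_less_Least[of k "\<lambda>k. a \<le> h k"] that unfolding K_def by simp
    have "k2 + 2 < K"
    proof (rule ccontr)
      assume "\<not> k2 + 2 < K"
      then have "h K \<le> h (k2 + 2)" by (intro Hplus_mono) auto
      then show False using K a(2) by simp
    qed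
    define k where "k = K - 2"
    have k: "K = Suc (Suc k)" "k2 \<le> k" "k0 \<le> k" using \<open>k2 + 2 < K\<close> by (auto simp: k_def k2_def)
    define s where "s = h k powr (1 - \<alpha>)"
    have h1: "1 \<le> h k" "1 \<le> h (Suc k)" using k2[of k] k2[of "Suc k"] k(2) by auto
    have "a \<le> h k powr ((1 + \<alpha>)\<^sup>2)"
    proof -
      have "a \<le> h (Suc k) powr (1 + \<alpha>)" using K k0[of "Suc k"] k by auto
      also have "\<dots> \<le> (h k powr (1 + \<alpha>)) powr (1 + \<alpha>)"
        using k0[OF k(3)] h1 \<alpha> by (intro powr_mono2) auto
      finally show ?thesis by (simp add: powr_powr power2_eq_square)
    qed
    then have "a powr \<gamma> \<le> (h k powr ((1 + \<alpha>)\<^sup>2)) powr \<gamma>" using a \<gamma> by (intro powr_mono2) auto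
    also have "\<dots> = h k powr (\<gamma> * (1 + \<alpha>)\<^sup>2)" by (simp add: powr_powr mult.commute)
    also have "\<dots> \<le> s" unfolding s_def using \<gamma> h1 by (intro powr_mono) auto
    finally have s: "a powr \<gamma> \<le> s" .
    have ex: "a \<le> drawup V (m (K + 1))" using drawup_valley_start[of K] K by simp
    \<comment> \<open>Taking the first site with such a drawup gives two things: all drawups before
      it are below \<open>a\<close>, and it is no further than the end \<open>m (K + 1)\<close> of
      valley \<open>K\<close>, where the drawup is at least \<open>h K\<close>.\<close>
    define y where "y = (LEAST i. a \<le> drawup V i)"
    have y: "a \<le> drawup V y" "y \<le> i" if "a \<le> drawup V i" for i
      using LeastI[of "\<lambda>i. a \<le> drawup V i", OF ex] Least_le[of "\<lambda>i. a \<le> drawup V i", OF that]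
      by (auto simp: y_def)
    have y_less: "drawup V z < a" if "z < y" for z using y(2)[of z] that by (meson not_le)
    obtain b where b: "b \<le> y" "a \<le> V y - V b" using y(1)[OF ex] by (auto simp: drawup_ge_iff)
    then have "b < y" using a(3) by (cases "b = y") auto
    moreover have "y \<le> m (K + 1)" by (rule y(2)[OF ex])
    moreover have "real y \<le> (a + 1) ^ 4"
    proof -
      let ?l = "nat \<lceil>a\<rceil>"
      have "l0 \<le> ?l" using a(1) by linarith
      then obtain i where i: "i \<le> ?l ^ 4" "real ?l \<le> drawup V i" using l0 by blast
      have "a \<le> drawup V i" using i(2) by linarith
      then have "y \<le> ?l ^ 4" using y(2)[of i] i(1) by linarith
      then have "real y \<le> real ?l ^ 4" by (metis of_nat_le_iff of_nat_power)
      also have "\<dots> \<le> (a + 1) ^ 4" by (rule power_mono) (use a(3) in linarith)+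
      finally show ?thesis .
    qed
    moreover have "V i - V x \<le> a - a powr \<gamma>" if "x < m (K - 1)" "x \<le> i" "i < y" for x i
    proof -
      have "V i - V x \<le> a - s"
        by (rule climb_from_left[of s k, OF _ _ _ y_less])
          (use k0[OF k(3)] K_less[of "Suc k"] k that in \<open>auto simp: s_def\<close>)
      then show ?thesis using s by simp
    qed
    moreover have "2 \<le> K" using k(1) by simp
    ultimately show "\<exists>K\<ge>2. \<exists>b y. b < y \<and> y \<le> m (K + 1) \<and> a \<le> V y - V b \<and> real y \<le> (a + 1) ^ 4 \<and>
        (\<forall>x i. x < m (K - 1) \<longrightarrow> x \<le> i \<longrightarrow> i < y \<longrightarrow> V i - V x \<le> a - a powr \<gamma>)"
      using b(2) by blast
  qed
qed

end

text \<open>At most \<open>K\<close> valleys are seen, so \<open>k + 1 < N_n\<close> puts the end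
  \<open>m (k + 1)\<close> of valley \<open>k\<close> no further than \<open>m (K - 1)\<close>. The
  valleys \<open>K - 1\<close> and \<open>K\<close> then cover all remaining times up to
  \<open>n\<close>. \<open>Suc n\<close> appears because \<open>visits\<close> counts times strictly
  below its argument.\<close>

lemma (in valleys) time_in_valleys:
  assumes V: "V = potential w" and K: "2 \<le> K" and X: "\<And>i. i \<le> n \<Longrightarrow> X i < m (K + 1)"
  shows "(\<Sum>k | 1 \<le> k \<and> k + 1 < valleys_seen K0 w X n. real (valley_time K0 w X n k)) \<le> visits (m (K - 1)) (Suc n) X"
    and "real n \<le> visits (m (K - 1)) (Suc n) X + real (valley_time K0 w X n (K - 1)) + real (valley_time K0 w X n K)"
proof -
  have seen: "valleys_seen K0 w X n \<le> K"
  proof -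
    have bound: "k \<le> K" if k: "1 \<le> k" "m k \<le> Max (X ` {0..n})" for k
    proof (rule ccontr)
      assume "\<not> k \<le> K"
      then have "m (K + 1) \<le> m k" using K by (intro valley_start_mono) auto
      also have "m k \<le> Max (X ` {0..n})" by (rule k)
      finally have le: "m (K + 1) \<le> Max (X ` {0..n})" .
      have "Max (X ` {0..n}) \<in> X ` {0..n}" by (rule Max_in) auto
      then obtain i where "i \<in> {0..n}" "Max (X ` {0..n}) = X i" by blast
      then have "Max (X ` {0..n}) < m (K + 1)" using X[of i] by simp
      with le show False by linarith
    qed
    have "Sup {k. 1 \<le> k \<and> m k \<le> Max (X ` {0..n})} \<le> K"
    proof (cases "{k. 1 \<le> k \<and> m k \<le> Max (X ` {0..n})} = {}")
      case True
      show ?thesis unfolding True by (simp add: Sup_nat_def)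
    next
      case False
      then show ?thesis by (rule cSup_least) (use bound in blast)
    qed
    then show ?thesis unfolding valleys_seen_def V[symmetric] .
  qed
  let ?I = "{k. 1 \<le> k \<and> k + 1 < valleys_seen K0 w X n}"
  let ?T = "\<lambda>k. {j. j \<le> n \<and> X j \<in> {m k..<m (k + 1)}}"
  have fin: "finite ?I" by (rule finite_subset[of _ "{..K}"]) (use seen in auto)
  have time: "valley_time K0 w X n k = card (?T k)" for k
    unfolding valley_time_eq_card V[symmetric] ..
  have disj: "?T k \<inter> ?T l = {}" if "1 \<le> k" "1 \<le> l" "k \<noteq> l" for k l
  proof -
    have "m (k + 1) \<le> m l \<or> m (l + 1) \<le> m k"
      using that valley_start_mono[of "k + 1" l] valley_start_mono[of "l + 1" k] by linarith
    then show ?thesis by auto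
  qed
  have "(\<Sum>k\<in>?I. card (?T k)) = card (\<Union>k\<in>?I. ?T k)"
    by (rule card_UN_disjoint[symmetric]) (use fin disj in auto)
  also have "\<dots> \<le> card {j. j \<le> n \<and> X j < m (K - 1)}"
  proof (rule card_mono)
    show "(\<Union>k\<in>?I. ?T k) \<subseteq> {j. j \<le> n \<and> X j < m (K - 1)}"
    proof
      fix j assume "j \<in> (\<Union>k\<in>?I. ?T k)"
      then obtain k where k: "1 \<le> k" "k + 1 < valleys_seen K0 w X n" "j \<le> n" "X j < m (k + 1)" by auto
      have "m (k + 1) \<le> m (K - 1)" using k seen by (intro valley_start_mono) auto
      then show "j \<in> {j. j \<le> n \<and> X j < m (K - 1)}" using k by auto
    qed
  qed auto
  finally show "(\<Sum>k\<in>?I. real (valley_time K0 w X n k)) \<le> visits (m (K - 1)) (Suc n) X"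
    unfolding visits_eq_card time by (simp flip: of_nat_sum)
  have "{..n} \<subseteq> {j. j \<le> n \<and> X j < m (K - 1)} \<union> ?T (K - 1) \<union> ?T K"
    using X K by (auto simp: not_less)
  then have "card {..n} \<le> card ({j. j \<le> n \<and> X j < m (K - 1)} \<union> ?T (K - 1) \<union> ?T K)"
    by (intro card_mono) auto
  also have "\<dots> \<le> card {j. j \<le> n \<and> X j < m (K - 1)} + card (?T (K - 1)) + card (?T K)"
    by (meson add_right_mono card_Un_le order_trans)
  finally have "Suc n \<le> card {j. j \<le> n \<and> X j < m (K - 1)} + card (?T (K - 1)) + card (?T K)" by simp
  then show "real n \<le> visits (m (K - 1)) (Suc n) X + real (valley_time K0 w X n (K - 1)) + real (valley_time K0 w X n K)"
    unfolding visits_eq_card time by linarith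
qed

text \<open>Here \<open>exp (a j - j) = (j + 1)^3\<close>. The first term is thus of order
  \<open>(j + 1)^(-3)\<close>, and the second is a polynomial in \<open>j\<close> and
  \<open>a j\<close> times \<open>exp (- (a j powr \<gamma>) / 2)\<close>.\<close>

lemma summable_trap_bounds:
  fixes c d \<gamma> :: real
  assumes \<gamma>: "1 / 2 \<le> \<gamma>"
  defines "a \<equiv> \<lambda>j::nat. real j + 3 * ln (real j + 1)"
  shows "summable (\<lambda>j. c * (exp (real j + 1) + 2) * exp (- a j) +
    d * ((a j + 1) ^ 4)\<^sup>2 * exp (a j - a j powr \<gamma>) / exp (real j - a j powr \<gamma> / 2))"
proof -
  have "summable (\<lambda>j. (exp (real j + 1) + 2) * exp (- a j))"
  proof (rule summable_comparison_test_bigo)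
    show "(\<lambda>j. (exp (real j + 1) + 2) * exp (- a j)) \<in> O(\<lambda>j. 1 / real j ^ 2)"
      unfolding a_def by real_asymp
    show "summable (\<lambda>j. norm (1 / real j ^ 2))"
      using inverse_power_summable[of 2, where 'a = real] by (simp add: inverse_eq_divide)
  qed
  moreover have "summable (\<lambda>j. ((a j + 1) ^ 4)\<^sup>2 * exp (a j - a j powr \<gamma>) / exp (real j - a j powr \<gamma> / 2))"
  proof (rule summable_comparison_test_bigo)
    show "summable (\<lambda>j. norm (1 / real j ^ 2))"
      using inverse_power_summable[of 2, where 'a = real] by (simp add: inverse_eq_divide)
    \<comment> \<open>As \<open>a j\<close> is at least 1, the symbolic exponent
      \<open>\<gamma>\<close> may be replaced by its lower bound 1/2, which leaves a comparison of
      explicit functions.\<close>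
    have "(\<lambda>j. ((a j + 1) ^ 4)\<^sup>2 * exp (a j - a j powr \<gamma>) / exp (real j - a j powr \<gamma> / 2)) \<in>
        O(\<lambda>j. ((a j + 1) ^ 4)\<^sup>2 * exp (a j - real j) * exp (- (a j powr (1 / 2)) / 2))"
    proof (rule bigoI[where c = 1], use eventually_ge_at_top[of 1] in eventually_elim)
      fix j :: nat assume "1 \<le> j"
      then have a: "1 \<le> a j" by (auto simp: a_def intro!: add_increasing2)
      have "exp (a j - a j powr \<gamma>) / exp (real j - a j powr \<gamma> / 2) = exp (a j - real j) * exp (- (a j powr \<gamma>) / 2)"
        by (simp add: exp_diff[symmetric] exp_add[symmetric])
      also have "\<dots> \<le> exp (a j - real j) * exp (- (a j powr (1 / 2)) / 2)"
        using a \<gamma> by (intro mult_left_mono) (auto intro!: powr_mono)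
      finally show "norm (((a j + 1) ^ 4)\<^sup>2 * exp (a j - a j powr \<gamma>) / exp (real j - a j powr \<gamma> / 2)) \<le>
          1 * norm (((a j + 1) ^ 4)\<^sup>2 * exp (a j - real j) * exp (- (a j powr (1 / 2)) / 2))"
        by (simp add: abs_mult mult.assoc mult_left_mono flip: times_divide_eq_right)
    qed
    also have "(\<lambda>j. ((a j + 1) ^ 4)\<^sup>2 * exp (a j - real j) * exp (- (a j powr (1 / 2)) / 2)) \<in> O(\<lambda>j. 1 / real j ^ 2)"
      unfolding a_def by real_asymp
    finally show "(\<lambda>j. ((a j + 1) ^ 4)\<^sup>2 * exp (a j - a j powr \<gamma>) / exp (real j - a j powr \<gamma> / 2)) \<in>
        O(\<lambda>j. 1 / real j ^ 2)" .
  qed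
  ultimately have "summable (\<lambda>j. c * ((exp (real j + 1) + 2) * exp (- a j)) +
      d * (((a j + 1) ^ 4)\<^sup>2 * exp (a j - a j powr \<gamma>) / exp (real j - a j powr \<gamma> / 2)))"
    by (intro summable_add summable_mult)
  then show ?thesis by (simp add: mult.assoc)
qed

lemma tendsto_stretched_exp:
  fixes \<beta> \<gamma> :: real
  assumes "\<beta> < \<gamma>" "0 < \<gamma>"
  shows "(\<lambda>n::nat. exp (ln (real n) powr \<beta> - ln (real n) powr \<gamma> / 2)) \<longlonglongrightarrow> 0"
proof (rule tendsto_sandwich[where f = "\<lambda>_. 0" and h = "\<lambda>n. exp (- (ln (real n) powr \<gamma> / 4))"])
  have ln_powr: "filterlim (\<lambda>n::nat. ln (real n) powr d) at_top sequentially" if "0 < d" for d :: real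
    using that by real_asymp
  have "((\<lambda>x::real. exp (- (x / 4))) \<longlongrightarrow> 0) at_top" by real_asymp
  then show "(\<lambda>n::nat. exp (- (ln (real n) powr \<gamma> / 4))) \<longlonglongrightarrow> 0"
    by (rule filterlim_compose[OF _ ln_powr[OF assms(2)]])
  have "filterlim (\<lambda>n::nat. ln (real n) powr (\<gamma> - \<beta>)) at_top sequentially"
    using assms(1) by (intro ln_powr) simp
  then have "\<forall>\<^sub>F n::nat in sequentially. 4 \<le> ln (real n) powr (\<gamma> - \<beta>)"
    by (simp add: filterlim_at_top)
  moreover have "\<forall>\<^sub>F n::nat in sequentially. 0 < ln (real n)" by real_asymp
  ultimately show "\<forall>\<^sub>F n::nat in sequentially. exp (ln (real n) powr \<beta> - ln (real n) powr \<gamma> / 2) \<le>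
      exp (- (ln (real n) powr \<gamma> / 4))"
  proof eventually_elim
    case (elim n)
    have "4 * ln (real n) powr \<beta> \<le> ln (real n) powr (\<gamma> - \<beta>) * ln (real n) powr \<beta>"
      using elim by (intro mult_right_mono) auto
    also have "\<dots> = ln (real n) powr \<gamma>" by (simp flip: powr_add)
    finally show ?case by simp
  qed
qed auto

lemma AE_trapped:
  assumes "quenched_walk Q w \<delta>" "valleys (potential w) K0"
    and steps: "\<And>i. \<bar>potential w (Suc i) - potential w i\<bar> \<le> C"
    and gaps: "\<forall>\<^sub>F k in sequentially. Hplus (potential w) K0 k powr (1 - \<alpha>) \<le>
        potential w (bottom (potential w) K0 k) - potential w (bottom (potential w) K0 (Suc k)) \<and>
      Hplus (potential w) K0 k + Hplus (potential w) K0 k powr (1 - \<alpha>) \<le> Hplus (potential w) K0 (Suc k) \<and>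
      Hplus (potential w) K0 (Suc k) \<le> Hplus (potential w) K0 k powr (1 + \<alpha>)"
    and reached: "\<forall>\<^sub>F l in sequentially. \<exists>i\<le>l ^ 4. real l \<le> drawup (potential w) i"
    and \<alpha>: "0 < \<alpha>" "\<alpha> < 1" and \<gamma>: "1 / 2 \<le> \<gamma>" "\<gamma> * (1 + \<alpha>)\<^sup>2 \<le> 1 - \<alpha>"
  shows "AE X in Q. \<forall>\<^sub>F n in sequentially. \<exists>K\<ge>2. (\<forall>i\<le>n. X i < valley_start (potential w) K0 (K + 1)) \<and>
    visits (valley_start (potential w) K0 (K - 1)) (Suc n) X \<le> real n * exp (- (ln (real n) powr \<gamma> / 2))"
proof -
  interpret W: quenched_walk Q w \<delta> by fact
  let ?V = "potential w"
  let ?m = "valley_start ?V K0"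
  define trap where "trap a K b y \<longleftrightarrow> 2 \<le> K \<and> b < y \<and> y \<le> ?m (K + 1) \<and> a \<le> ?V y - ?V b \<and>
      real y \<le> (a + 1) ^ 4 \<and> (\<forall>x i. x < ?m (K - 1) \<longrightarrow> x \<le> i \<longrightarrow> i < y \<longrightarrow> ?V i - ?V x \<le> a - a powr \<gamma>)"
    for a :: real and K b y
  have "\<forall>\<^sub>F a in at_top. \<exists>K b y. trap a K b y"
    using valleys.eventually_trap[OF assms(2) gaps reached \<alpha> _ \<gamma>(2)] \<gamma>(1)
    by (auto simp: trap_def elim!: eventually_mono)
  then obtain A where "\<forall>a\<ge>A. \<exists>K b y. trap a K b y"
    unfolding eventually_at_top_linorder by blast
  then obtain K b y where trap: "\<And>a. A \<le> a \<Longrightarrow> trap a (K a) (b a) (y a)"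
    by metis
  have K: "2 \<le> K a" and b: "b a < y a" and y: "y a \<le> ?m (K a + 1)" "real (y a) \<le> (a + 1) ^ 4"
    and rise: "a \<le> ?V (y a) - ?V (b a)" if "A \<le> a" for a
    using trap[OF that] by (auto simp: trap_def)
  have climb: "?V i - ?V x \<le> a - a powr \<gamma>" if "A \<le> a" "x < ?m (K a - 1)" "x \<le> i" "i < y a" for a x i
    using trap[OF that(1)] that by (auto simp: trap_def)
  \<comment> \<open>The logarithmic excess over \<open>j\<close> makes the escape probabilities summable.\<close>
  define a where "a j = real j + 3 * ln (real j + 1)" for j :: nat
  \<comment> \<open>Large enough that \<open>Suc n\<close> is at most \<open>N j\<close> whenever
    \<open>n < exp (j + 1)\<close>.\<close>
  define N where "N j = Suc (nat \<lceil>exp (real j + 1)\<rceil>)" for j :: nat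
  \<comment> \<open>Only half of \<open>a j powr \<gamma>\<close> is claimed; the other half beats
    the polynomial factors in the probability of \<open>linger\<close>.\<close>
  define L where "L j = exp (real j - a j powr \<gamma> / 2)" for j :: nat
  define escape where "escape j = - W.below (y (a j)) (N j)" for j
  define linger where "linger j = W.below (y (a j)) (N j) \<inter> {X. L j \<le> visits (?m (K (a j) - 1)) (N j) X}" for j
  define Bad where "Bad j = (if A \<le> a j then escape j \<union> linger j else {})" for j
  define c where "c j = exp C * (exp (real j + 1) + 2) * exp (- a j) +
    1 / \<delta> * ((a j + 1) ^ 4)\<^sup>2 * exp (a j - a j powr \<gamma>) / exp (real j - a j powr \<gamma> / 2)" for j
  have escape: "escape j \<in> sets Q" for j
    using sets.compl_sets[OF W.below_sets] by (simp add: escape_def Compl_eq_Diff_UNIV)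
  have linger: "linger j \<in> sets Q" for j
  proof -
    have "{X \<in> space Q. L j \<le> visits (?m (K (a j) - 1)) (N j) X} \<in> sets Q" by measurable
    then show ?thesis by (simp add: linger_def)
  qed
  have "AE X in Q. \<forall>\<^sub>F j in sequentially. X \<notin> Bad j"
  proof (rule W.Q.AE_eventually_not)
    show "Bad j \<in> sets Q" for j using escape[of j] linger[of j] by (simp add: Bad_def)
    show c0: "0 \<le> c j" for j using W.\<delta> by (simp add: c_def)
    show "summable c"
      unfolding c_def a_def by (rule summable_trap_bounds[OF \<gamma>(1)])
    show "emeasure Q (Bad j) \<le> ennreal (c j)" for j
    proof (cases "A \<le> a j")
      case True
      have "emeasure Q (escape j) \<le> ennreal (real (N j) * exp (?V (b (a j)) - ?V (y (a j) - 1)))"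
        unfolding escape_def by (rule W.prob_not_below[OF b[OF True]])
      also have "\<dots> \<le> ennreal ((exp (real j + 1) + 2) * exp (C - a j))"
      proof (intro ennreal_leI mult_mono)
        have ceil: "real (nat \<lceil>x\<rceil>) \<le> x + 1" if "0 < x" for x :: real using that by linarith
        have "real (nat \<lceil>exp (real j + 1)\<rceil>) \<le> exp (real j + 1) + 1" by (rule ceil[OF exp_gt_zero])
        then show "real (N j) \<le> exp (real j + 1) + 2" unfolding N_def of_nat_Suc by linarith
        \<comment> \<open>The escape bound involves the potential at \<open>y - 1\<close>, while the
          drawup is known at \<open>y\<close>; the step between them costs the factor
          \<open>exp C\<close>.\<close>
        have "\<bar>?V (Suc (y (a j) - 1)) - ?V (y (a j) - 1)\<bar> \<le> C" by (rule steps)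
        then show "exp (?V (b (a j)) - ?V (y (a j) - 1)) \<le> exp (C - a j)"
          using rise[OF True] b[OF True] by simp
      qed (auto simp: add_nonneg_nonneg)
      also have "(exp (real j + 1) + 2) * exp (C - a j) = exp C * (exp (real j + 1) + 2) * exp (- a j)"
        by (simp add: exp_diff exp_minus field_simps)
      finally have 1: "emeasure Q (escape j) \<le> ennreal (exp C * (exp (real j + 1) + 2) * exp (- a j))" .
      have "emeasure Q (linger j) \<le> ennreal ((real (y (a j)))\<^sup>2 * exp (a j - a j powr \<gamma>) / \<delta> / L j)"
        unfolding linger_def by (rule W.prob_many_visits) (use climb[OF True] in \<open>auto simp: L_def\<close>)
      also have "\<dots> \<le> ennreal (((a j + 1) ^ 4)\<^sup>2 * exp (a j - a j powr \<gamma>) / \<delta> / L j)"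
        using y(2)[OF True] W.\<delta>
        by (intro ennreal_leI divide_right_mono mult_right_mono power_mono) (auto simp: L_def)
      also have "((a j + 1) ^ 4)\<^sup>2 * exp (a j - a j powr \<gamma>) / \<delta> / L j =
          1 / \<delta> * ((a j + 1) ^ 4)\<^sup>2 * exp (a j - a j powr \<gamma>) / exp (real j - a j powr \<gamma> / 2)"
        by (simp add: L_def)
      finally have 2: "emeasure Q (linger j) \<le> \<dots>" .
      have "emeasure Q (Bad j) \<le> emeasure Q (escape j) + emeasure Q (linger j)"
        using True by (simp add: Bad_def emeasure_subadditive escape linger)
      also have "\<dots> \<le> ennreal (exp C * (exp (real j + 1) + 2) * exp (- a j)) +
          ennreal (1 / \<delta> * ((a j + 1) ^ 4)\<^sup>2 * exp (a j - a j powr \<gamma>) / exp (real j - a j powr \<gamma> / 2))"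
        by (rule add_mono[OF 1 2])
      also have "\<dots> = ennreal (c j)"
        unfolding c_def using W.\<delta> by (intro ennreal_plus[symmetric]) (auto simp: add_nonneg_nonneg)
      finally show ?thesis .
    qed (simp add: Bad_def)
  qed
  then show ?thesis
  proof eventually_elim
    case (elim X)
    then obtain j0 where j0: "\<And>j. j0 \<le> j \<Longrightarrow> X \<notin> Bad j" by (auto simp: eventually_sequentially)
    \<comment> \<open>The 1 ensures \<open>3 * ln (j + 1) >= 1\<close>, so that
      \<open>ln n < j + 1 <= a j\<close>. The bound by \<open>A\<close> then makes the trap at level
      \<open>a j\<close> available.\<close>
    define j1 where "j1 = max j0 (max 1 (nat \<lceil>A\<rceil>))"
    show ?case
      unfolding eventually_sequentially
    proof (rule exI[of _ "nat \<lceil>exp (real j1)\<rceil>"], intro allI impI)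
      fix n assume "nat \<lceil>exp (real j1)\<rceil> \<le> n"
      then have "exp (real j1) \<le> real n" by linarith
      moreover from this have n: "0 < real n" using exp_gt_zero[of "real j1"] by linarith
      ultimately have ln: "real j1 \<le> ln (real n)" using ln_ge_iff[of "real n" "real j1"] by simp
      define j where "j = nat \<lfloor>ln (real n)\<rfloor>"
      have j: "j1 \<le> j" "real j \<le> ln (real n)" "ln (real n) < real j + 1"
        using ln by (auto simp: j_def le_nat_floor)
      have a_ge: "real j + 1 \<le> a j"
      proof -
        have "ln (2::real) \<le> ln (real j + 1)"
          using j(1) by (subst ln_le_cancel_iff) (auto simp: j1_def)
        then have "1 \<le> 3 * ln (real j + 1)" using ln2_ge_two_thirds by linarith
        then show ?thesis by (simp add: a_def)
      qed
      have Aj: "A \<le> a j"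
      proof -
        have "nat \<lceil>A\<rceil> \<le> j" using j(1) by (simp add: j1_def)
        then show ?thesis using a_ge by linarith
      qed
      have "X \<notin> Bad j" using j(1) by (intro j0) (simp add: j1_def)
      then have below: "X \<in> W.below (y (a j)) (N j)" and short: "visits (?m (K (a j) - 1)) (N j) X < L j"
        using Aj by (auto simp: Bad_def escape_def linger_def not_le)
      have "real n < exp (real j + 1)" using iffD2[OF exp_less_cancel_iff j(3)] n by simp
      then have nN: "Suc n \<le> N j" unfolding N_def by linarith
      show "\<exists>K\<ge>2. (\<forall>i\<le>n. X i < ?m (K + 1)) \<and>
          visits (?m (K - 1)) (Suc n) X \<le> real n * exp (- (ln (real n) powr \<gamma> / 2))"
      proof (rule exI[of _ "K (a j)"], intro conjI allI impI)
        show "2 \<le> K (a j)" by (rule K[OF Aj])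
        show "X i < ?m (K (a j) + 1)" if "i \<le> n" for i
        proof -
          have "X i < y (a j)" using below that nN by (simp add: W.below_def)
          then show ?thesis using y(1)[OF Aj] by (rule less_le_trans)
        qed
        have "visits (?m (K (a j) - 1)) (Suc n) X \<le> visits (?m (K (a j) - 1)) (N j) X"
          by (rule visits_mono[OF nN])
        also have "\<dots> \<le> L j" using short by simp
        also have "\<dots> \<le> exp (ln (real n) - ln (real n) powr \<gamma> / 2)"
        proof -
          have "ln (real n) powr \<gamma> \<le> a j powr \<gamma>"
            using j a_ge \<gamma>(1) by (intro powr_mono2) auto
          then have "real j - a j powr \<gamma> / 2 \<le> ln (real n) - ln (real n) powr \<gamma> / 2"
            using j(2) by linarith
          then show ?thesis unfolding L_def by (rule iffD2[OF exp_le_cancel_iff])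
        qed
        also have "\<dots> = real n * exp (- (ln (real n) powr \<gamma> / 2))"
          unfolding diff_conv_add_uminus exp_add using n by simp
        finally show "visits (?m (K (a j) - 1)) (Suc n) X \<le> real n * exp (- (ln (real n) powr \<gamma> / 2))" .
      qed
    qed
  qed
qed

lemma localization_of_trapped:
  assumes "valleys (potential w) K0" and \<gamma>: "0 < \<gamma>" "\<beta> < \<gamma>"
    and trapped: "\<forall>\<^sub>F n in sequentially. \<exists>K\<ge>2. (\<forall>i\<le>n. X i < valley_start (potential w) K0 (K + 1)) \<and>
      visits (valley_start (potential w) K0 (K - 1)) (Suc n) X \<le> real n * exp (- (ln (real n) powr \<gamma> / 2))"
  shows "(\<lambda>n. exp (ln (real n) powr \<beta>) / real n *
      (\<Sum>k | 1 \<le> k \<and> k + 1 < valleys_seen K0 w X n. real (valley_time K0 w X n k))) \<longlonglongrightarrow> 0"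
    and "c < 1 / 2 \<Longrightarrow> \<forall>\<^sub>F n in sequentially. \<exists>k\<ge>1. c * real n \<le> real (valley_time K0 w X n k)"
proof -
  interpret valleys "potential w" K0 by fact
  let ?f = "\<lambda>n. exp (ln (real n) powr \<beta>) / real n *
      (\<Sum>k | 1 \<le> k \<and> k + 1 < valleys_seen K0 w X n. real (valley_time K0 w X n k))"
  show "?f \<longlonglongrightarrow> 0"
  proof (rule tendsto_sandwich[where f = "\<lambda>_. 0" and h = "\<lambda>n. exp (ln (real n) powr \<beta> - ln (real n) powr \<gamma> / 2)"])
    show "\<forall>\<^sub>F n in sequentially. ?f n \<le> exp (ln (real n) powr \<beta> - ln (real n) powr \<gamma> / 2)"
      using trapped eventually_gt_at_top[of 0]
    proof eventually_elim
      case (elim n)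
      then obtain K where K: "2 \<le> K" "\<And>i. i \<le> n \<Longrightarrow> X i < m (K + 1)"
        "visits (m (K - 1)) (Suc n) X \<le> real n * exp (- (ln (real n) powr \<gamma> / 2))" by blast
      have "?f n \<le> exp (ln (real n) powr \<beta>) / real n * (real n * exp (- (ln (real n) powr \<gamma> / 2)))"
        using time_in_valleys(1)[OF refl K(1), of n X, OF K(2)] K(3) by (intro mult_left_mono) auto
      also have "\<dots> = exp (ln (real n) powr \<beta> - ln (real n) powr \<gamma> / 2)"
        unfolding diff_conv_add_uminus exp_add using elim(2) by simp
      finally show ?case .
    qed
    show "(\<lambda>n. exp (ln (real n) powr \<beta> - ln (real n) powr \<gamma> / 2)) \<longlonglongrightarrow> 0"
      by (rule tendsto_stretched_exp) fact+
    show "\<forall>\<^sub>F n in sequentially. 0 \<le> ?f n"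
      by (intro always_eventually allI mult_nonneg_nonneg divide_nonneg_nonneg sum_nonneg) auto
  qed simp
  show "\<forall>\<^sub>F n in sequentially. \<exists>k\<ge>1. c * real n \<le> real (valley_time K0 w X n k)" if c: "c < 1 / 2"
  proof -
    \<comment> \<open>The instance \<open>\<beta> = 0\<close> only adds a nonnegative term to the
      exponent. Hence the time left of valley \<open>K - 1\<close> is eventually at most
      \<open>(1 - 2 * c) * n\<close>, and one of the two remaining valleys must hold at least
      \<open>c * n\<close>.\<close>
    have "(\<lambda>n::nat. exp (ln (real n) powr 0 - ln (real n) powr \<gamma> / 2)) \<longlonglongrightarrow> 0"
      by (rule tendsto_stretched_exp) fact+
    then have "\<forall>\<^sub>F n::nat in sequentially. exp (ln (real n) powr 0 - ln (real n) powr \<gamma> / 2) < 1 - 2 * c"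
      using c by (intro order_tendstoD) auto
    with trapped eventually_gt_at_top[of 0] show ?thesis
    proof eventually_elim
      case (elim n)
      then obtain K where K: "2 \<le> K" "\<And>i. i \<le> n \<Longrightarrow> X i < m (K + 1)"
        "visits (m (K - 1)) (Suc n) X \<le> real n * exp (- (ln (real n) powr \<gamma> / 2))" by blast
      have "exp (- (ln (real n) powr \<gamma> / 2)) \<le> exp (ln (real n) powr 0 - ln (real n) powr \<gamma> / 2)" by simp
      then have "exp (- (ln (real n) powr \<gamma> / 2)) \<le> 1 - 2 * c" using elim(3) by linarith
      then have "real n * exp (- (ln (real n) powr \<gamma> / 2)) \<le> real n * (1 - 2 * c)" by (intro mult_left_mono) auto
      then have "2 * (c * real n) \<le> real (valley_time K0 w X n (K - 1)) + real (valley_time K0 w X n K)"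
        using time_in_valleys(2)[OF refl K(1), of n X, OF K(2)] K(3) by (simp add: algebra_simps)
      then have "c * real n \<le> real (valley_time K0 w X n (K - 1)) \<or> c * real n \<le> real (valley_time K0 w X n K)"
        by linarith
      moreover have "1 \<le> K - 1" "1 \<le> K" using K(1) by auto
      ultimately show ?case by blast
    qed
  qed
qed

lemma liminf_valley_time:
  assumes "\<And>p::nat. \<forall>\<^sub>F n in sequentially. \<exists>k\<ge>1. (1 / 2 - 1 / (real p + 1)) * real n \<le> real (valley_time K0 w X n k)"
  shows "liminf (\<lambda>n. ereal (1 / real n * (SUP k\<in>{1..}. real (valley_time K0 w X n k)))) \<ge> 1 / 2"
proof -
  let ?g = "\<lambda>n. ereal (1 / real n * (SUP k\<in>{1..}. real (valley_time K0 w X n k)))"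
  have "ereal (1 / 2 - 1 / (real p + 1)) \<le> liminf ?g" for p :: nat
  proof (rule Liminf_bounded)
    show "\<forall>\<^sub>F n in sequentially. ereal (1 / 2 - 1 / (real p + 1)) \<le> ?g n"
      using assms[of p] eventually_gt_at_top[of 0]
    proof eventually_elim
      case (elim n)
      then obtain k where k: "1 \<le> k" "(1 / 2 - 1 / (real p + 1)) * real n \<le> real (valley_time K0 w X n k)" by blast
      have "real (valley_time K0 w X n k) \<le> (SUP k\<in>{1..}. real (valley_time K0 w X n k))"
      proof (rule cSUP_upper)
        show "bdd_above ((\<lambda>k. real (valley_time K0 w X n k)) ` {1..})"
          using valley_time_le by (intro bdd_aboveI[of _ "real (n + 1)"]) (auto simp flip: of_nat_Suc)
      qed (use k in auto)
      with k(2) have "(1 / 2 - 1 / (real p + 1)) * real n \<le> (SUP k\<in>{1..}. real (valley_time K0 w X n k))" by linarith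
      then have "1 / 2 - 1 / (real p + 1) \<le> (SUP k\<in>{1..}. real (valley_time K0 w X n k)) / real n"
        using elim(2) by (subst pos_le_divide_eq) auto
      then show ?case by simp
    qed
  qed
  moreover have "(\<lambda>p::nat. ereal (1 / 2 - 1 / (real p + 1))) \<longlonglongrightarrow> ereal (1 / 2)"
    by (rule tendsto_ereal) real_asymp
  ultimately have "ereal (1 / 2) \<le> liminf ?g" by (blast intro: LIMSEQ_le_const2)
  moreover have "(1 / 2 :: ereal) = ereal (1 / 2)" by (simp add: one_ereal_def numeral_eq_ereal)
  ultimately show ?thesis by simp
qed

section \<open>The annealed law\<close>

lemma pred_nat_compare:
  fixes a b :: "'x \<Rightarrow> nat"
  assumes a: "a \<in> N \<rightarrow>\<^sub>M count_space UNIV" and b: "b \<in> N \<rightarrow>\<^sub>M count_space UNIV"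
  shows "Measurable.pred N (\<lambda>x. a x \<le> b x)" "Measurable.pred N (\<lambda>x. a x < b x)"
  by (rule measurable_compose_countable[OF measurable_compose[OF b] a], simp)+

context
  fixes mu :: "real measure" and Q :: "(nat \<Rightarrow> real) \<Rightarrow> (nat \<Rightarrow> nat) measure" and \<delta> K0 :: real
  assumes prob_mu: "prob_space mu" and sets_mu: "sets mu = sets borel"
    and centered: "prob_space.expectation (env_law mu) (\<lambda>w. ln (rho w 1)) = 0"
    and nondegenerate: "prob_space.variance (env_law mu) (\<lambda>w. ln (rho w 1)) > 0"
    and \<delta>: "0 < \<delta>" "\<delta> < 1"
    and elliptic: "\<P>(w in env_law mu. \<delta> \<le> w 1 \<and> w 1 \<le> 1 - \<delta>) = 1"
    and K0: "K0 > 0"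
    and kernel: "quenched_kernel mu Q"
begin

abbreviation "log_ratio \<equiv> \<lambda>s::real. ln ((1 - s) / s)"

lemma sequence_space_mu: "sequence_space mu"
proof -
  interpret prob_space mu by (rule prob_mu)
  show ?thesis by unfold_locales
qed

lemma log_ratio_measurable [measurable]: "log_ratio \<in> borel_measurable mu"
  unfolding measurable_cong_sets[OF sets_mu refl] by measurable

lemma distr_env_component: "distr (env_law mu) mu (\<lambda>w. w i) = mu"
  unfolding env_law_def using sequence_space_mu
  by (intro product_prob_space.PiM_component) (auto simp: sequence_space_def)

lemma component_env [measurable]: "(\<lambda>w. w i) \<in> env_law mu \<rightarrow>\<^sub>M mu"
  unfolding env_law_def by measurable

lemma prob_space_env: "prob_space (env_law mu)"
  unfolding env_law_def by (intro prob_space_PiM prob_mu)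

lemma AE_elliptic_mu: "AE s in mu. \<delta> \<le> s \<and> s \<le> 1 - \<delta>"
proof -
  interpret E: prob_space "env_law mu" by (rule prob_space_env)
  have pred: "Measurable.pred mu (\<lambda>s. \<delta> \<le> s \<and> s \<le> 1 - \<delta>)"
    unfolding measurable_cong_sets[OF sets_mu refl] by measurable
  have "{w \<in> space (env_law mu). \<delta> \<le> w 1 \<and> w 1 \<le> 1 - \<delta>} \<in> sets (env_law mu)"
    using measurable_compose[OF component_env pred] by (simp add: pred_def)
  then have "AE w in env_law mu. \<delta> \<le> w 1 \<and> w 1 \<le> 1 - \<delta>"
    using E.prob_eq_1 elliptic by auto
  then have "AE s in distr (env_law mu) mu (\<lambda>w. w 1). \<delta> \<le> s \<and> s \<le> 1 - \<delta>"
    using pred by (subst AE_distr_iff) (auto simp: pred_def)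
  then show ?thesis by (subst (asm) distr_env_component)
qed

lemma log_ratio_bounded:
  assumes "\<delta> \<le> s" "s \<le> 1 - \<delta>" shows "\<bar>log_ratio s\<bar> \<le> - ln \<delta>"
proof -
  have s: "0 < s" "s < 1" using assms \<delta> by auto
  have "ln \<delta> \<le> ln s" "ln \<delta> \<le> ln (1 - s)" using assms \<delta> s by (auto intro!: ln_mono)
  moreover have "ln s \<le> 0" "ln (1 - s) \<le> 0" using s by auto
  moreover have "log_ratio s = ln (1 - s) - ln s" using s by (simp add: ln_div)
  ultimately show ?thesis by linarith
qed

lemma centered_steps_mu: "centered_steps mu log_ratio (- ln \<delta>)"
proof -
  interpret sequence_space mu by (rule sequence_space_mu)
  show ?thesis
  proof unfold_locales
    show "AE s in mu. \<bar>log_ratio s\<bar> \<le> - ln \<delta>"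
      using AE_elliptic_mu by eventually_elim (auto intro!: log_ratio_bounded)
    have "(\<integral>s. log_ratio s \<partial>distr (env_law mu) mu (\<lambda>w. w 1)) = (\<integral>w. log_ratio (w 1) \<partial>env_law mu)"
      by (rule integral_distr) measurable
    moreover have "(\<integral>s. log_ratio s \<partial>distr (env_law mu) mu (\<lambda>w. w 1)) = (\<integral>s. log_ratio s \<partial>mu)"
      using arg_cong[OF distr_env_component[of 1], of "\<lambda>N. integral\<^sup>L N log_ratio"] .
    ultimately have "(\<integral>s. log_ratio s \<partial>mu) = (\<integral>w. log_ratio (w 1) \<partial>env_law mu)" by (simp only:)
    then show "(\<integral>s. log_ratio s \<partial>mu) = 0" using centered by (simp add: rho_def)
    show "0 < - ln \<delta>" using \<delta> by simp
  qed measurable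
qed

text \<open>If \<open>v\<close> were 0, the log ratio would be almost surely nonpositive. Being
  centered it would then vanish almost surely, against the positive variance.\<close>

lemma valley_environment_mu: "valley_environment mu log_ratio (- ln \<delta>) K0"
proof -
  interpret centered_steps mu log_ratio "- ln \<delta>" by (rule centered_steps_mu)
  have sq: "integrable mu (\<lambda>s. (max (log_ratio s) 0)\<^sup>2)"
    using square_pos_part_integrable[of 0] by simp
  have "v \<noteq> 0"
  proof
    assume "v = 0"
    then have "AE s in mu. (max (log_ratio s) 0)\<^sup>2 = 0"
      unfolding v_def using integral_nonneg_eq_0_iff_AE[OF sq] by simp
    then have le: "AE s in mu. 0 \<le> - log_ratio s" by (auto elim!: eventually_mono simp: max_def split: if_splits)
    have "(\<integral>s. - log_ratio s \<partial>mu) = 0" using xi_centered by simp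
    then have "AE s in mu. - log_ratio s = 0"
      using integral_nonneg_eq_0_iff_AE[of mu "\<lambda>s. - log_ratio s"] le xi_integrable by simp
    then have zero: "AE s in mu. (log_ratio s)\<^sup>2 = 0" by (auto elim!: eventually_mono)
    have "prob_space.variance (env_law mu) (\<lambda>w. ln (rho w 1)) = (\<integral>w. (log_ratio (w 1))\<^sup>2 \<partial>env_law mu)"
      unfolding centered by (simp add: rho_def)
    also have "\<dots> = (\<integral>s. (log_ratio s)\<^sup>2 \<partial>distr (env_law mu) mu (\<lambda>w. w 1))"
      by (rule integral_distr[symmetric]) measurable
    also have "\<dots> = (\<integral>s. (log_ratio s)\<^sup>2 \<partial>mu)"
      using arg_cong[OF distr_env_component[of 1], of "\<lambda>N. integral\<^sup>L N (\<lambda>s. (log_ratio s)\<^sup>2)"] .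
    also have "\<dots> = 0" using zero by (rule integral_eq_zero_AE)
    finally show False using nondegenerate by simp
  qed
  moreover have "0 \<le> v" unfolding v_def by simp
  ultimately show ?thesis using K0 by unfold_locales auto
qed

lemma AE_trapped_environment:
  assumes \<gamma>: "1 / 2 \<le> \<gamma>" "\<gamma> < 1"
  shows "AE w in env_law mu. valleys (potential w) K0 \<and>
    (AE X in Q w. \<forall>\<^sub>F n in sequentially. \<exists>K\<ge>2. (\<forall>i\<le>n. X i < valley_start (potential w) K0 (K + 1)) \<and>
      visits (valley_start (potential w) K0 (K - 1)) (Suc n) X \<le> real n * exp (- (ln (real n) powr \<gamma> / 2)))"
proof -
  interpret valley_environment mu log_ratio "- ln \<delta>" K0 by (rule valley_environment_mu)
  \<comment> \<open>With \<open>\<gamma> = 1 - 4 * \<alpha>\<close>, the difference of the two sides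
    of the required inequality is a polynomial in \<open>\<alpha>\<close> with positive
    coefficients.\<close>
  define \<alpha> where "\<alpha> = (1 - \<gamma>) / 4"
  have \<alpha>: "0 < \<alpha>" "\<alpha> < 1" using \<gamma> by (auto simp: \<alpha>_def)
  have \<gamma>\<alpha>: "\<gamma> * (1 + \<alpha>)\<^sup>2 \<le> 1 - \<alpha>"
  proof -
    have \<gamma>_eq: "\<gamma> = 1 - 4 * \<alpha>" by (simp add: \<alpha>_def field_simps)
    have "1 - \<alpha> - \<gamma> * (1 + \<alpha>)\<^sup>2 = \<alpha> + 7 * \<alpha>\<^sup>2 + 4 * \<alpha> ^ 3"
      unfolding \<gamma>_eq by (simp add: power2_eq_square power3_eq_cube algebra_simps)
    moreover have "0 \<le> \<alpha> + 7 * \<alpha>\<^sup>2 + 4 * \<alpha> ^ 3" using \<alpha> by simp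
    ultimately show ?thesis by linarith
  qed
  have V: "V w = potential w" for w
    by (rule ext) (simp add: V_def walk_def potential_def rho_def sum.atLeast1_atMost_eq)
  have env: "env_law mu = S" by (simp add: env_law_def)
  have "AE w in S. \<delta> \<le> w x \<and> w x \<le> 1 - \<delta>" for x
    by (rule AE_PiM_component) (use AE_elliptic_mu prob_mu in auto)
  then have "AE w in S. \<forall>x. \<delta> \<le> w x \<and> w x \<le> 1 - \<delta>" by (simp add: AE_all_countable)
  moreover have "AE w in S. quenched_chain w (Q w)"
    using kernel unfolding quenched_kernel_def env by simp
  ultimately show ?thesis
    using AE_good AE_eventually_gaps[OF \<alpha>] AE_drawup_V_reached unfolding env V
  proof eventually_elim
    case (elim w)
    have val: "valleys (potential w) K0" using good_valleys[OF elim(3)] unfolding V .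
    have "prob_space (Q w)" using elim(2) by (simp add: quenched_chain_def)
    then have "quenched_walk (Q w) w \<delta>"
      using elim(1,2) \<delta> by (simp add: quenched_walk_def quenched_walk_axioms_def)
    then have "AE X in Q w. \<forall>\<^sub>F n in sequentially. \<exists>K\<ge>2. (\<forall>i\<le>n. X i < valley_start (potential w) K0 (K + 1)) \<and>
      visits (valley_start (potential w) K0 (K - 1)) (Suc n) X \<le> real n * exp (- (ln (real n) powr \<gamma> / 2))"
      using val good_step[OF elim(3)] elim(4,5) \<alpha> \<gamma>(1) \<gamma>\<alpha> unfolding V by (rule AE_trapped)
    with val show ?case by simp
  qed
qed

section \<open>From the quenched laws to the joint law\<close>

abbreviation "joint_space \<equiv> env_law mu \<Otimes>\<^sub>M path_space"

lemma AE_joint_law: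
  assumes pred: "Measurable.pred joint_space P"
    and AE: "AE w in env_law mu. AE X in Q w. P (w, X)"
  shows "AE p in joint_law mu Q. P p"
proof -
  have Q: "Q \<in> env_law mu \<rightarrow>\<^sub>M subprob_algebra path_space"
    using kernel by (auto simp: quenched_kernel_def intro: measurable_prob_algebraD)
  have "(\<lambda>w. distr (Q w) joint_space (\<lambda>X. (w, X))) \<in> env_law mu \<rightarrow>\<^sub>M subprob_algebra joint_space"
    by (rule measurable_distr2[OF _ Q]) simp
  then have "(AE p in joint_law mu Q. P p) \<longleftrightarrow>
      (AE w in env_law mu. AE p in distr (Q w) joint_space (\<lambda>X. (w, X)). P p)"
    unfolding joint_law_def using pred by (rule AE_bind)
  moreover have "AE w in env_law mu. AE p in distr (Q w) joint_space (\<lambda>X. (w, X)). P p"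
    using AE AE_space
  proof eventually_elim
    case (elim w)
    have "sets (Q w) = sets path_space" by (rule sets_kernel[OF Q elim(2)])
    then have "(\<lambda>X. (w, X)) \<in> Q w \<rightarrow>\<^sub>M joint_space"
      using elim(2) by (subst measurable_cong_sets[OF _ refl, of _ path_space]) auto
    then show ?case using elim(1) pred by (subst AE_distr_iff) (auto simp: pred_def)
  qed
  ultimately show ?thesis by simp
qed

lemma potential_joint_measurable: "(\<lambda>p. potential (fst p) x) \<in> borel_measurable joint_space"
proof -
  have "(\<lambda>p. log_ratio (fst p i)) \<in> borel_measurable joint_space" for i
    by (rule measurable_compose[OF measurable_fst], rule measurable_compose[OF component_env log_ratio_measurable])
  then show ?thesis unfolding potential_def rho_def by (rule borel_measurable_sum)
qed

lemma valley_start_joint [measurable]: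
  "(\<lambda>p. valley_start (potential (fst p)) K0 k) \<in> joint_space \<rightarrow>\<^sub>M count_space UNIV"
  by (rule measurable_valley_start[OF potential_joint_measurable])

lemma walk_joint [measurable]: "(\<lambda>p. snd p n) \<in> joint_space \<rightarrow>\<^sub>M count_space UNIV"
  by (rule measurable_compose[OF measurable_snd]) (simp add: path_space_def)

lemma valley_time_joint [measurable]:
  "(\<lambda>p. real (valley_time K0 (fst p) (snd p) n k)) \<in> borel_measurable joint_space"
proof -
  let ?m = "\<lambda>p k. valley_start (potential (fst p)) K0 k"
  have "real (valley_time K0 (fst p) (snd p) n k) =
      (\<Sum>j\<le>n. if ?m p k \<le> snd p j \<and> snd p j < ?m p (k + 1) then 1 else 0)" for p
  proof -
    have "(\<Sum>j\<le>n. if ?m p k \<le> snd p j \<and> snd p j < ?m p (k + 1) then 1 else 0) =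
        (\<Sum>j\<in>{j\<in>{..n}. ?m p k \<le> snd p j \<and> snd p j < ?m p (k + 1)}. 1 :: real)"
      by (rule sum.inter_filter[symmetric]) simp
    also have "\<dots> = real (valley_time K0 (fst p) (snd p) n k)"
      unfolding valley_time_eq_card by simp
    finally show ?thesis by simp
  qed
  moreover have "(\<lambda>p. \<Sum>j\<le>n. if ?m p k \<le> snd p j \<and> snd p j < ?m p (k + 1) then 1 else 0 :: real)
      \<in> borel_measurable joint_space"
    using pred_nat_compare[OF valley_start_joint walk_joint] pred_nat_compare[OF walk_joint valley_start_joint]
    by (intro borel_measurable_sum measurable_If measurable_const pred_intros_logic) auto
  ultimately show ?thesis by (simp only:)
qed

lemma valleys_seen_joint [measurable]:
  "(\<lambda>p. valleys_seen K0 (fst p) (snd p) n) \<in> joint_space \<rightarrow>\<^sub>M count_space UNIV"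
proof -
  have "(a \<le> Max (X ` {0..n})) \<longleftrightarrow> (\<exists>i\<le>n. a \<le> X i)" for a :: nat and X :: "nat \<Rightarrow> nat"
    by (subst Max_ge_iff) auto
  moreover note [measurable] = pred_nat_compare(1)[OF valley_start_joint walk_joint]
  ultimately show ?thesis unfolding valleys_seen_def by simp
qed

lemma seen_valleys_time_joint [measurable]:
  "(\<lambda>p. \<Sum>k | 1 \<le> k \<and> k + 1 < valleys_seen K0 (fst p) (snd p) n. real (valley_time K0 (fst p) (snd p) n k))
    \<in> borel_measurable joint_space"
  by (rule measurable_compose_countable[OF _ valleys_seen_joint]) measurable

end

theorem theorem3p4:
  fixes mu :: "real measure"
    and Q :: "(nat \<Rightarrow> real) \<Rightarrow> (nat \<Rightarrow> nat) measure"
    and \<delta> K0 :: real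
  assumes "prob_space mu" and "sets mu = sets borel"
    and "AE x in mu. 0 < x \<and> x < 1"
    and "prob_space.expectation (env_law mu) (\<lambda>w. ln (rho w 1)) = 0"
    and "prob_space.variance (env_law mu) (\<lambda>w. ln (rho w 1)) > 0"
    and "0 < \<delta>" and "\<delta> < 1"
    and "\<P>(w in env_law mu. \<delta> \<le> w 1 \<and> w 1 \<le> 1 - \<delta>) = 1"
    and "K0 > 0"
    and "quenched_kernel mu Q"
  shows "(\<forall>\<beta>::real. \<beta> < 1 \<longrightarrow>
           (AE (w, X) in joint_law mu Q.
              (\<lambda>n. exp (ln (real n) powr \<beta>) / real n *
                 (\<Sum>k | 1 \<le> k \<and> k + 1 < valleys_seen K0 w X n. real (valley_time K0 w X n k)))
              \<longlonglongrightarrow> 0)) \<and>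
         (AE (w, X) in joint_law mu Q.
            liminf (\<lambda>n. ereal (1 / real n * (SUP k\<in>{1..}. real (valley_time K0 w X n k)))) \<ge> 1 / 2)"
proof (intro conjI allI impI)
  note ctx = assms(1,2,4-10)
  note joint = AE_joint_law[OF ctx]
  note [measurable] = valley_time_joint[OF ctx] seen_valleys_time_joint[OF ctx]
  let ?f = "\<lambda>\<beta> w X n. exp (ln (real n) powr \<beta>) / real n *
    (\<Sum>k | 1 \<le> k \<and> k + 1 < valleys_seen K0 w X n. real (valley_time K0 w X n k))"
  fix \<beta> :: real assume "\<beta> < 1"
  \<comment> \<open>Strictly between \<open>\<beta>\<close> and 1, and at least 1/2 as the
    summability of the trap bounds requires.\<close>
  define \<gamma> where "\<gamma> = max (1 / 2) ((1 + \<beta>) / 2)"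
  have \<gamma>: "1 / 2 \<le> \<gamma>" "\<gamma> < 1" "\<beta> < \<gamma>" using \<open>\<beta> < 1\<close> by (auto simp: \<gamma>_def less_max_iff_disj)
  \<comment> \<open>\<open>AE_joint_law\<close> needs a measurable predicate, so convergence is
    written with countable quantifiers; an upper bound suffices because the quantity is
    nonnegative.\<close>
  have "AE p in joint_law mu Q. \<forall>q::nat. \<exists>n0. \<forall>n\<ge>n0. ?f \<beta> (fst p) (snd p) n < 1 / (real q + 1)"
  proof (rule joint)
    show "AE w in env_law mu. AE X in Q w. \<forall>q::nat. \<exists>n0. \<forall>n\<ge>n0. ?f \<beta> (fst (w, X)) (snd (w, X)) n < 1 / (real q + 1)"
      using AE_trapped_environment[OF ctx \<gamma>(1,2)]
    proof eventually_elim
      case (elim w)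
      from conjunct2[OF elim] show ?case
      proof eventually_elim
        case (elim X)
        have "?f \<beta> w X \<longlonglongrightarrow> 0"
          by (rule localization_of_trapped(1)[OF conjunct1[OF \<open>_ \<and> _\<close>] _ \<gamma>(3) elim]) (use \<gamma> in simp)
        then show ?case
          unfolding eventually_sequentially[symmetric] by (auto intro!: order_tendstoD(2))
      qed
    qed
  qed measurable
  then show "AE (w, X) in joint_law mu Q. ?f \<beta> w X \<longlonglongrightarrow> 0"
  proof eventually_elim
    case (elim p)
    obtain w X where p: "p = (w, X)" by (cases p)
    have "?f \<beta> w X \<longlonglongrightarrow> 0"
    proof (rule LIMSEQ_I)
      fix r :: real assume "0 < r"
      then obtain q :: nat where q: "1 / (real q + 1) < r"
        using reals_Archimedean[of r] by (auto simp: inverse_eq_divide add.commute)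
      obtain n0 where "\<And>n. n0 \<le> n \<Longrightarrow> ?f \<beta> w X n < 1 / (real q + 1)" using elim p by auto
      moreover have "0 \<le> ?f \<beta> w X n" for n
        by (intro mult_nonneg_nonneg divide_nonneg_nonneg sum_nonneg) auto
      ultimately show "\<exists>n0. \<forall>n\<ge>n0. norm (?f \<beta> w X n - 0) < r"
        using q by (intro exI[of _ n0]) (auto intro: less_trans simp del: times_divide_eq_left)
    qed
    then show ?case by (simp add: p)
  qed
next
  note ctx = assms(1,2,4-10)
  note [measurable] = valley_time_joint[OF ctx]
  have half: "(1 / 2 :: real) < 1" by simp
  \<comment> \<open>Transferred before supremum and lower limit are formed: in this shape only
    countable quantifiers over the measurable valley times occur.\<close>
  have "AE p in joint_law mu Q. \<forall>q::nat. \<exists>n0. \<forall>n\<ge>n0. \<exists>k\<ge>1.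
      (1 / 2 - 1 / (real q + 1)) * real n \<le> real (valley_time K0 (fst p) (snd p) n k)"
  proof (rule AE_joint_law[OF ctx])
    show "AE w in env_law mu. AE X in Q w. \<forall>q::nat. \<exists>n0. \<forall>n\<ge>n0. \<exists>k\<ge>1.
      (1 / 2 - 1 / (real q + 1)) * real n \<le> real (valley_time K0 (fst (w, X)) (snd (w, X)) n k)"
      using AE_trapped_environment[OF ctx order.refl half]
    proof eventually_elim
      case (elim w)
      from conjunct2[OF elim] show ?case
      proof eventually_elim
        case (elim X)
        show ?case
          unfolding eventually_sequentially[symmetric] fst_conv snd_conv
          by (intro allI localization_of_trapped(2)[OF conjunct1[OF \<open>_ \<and> _\<close>] _ _ elim, where \<beta> = 0]) auto
      qed
    qed
  qed measurable
  then show "AE (w, X) in joint_law mu Q.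
      liminf (\<lambda>n. ereal (1 / real n * (SUP k\<in>{1..}. real (valley_time K0 w X n k)))) \<ge> 1 / 2"
  proof eventually_elim
    case (elim p)
    obtain w X where p: "p = (w, X)" by (cases p)
    have "liminf (\<lambda>n. ereal (1 / real n * (SUP k\<in>{1..}. real (valley_time K0 w X n k)))) \<ge> 1 / 2"
      by (rule liminf_valley_time) (use elim p in \<open>auto simp: eventually_sequentially\<close>)
    then show ?case by (simp add: p)
  qed
qed

end
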